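(* Let $\mathcal{M}$ be the free multiplicative abelian monoid generated by a set $\mathcal{P}$, endowed with a norm $\mathbf{N}:\mathcal{M}\to\mathbb{N}$, satisfying the growth conditions (G1) and (G2) stated in the context. Let $g:\mathcal{M}\to\mathbb{N}$ be a strongly additive function and $\rho$ a probability measure on $\mathbb{R}$ satisfying conditions (A1) and (A2) stated in the context. For each positive integer $X$ let $V(X)$ be a uniformly random element of the finite set $\{m\in\mathcal{M}:\mathbf{N}(m)\le X\}$, and let $W(X):=g(V(X))$. Then $\frac{W(X)}{\log\log X}$ satisfies a large deviation principle with speed $\log\log X$ and rate function $$I(x):=\sup_{\theta\in\mathbb{R}}\left\{\theta x-\int_{\mathbb{R}}(e^{\theta y}-1)\,\rho(dy)\right\};$$ that is, for every Borel measurable set $A\subset\mathbb{R}$, $$-\inf_{x\in A^o}I(x)\le\liminf_{X\to\infty}\frac{1}{\log\log X}\log\mathbb{P}\left[\frac{W(X)}{\log\log X}\in A\right]\le\limsup_{X\to\infty}\frac{1}{\log\log X}\log\mathbb{P}\left[\frac{W(X)}{\log\log X}\in A\right]\le-\inf_{x\in\overline{A}}I(x),$$ where $A^o$ is the interior of $A$ and $\overline{A}$ is the closure of $A$.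
   Context: Setting. $\mathcal{P}$ is a set with a map $\mathbf{N}:\mathcal{P}\to\{2,3,4,\dots\}$. $\mathcal{M}$ is the free multiplicative abelian monoid on $\mathcal{P}$: every $m\in\mathcal{M}$ is uniquely $m=\prod_{p\in\mathcal{P}}p^{e_p}$ with $e_p\in\mathbb{Z}_{\ge0}$, almost all zero. $\mathbf{N}$ is extended to $\mathcal{M}$ multiplicatively: $\mathbf{N}(m)=\prod_p\mathbf{N}(p)^{e_p}$. Sums over $p$ run over $p\in\mathcal{P}$. Growth conditions: (G1) $\#\{m\in\mathcal{M}:\mathbf{N}(m)\le X\}=aX+O(X^b)$ for some $a>0$ and $b\in[0,1)$; (G2) $\#\{p\in\mathcal{P}:\mathbf{N}(p)\le X\}=O\left(\frac{X}{\log X}\right)$. Strongly additive function: $g:\mathcal{M}\to\mathbb{N}$ (here $0\in\mathbb{N}$) satisfies $g(p^k)=g(p)$ for all $p\in\mathcal{P}$, $k\ge1$, and $g(mn)=g(m)+g(n)$ whenever $m,n\in\mathcal{M}$ are coprime (no $p\in\mathcal{P}$ divides both). Conditions on $g$ and $\rho$: (A1) $\int_{\mathbb{R}}e^{\theta y}\rho(dy)<\infty$ for every $\theta\in\mathbb{R}$; (A2) defining, for $X$ large enough that the denominator is nonzero, the probability measures $$\rho_X(A):=\frac{\sum_{g(p)\in A,\ \mathbf{N}(p)\le X}\frac{1}{\mathbf{N}(p)}}{\sum_{\mathbf{N}(p)\le X}\frac{1}{\mathbf{N}(p)}}\qquad(A\subset\mathbb{R}\text{ Borel}),$$ one has $\int_{\mathbb{R}}e^{\theta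 y}\rho_X(dy)\to\int_{\mathbb{R}}e^{\theta y}\rho(dy)$ as $X\to\infty$ for every $\theta\in\mathbb{R}$. Conventions: $\log0=-\infty$ and $\inf\emptyset=+\infty$. *)

theory Defs
  imports "HOL-Probability.Probability"
begin

text \<open>
  The free abelian monoid on P is the set of finite multisets over P. The library writes it
  additively: the unit is the empty multiset, the product of m and n is \<open>m + n\<close>,
  the generator p is \<open>{#p#}\<close>, and its power with exponent k is \<open>replicate_mset k p\<close>.
\<close>

definition free_monoid :: "'p set \<Rightarrow> 'p multiset set" where
  "free_monoid P = {m. set_mset m \<subseteq> P}"

definition mnorm :: "('p \<Rightarrow> nat) \<Rightarrow> 'p multiset \<Rightarrow> nat" where
  "mnorm N m = (\<Prod>p\<in>#m. N p)"

definition monoid_upto :: "'p set \<Rightarrow> ('p \<Rightarrow> nat) \<Rightarrow> real \<Rightarrow> 'p multiset set" where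
  "monoid_upto P N X = {m \<in> free_monoid P. real (mnorm N m) \<le> X}"

definition gens_upto :: "'p set \<Rightarrow> ('p \<Rightarrow> nat) \<Rightarrow> real \<Rightarrow> 'p set" where
  "gens_upto P N X = {p \<in> P. real (N p) \<le> X}"

text \<open>
  Finiteness of the counted sets is implicit in the asymptotics; it is spelled out because
  \<open>card\<close> of an infinite set is 0.
\<close>

definition growth_monoid :: "'p set \<Rightarrow> ('p \<Rightarrow> nat) \<Rightarrow> bool" where
  "growth_monoid P N \<longleftrightarrow>
     (\<forall>X. finite (monoid_upto P N X)) \<and>
     (\<exists>a b. a > 0 \<and> 0 \<le> b \<and> b < 1 \<and>
        (\<lambda>X. real (card (monoid_upto P N X)) - a * X) \<in> O[at_top](\<lambda>X. X powr b))"

definition growth_gens :: "'p set \<Rightarrow> ('p \<Rightarrow> nat) \<Rightarrow> bool" where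
  "growth_gens P N \<longleftrightarrow>
     (\<forall>X. finite (gens_upto P N X)) \<and>
     (\<lambda>X. real (card (gens_upto P N X))) \<in> O[at_top](\<lambda>X. X / ln X)"

definition coprime_on :: "'p set \<Rightarrow> 'p multiset \<Rightarrow> 'p multiset \<Rightarrow> bool" where
  "coprime_on P m n \<longleftrightarrow> \<not> (\<exists>p\<in>P. p \<in># m \<and> p \<in># n)"

definition strongly_additive :: "'p set \<Rightarrow> ('p multiset \<Rightarrow> nat) \<Rightarrow> bool" where
  "strongly_additive P g \<longleftrightarrow>
     (\<forall>p\<in>P. \<forall>k\<ge>1. g (replicate_mset k p) = g {#p#}) \<and>
     (\<forall>m\<in>free_monoid P. \<forall>n\<in>free_monoid P. coprime_on P m n \<longrightarrow> g (m + n) = g m + g n)"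

definition rho_upto ::
  "'p set \<Rightarrow> ('p \<Rightarrow> nat) \<Rightarrow> ('p multiset \<Rightarrow> nat) \<Rightarrow> real \<Rightarrow> real measure" where
  "rho_upto P N g X = measure_of UNIV (sets borel)
     (\<lambda>A. ennreal ((\<Sum>p | p \<in> gens_upto P N X \<and> real (g {#p#}) \<in> A. 1 / real (N p))
                 / (\<Sum>p\<in>gens_upto P N X. 1 / real (N p))))"

text \<open>
  \<open>measure_of\<close> falls back to the null measure if the given set function is not
  a measure; the next two lemmas show that this does not happen here.
\<close>

lemma sets_rho_upto: "sets (rho_upto P N g X) = sets borel"
  unfolding rho_upto_def
  using sets.sets_measure_of_eq[of "borel::real measure"] by (simp only: space_borel)

lemma emeasure_rho_upto:
  assumes fin: "finite (gens_upto P N X)" and A: "A \<in> sets borel"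
  shows "emeasure (rho_upto P N g X) A =
     ennreal ((\<Sum>p | p \<in> gens_upto P N X \<and> real (g {#p#}) \<in> A. 1 / real (N p))
            / (\<Sum>p\<in>gens_upto P N X. 1 / real (N p)))"
proof -
  let ?G = "gens_upto P N X"
  let ?T = "\<Sum>p\<in>?G. 1 / real (N p)"
  let ?f = "\<lambda>A. ennreal ((\<Sum>p | p \<in> ?G \<and> real (g {#p#}) \<in> A. 1 / real (N p)) / ?T)"
  let ?D = "distr (point_measure ?G (\<lambda>p. ennreal (1 / real (N p) / ?T))) borel (\<lambda>p. real (g {#p#}))"
  have T: "?T \<ge> 0" by (simp add: sum_nonneg)
  have D: "emeasure ?D B = ?f B" if B: "B \<in> sets borel" for B
  proof -
    let ?S = "{p. p \<in> ?G \<and> real (g {#p#}) \<in> B}"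
    have "emeasure ?D B = (\<Sum>p\<in>?S. ennreal (1 / real (N p) / ?T))"
      using B fin
      by (subst emeasure_distr)
         (auto simp: space_point_measure emeasure_point_measure_finite2 vimage_def Int_def conj_commute
               measurable_def sets_point_measure)
    also have "\<dots> = ennreal (\<Sum>p\<in>?S. 1 / real (N p) / ?T)"
      using T by (intro sum_ennreal) (simp add: divide_nonneg_nonneg)
    finally show ?thesis by (simp add: sum_divide_distrib)
  qed
  have "rho_upto P N g X = ?D"
  proof -
    have "?D = measure_of UNIV (sets borel) (emeasure ?D)"
      using measure_of_of_measure[of ?D] by simp
    also have "\<dots> = rho_upto P N g X"
      unfolding rho_upto_def
    proof (rule measure_of_eq)
      fix B assume "B \<in> sigma_sets UNIV (sets (borel :: real measure))"
      then have "B \<in> sets borel"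
        using sets.sigma_sets_eq[of "borel :: real measure"] by simp
      then show "emeasure ?D B = ?f B" by (rule D)
    qed simp
    finally show ?thesis by simp
  qed
  with D A show ?thesis by simp
qed

text \<open>Extended logarithm with log 0 = -infinity\<close>

definition elog :: "real \<Rightarrow> ereal" where
  "elog x = (if x = 0 then - \<infinity> else ereal (ln x))"

definition large_deviation_principle ::
  "(nat \<Rightarrow> real measure) \<Rightarrow> (nat \<Rightarrow> real) \<Rightarrow> (real \<Rightarrow> ereal) \<Rightarrow> bool" where
  "large_deviation_principle \<mu> s I \<longleftrightarrow>
     (\<forall>A\<in>sets borel.
        - (INF x\<in>interior A. I x) \<le> liminf (\<lambda>X. elog (measure (\<mu> X) A) / ereal (s X)) \<and>
        liminf (\<lambda>X. elog (measure (\<mu> X) A) / ereal (s X))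
          \<le> limsup (\<lambda>X. elog (measure (\<mu> X) A) / ereal (s X)) \<and>
        limsup (\<lambda>X. elog (measure (\<mu> X) A) / ereal (s X)) \<le> - (INF x\<in>closure A. I x))"

definition rate_function :: "real measure \<Rightarrow> real \<Rightarrow> ereal" where
  "rate_function \<rho> x = (SUP \<theta>. ereal (\<theta> * x - (\<integral>y. (exp (\<theta> * y) - 1) \<partial>\<rho>)))"

text \<open>
  Under \<open>growth_monoid\<close> the set \<open>monoid_upto P N (real X)\<close> is finite, and for X at
  least 1 it contains the unit, so \<open>pmf_of_set\<close> is the uniform distribution on it.
\<close>

definition V_pmf :: "'p set \<Rightarrow> ('p \<Rightarrow> nat) \<Rightarrow> nat \<Rightarrow> 'p multiset pmf" where
  "V_pmf P N X = pmf_of_set (monoid_upto P N (real X))"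

definition W_pmf :: "'p set \<Rightarrow> ('p \<Rightarrow> nat) \<Rightarrow> ('p multiset \<Rightarrow> nat) \<Rightarrow> nat \<Rightarrow> nat pmf" where
  "W_pmf P N g X = map_pmf g (V_pmf P N X)"

end

(*
The logarithmic moment generating function of W(X) is log log X times kappa(theta) + o(1), where
kappa(theta) is the integral of exp(theta y) - 1 against rho; the Gaertner-Ellis theorem then gives
the large deviation principle, as kappa is finite and differentiable on the whole real line.

To evaluate the mean of the multiplicative function h = exp(theta g) up to powers (log X)^o(1), insert
log N(m) = sum of log N(p) over the prime powers p^j dividing m. This gives
  sum_{N(m) <= X} h(m) log N(m) = sum_n sum_{p^j <= X/N(n)} log N(p) h(p^j n),
where h(p^j n) and h(n) differ by a factor of at most exp(|theta| g(p)). By (A2) at large multiples of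
theta this factor is at most (log X)^eps outside a negligible set of p, and with Chebyshev's bounds the
mean of h becomes comparable to (1 / log X) sum h(n) / N(n), hence to the Euler product of h divided by
log X. The lower Chebyshev bound comes from Mertens' theorem, and the same argument with h = 1 shows
that the sum of 1 / N(p) is asymptotic to log log X.
*)
theory Submission
  imports Defs "HOL-Real_Asymp.Real_Asymp"
begin

section \<open>The Gaertner-Ellis theorem on the real line\<close>

text \<open>Since the speed is log log X, a factor (log X)^eps moves the scaled logarithm of a mean
  by eps only. Hence no asymptotic formula for the mean of h is sought: each estimate may lose such
  a factor, and the losses are sent to zero at the end. The upper bound by an Euler product costs
  little, but in the lower bound the product over N(p) <= z contains elements of norm far beyond X.
  The remedy is z = exp((log X)^(1-d)): log log z is still (1-d) log log X, while under the weights
  of the product the mean of log N is at most log z times a multiple of log log X, which is o(log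
  X). So half of the mass lies below sqrt X, where X / N(n) remains large enough for the lower
  Chebyshev bound. For h = 1 the size of the sum of 1 / N(p) is what is sought, so there the cut
  comes from Mertens' theorem instead. On the probabilistic side, convexity and differentiability of
  the limit enter as a family of tangent lines whose slope \<open>\<kappa>'\<close> is continuous;
  this form is verified directly from 1 + u <= exp u.\<close>

locale scaled_mgf_limit =
  fixes \<mu> :: "nat \<Rightarrow> real measure" and s :: "nat \<Rightarrow> real" and \<kappa> \<kappa>' :: "real \<Rightarrow> real"
  assumes prob: "\<And>n. prob_space (\<mu> n)"
    and sets_mu: "\<And>n. sets (\<mu> n) = sets borel"
    and speed: "filterlim s at_top sequentially"
    and mgf_integrable: "\<And>\<theta>. \<forall>\<^sub>F n in sequentially. integrable (\<mu> n) (\<lambda>y. exp (\<theta> * s n * y))"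
    and mgf_limit: "\<And>\<theta>. (\<lambda>n. ln (\<integral>y. exp (\<theta> * s n * y) \<partial>\<mu> n) / s n) \<longlonglongrightarrow> \<kappa> \<theta>"
    and subgradient: "\<And>\<eta> \<theta>. \<kappa> \<eta> + (\<theta> - \<eta>) * \<kappa>' \<eta> \<le> \<kappa> \<theta>"
    and continuous_subgradient: "continuous_on UNIV \<kappa>'"
begin

section \<open>Moment generating functions on the exponential scale\<close>

lemma measurable_mu [simp]: "borel_measurable (\<mu> n) = borel_measurable borel"
  using sets_mu by (intro measurable_cong_sets) auto

lemma space_mu [simp]: "space (\<mu> n) = UNIV"
  using sets_mu[of n] sets_eq_imp_space_eq[of "\<mu> n" borel] by simp

lemma speed_pos: "\<forall>\<^sub>F n in sequentially. 0 < s n"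
  using speed by (simp add: filterlim_at_top_dense)

text \<open>Constant factors are invisible on the exponential scale: any gap between two exponents
  absorbs them once the speed is large.\<close>

lemma exp_speed_dominates:
  assumes "a < b" "0 \<le> K"
  shows "\<forall>\<^sub>F n in sequentially. K * exp (a * s n) \<le> exp (b * s n)"
proof -
  have "\<forall>\<^sub>F n in sequentially. ln (K + 1) / (b - a) \<le> s n"
    using speed by (simp add: filterlim_at_top)
  then show ?thesis
  proof eventually_elim
    case (elim n)
    then have "ln (K + 1) \<le> (b - a) * s n"
      using assms by (simp add: field_simps)
    then have "exp (ln (K + 1)) \<le> exp ((b - a) * s n)" by simp
    then have "K \<le> exp ((b - a) * s n)" using assms by simp
    then have "K * exp (a * s n) \<le> exp ((b - a) * s n) * exp (a * s n)"
      by (intro mult_right_mono) auto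
    also have "\<dots> = exp (b * s n)"
      by (simp add: exp_add[symmetric] algebra_simps)
    finally show ?case .
  qed
qed

text \<open>Bounds on \<open>ln\<close> can be turned back into bounds on its argument only if that
  is positive.\<close>

lemma mgf_pos:
  assumes "integrable (\<mu> n) (\<lambda>y. exp (\<theta> * s n * y))"
  shows "0 < (\<integral>y. exp (\<theta> * s n * y) \<partial>\<mu> n)"
proof -
  interpret prob_space "\<mu> n" by (rule prob)
  have "(\<integral>y. exp (\<theta> * s n * y) \<partial>\<mu> n) \<noteq> 0"
    using assms by (subst integral_nonneg_eq_0_iff_AE) auto
  moreover have "(\<integral>y. exp (\<theta> * s n * y) \<partial>\<mu> n) \<ge> 0" by simp
  ultimately show ?thesis by linarith
qed

lemma mgf_bounds:
  assumes "a < \<kappa> \<theta>" "\<kappa> \<theta> < b"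
  shows "\<forall>\<^sub>F n in sequentially. exp (a * s n) \<le> (\<integral>y. exp (\<theta> * s n * y) \<partial>\<mu> n) \<and>
           (\<integral>y. exp (\<theta> * s n * y) \<partial>\<mu> n) \<le> exp (b * s n)"
  using order_tendstoD(1)[OF mgf_limit assms(1)] order_tendstoD(2)[OF mgf_limit assms(2)]
    mgf_integrable[of \<theta>] speed_pos
proof eventually_elim
  case (elim n)
  let ?Z = "\<integral>y. exp (\<theta> * s n * y) \<partial>\<mu> n"
  have "a * s n \<le> ln ?Z" "ln ?Z \<le> b * s n"
    using elim by (simp_all add: field_simps)
  then show ?case
    using mgf_pos[OF elim(3)] by (metis exp_le_cancel_iff exp_ln)
qed

lemma kappa_0: "\<kappa> 0 = 0"
proof -
  have "(\<lambda>n. ln (\<integral>y. exp (0 * s n * y) \<partial>\<mu> n) / s n) = (\<lambda>n. 0)"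
    using prob_space.prob_space[OF prob] by simp
  then show ?thesis
    using mgf_limit[of 0] LIMSEQ_unique tendsto_const by metis
qed

text \<open>
  The case \<open>\<eta> = 0\<close> is Chernoff's bound; general \<open>\<eta>\<close> makes it
  available under the exponentially tilted measures.
\<close>

lemma tilted_tail:
  assumes B: "B \<in> sets borel" and v: "\<And>y. y \<in> B \<Longrightarrow> v \<le> t * y" and c: "c < v - \<kappa> (\<eta> + t)"
  shows "\<forall>\<^sub>F n in sequentially. integrable (\<mu> n) (\<lambda>y. indicator B y * exp (\<eta> * s n * y)) \<and>
           (\<integral>y. indicator B y * exp (\<eta> * s n * y) \<partial>\<mu> n) \<le> exp (- c * s n)"
proof -
  have "\<kappa> (\<eta> + t) < v - c" "\<kappa> (\<eta> + t) - 1 < \<kappa> (\<eta> + t)"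
    using c by auto
  from mgf_bounds[OF this(2,1)] mgf_integrable[of "\<eta> + t"] mgf_integrable[of \<eta>] speed_pos
  show ?thesis
  proof eventually_elim
    case (elim n)
    let ?f = "\<lambda>y. indicator B y * exp (\<eta> * s n * y)"
    let ?h = "\<lambda>y. exp (- v * s n) * exp ((\<eta> + t) * s n * y)"
    have i: "integrable (\<mu> n) ?f"
      using integrable_mult_indicator[of B "\<mu> n", OF _ elim(3)] B by (simp add: sets_mu)
    \<comment> \<open>On \<open>B\<close> the factor \<open>exp (s n * (t * y - v))\<close> is at
      least 1 and may replace the indicator; this moves the tilt from \<open>\<eta>\<close> to
      \<open>\<eta> + t\<close>.\<close>
    have "(\<integral>y. ?f y \<partial>\<mu> n) \<le> (\<integral>y. ?h y \<partial>\<mu> n)"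
    proof (rule integral_mono[OF i])
      show "integrable (\<mu> n) ?h" using elim by simp
      fix y show "?f y \<le> ?h y"
      proof (cases "y \<in> B")
        case True
        have "v * s n \<le> t * y * s n" using v[OF True] elim by (intro mult_right_mono) auto
        then have "\<eta> * s n * y \<le> - v * s n + (\<eta> + t) * s n * y"
          by (simp add: algebra_simps)
        then show ?thesis using True by (simp add: exp_add[symmetric])
      qed simp
    qed
    also have "\<dots> = exp (- v * s n) * (\<integral>y. exp ((\<eta> + t) * s n * y) \<partial>\<mu> n)"
      by simp
    also have "\<dots> \<le> exp (- v * s n) * exp ((v - c) * s n)"
      using elim by (intro mult_left_mono) auto
    also have "\<dots> = exp (- c * s n)" by (simp add: exp_add[symmetric] algebra_simps)
    finally show ?case using i by simp
  qed
qed

lemma chernoff: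
  assumes "B \<in> sets borel" "\<And>y. y \<in> B \<Longrightarrow> v \<le> \<theta> * y" "c < v - \<kappa> \<theta>"
  shows "\<forall>\<^sub>F n in sequentially. measure (\<mu> n) B \<le> exp (- c * s n)"
  using tilted_tail[of B v \<theta> c 0] assms by (auto simp: sets_mu elim: eventually_mono)

text \<open>Cramer's change of measure. The weight \<open>exp (\<eta> * s n * y)\<close> moves the
  mass to \<open>\<kappa>' \<eta>\<close>: both tails carry exponentially less than the total
  weight, so most of it stays in the ball, where removing the weight costs at most
  \<open>\<eta> * \<kappa>' \<eta> + \<bar>\<eta>\<bar> * d\<close> in the exponent.\<close>

lemma ball_lower_bound:
  assumes d: "0 < d" and c: "\<eta> * \<kappa>' \<eta> - \<kappa> \<eta> + \<bar>\<eta>\<bar> * d < c"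
  shows "\<forall>\<^sub>F n in sequentially. exp (- c * s n) \<le> measure (\<mu> n) {\<kappa>' \<eta> - d<..<\<kappa>' \<eta> + d}"
proof -
  let ?x = "\<kappa>' \<eta>"
  have "isCont \<kappa>' \<eta>"
    using continuous_subgradient by (simp add: continuous_on_eq_continuous_at)
  then obtain r where r: "0 < r" "\<And>\<theta>. dist \<theta> \<eta> < r \<Longrightarrow> dist (\<kappa>' \<theta>) ?x < d"
    using d unfolding continuous_at_eps_delta by (metis dist_commute)
  define t where "t = r / 2"
  have t: "0 < t" "\<kappa>' (\<eta> + t) < ?x + d" "?x - d < \<kappa>' (\<eta> - t)"
    using r(1) r(2)[of "\<eta> + t"] r(2)[of "\<eta> - t"] by (auto simp: t_def dist_real_def)
  \<comment> \<open>The tangent line is taken at \<open>\<eta> + t\<close>, not at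
    \<open>\<eta>\<close>: it gives \<open>\<kappa> (\<eta> + t) \<le> \<kappa> \<eta> + t *
    \<kappa>' (\<eta> + t)\<close>, and by continuity this slope is strictly below
    \<open>?x + d\<close>. Strictness is what makes the tail exponentially smaller.\<close>
  have up: "- \<kappa> \<eta> < t * (?x + d) - \<kappa> (\<eta> + t)"
    using subgradient[of "\<eta> + t" \<eta>] mult_strict_left_mono[OF t(2,1)] by simp
  have lo: "- \<kappa> \<eta> < - t * (?x - d) - \<kappa> (\<eta> - t)"
    using subgradient[of "\<eta> - t" \<eta>] mult_strict_left_mono[OF t(3,1)] by simp
  define b where "b = min (t * (?x + d) - \<kappa> (\<eta> + t)) (- t * (?x - d) - \<kappa> (\<eta> - t))"
  have "- \<kappa> \<eta> < b" using up lo by (simp add: b_def)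
  then obtain c1 where c1: "- \<kappa> \<eta> < c1" "c1 < b" using dense by blast
  have "max (\<eta> * ?x + \<bar>\<eta>\<bar> * d - c) (- c1) < \<kappa> \<eta>" using c c1 by simp
  then obtain e where e: "max (\<eta> * ?x + \<bar>\<eta>\<bar> * d - c) (- c1) < e" "e < \<kappa> \<eta>" using dense by blast
  have T1: "\<forall>\<^sub>F n in sequentially. integrable (\<mu> n) (\<lambda>y. indicator {?x + d..} y * exp (\<eta> * s n * y)) \<and>
           (\<integral>y. indicator {?x + d..} y * exp (\<eta> * s n * y) \<partial>\<mu> n) \<le> exp (- c1 * s n)"
    by (rule tilted_tail[where v = "t * (?x + d)" and t = t]) (use c1 t b_def in auto)
  have T2: "\<forall>\<^sub>F n in sequentially. integrable (\<mu> n) (\<lambda>y. indicator {..?x - d} y * exp (\<eta> * s n * y)) \<and>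
           (\<integral>y. indicator {..?x - d} y * exp (\<eta> * s n * y) \<partial>\<mu> n) \<le> exp (- c1 * s n)"
    by (rule tilted_tail[where v = "- t * (?x - d)" and t = "-t"]) (use c1 t b_def in auto)
  \<comment> \<open>With 4 and 2 as factors, the two tails together take at most half of
    \<open>exp (e * s n)\<close>, and the target takes at most the other half.\<close>
  have D1: "\<forall>\<^sub>F n in sequentially. 4 * exp (- c1 * s n) \<le> exp (e * s n)"
    using e by (intro exp_speed_dominates) auto
  have D2: "\<forall>\<^sub>F n in sequentially. 2 * exp ((\<eta> * ?x + \<bar>\<eta>\<bar> * d - c) * s n) \<le> exp (e * s n)"
    using e by (intro exp_speed_dominates) auto
  have "\<kappa> \<eta> < \<kappa> \<eta> + 1" by simp
  from mgf_bounds[OF e(2) this] T1 T2 D1 D2 mgf_integrable[of \<eta>] speed_pos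
  show ?thesis
  proof eventually_elim
    case (elim n)
    interpret prob_space "\<mu> n" by (rule prob)
    let ?B = "{?x - d<..<?x + d}"
    let ?f = "\<lambda>y. exp (\<eta> * s n * y)"
    let ?K = "exp ((\<eta> * ?x + \<bar>\<eta>\<bar> * d) * s n)"
    have i: "integrable (\<mu> n) (\<lambda>y. ?K * indicator ?B y)"
    proof (rule integrable_mult_right, rule integrable_real_indicator)
      show "?B \<in> events" unfolding sets_mu by (rule borel_open) simp
      show "emeasure (\<mu> n) ?B < \<infinity>" by (simp add: emeasure_finite less_top[symmetric])
    qed
    have "(\<integral>y. ?f y \<partial>\<mu> n) \<le> (\<integral>y. ?K * indicator ?B y + (indicator {?x + d..} y * ?f y
              + indicator {..?x - d} y * ?f y) \<partial>\<mu> n)"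
    proof (rule integral_mono)
      fix y
      show "?f y \<le> ?K * indicator ?B y + (indicator {?x + d..} y * ?f y + indicator {..?x - d} y * ?f y)"
      proof (cases "y \<in> ?B")
        case True
        have "\<eta> * (y - ?x) \<le> \<bar>\<eta>\<bar> * d"
          using True by (rule_tac order_trans[OF abs_ge_self]) (auto simp: abs_mult abs_le_iff intro!: mult_left_mono)
        then have "\<eta> * y \<le> \<eta> * ?x + \<bar>\<eta>\<bar> * d" by (simp add: algebra_simps)
        then have "\<eta> * y * s n \<le> (\<eta> * ?x + \<bar>\<eta>\<bar> * d) * s n" using elim by (intro mult_right_mono) auto
        then show ?thesis using True by (simp add: algebra_simps indicator_def)
      qed (auto simp: indicator_def)
    qed (use elim i in auto)
    also have "\<dots> = ?K * prob ?B + ((\<integral>y. indicator {?x + d..} y * ?f y \<partial>\<mu> n)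
              + (\<integral>y. indicator {..?x - d} y * ?f y \<partial>\<mu> n))"
      using elim i by (simp add: sets_mu)
    finally have "exp (e * s n) \<le> ?K * prob ?B + 2 * exp (- c1 * s n)"
      using elim by linarith
    then have "2 * exp ((\<eta> * ?x + \<bar>\<eta>\<bar> * d - c) * s n) \<le> 2 * (?K * prob ?B)"
      using elim by linarith
    moreover have "exp ((\<eta> * ?x + \<bar>\<eta>\<bar> * d - c) * s n) = ?K * exp (- c * s n)"
      by (simp add: exp_add[symmetric] algebra_simps)
    ultimately show ?case by simp
  qed
qed

section \<open>The Legendre transform and the two large deviation bounds\<close>

definition rate :: "real \<Rightarrow> ereal" where
  "rate x = (SUP \<theta>. ereal (\<theta> * x - \<kappa> \<theta>))"

lemma subgradient_mono: "\<eta> \<le> \<theta> \<Longrightarrow> \<kappa>' \<eta> \<le> \<kappa>' \<theta>"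
  using subgradient[of \<eta> \<theta>] subgradient[of \<theta> \<eta>] 
  by (cases "\<eta> = \<theta>") (auto simp: algebra_simps intro: mult_left_le_imp_le[of "\<theta> - \<eta>"])

text \<open>
  A point of finite rate may lie on the boundary of the range of \<open>\<kappa>'\<close>, outside it;
  then \<open>\<theta> x - \<kappa> \<theta>\<close> is monotone, and the values \<open>\<kappa>' n\<close> approach \<open>x\<close>
  without exceeding its rate.
\<close>

lemma approximate_by_exposed:
  assumes fin: "rate x \<noteq> \<infinity>" and U: "open U" "x \<in> U"
  shows "\<exists>\<eta>. \<kappa>' \<eta> \<in> U \<and> ereal (\<eta> * \<kappa>' \<eta> - \<kappa> \<eta>) \<le> rate x"
proof -
  have le: "ereal (\<theta> * x - \<kappa> \<theta>) \<le> rate x" for \<theta>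
    unfolding rate_def by (rule SUP_upper) simp
  obtain R where R: "\<And>\<theta>. \<theta> * x - \<kappa> \<theta> \<le> R"
  proof (cases "rate x")
    case (real r)
    then show ?thesis using le that by (metis ereal_less_eq(3))
  qed (use le[of 0] fin in auto)
  obtain d where d: "0 < d" "\<And>y. \<bar>y - x\<bar> < d \<Longrightarrow> y \<in> U"
    using U unfolding open_dist dist_real_def by blast
  \<comment> \<open>The range of the continuous function \<open>\<kappa>'\<close> is an interval, so
    it contains \<open>x\<close> or lies strictly on one side of it.\<close>
  consider (mid) \<eta> where "\<kappa>' \<eta> = x" | (below) "\<And>\<theta>. \<kappa>' \<theta> < x" | (above) "\<And>\<theta>. x < \<kappa>' \<theta>"
  proof (cases "(\<exists>\<theta>. \<kappa>' \<theta> \<le> x) \<and> (\<exists>\<theta>. x \<le> \<kappa>' \<theta>)")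
    case True
    then obtain p q where pq: "\<kappa>' p \<le> x" "x \<le> \<kappa>' q" by blast
    show thesis
    proof (cases "p \<le> q")
      case True
      then show thesis
        using IVT'[of \<kappa>' p x q] pq continuous_on_subset[OF continuous_subgradient] mid by auto
    next
      case False
      then show thesis using pq subgradient_mono[of q p] mid[of p] by linarith
    qed
  next
    case False
    then show thesis using below above by (metis not_le)
  qed
  then show ?thesis
  proof cases
    case mid
    then show ?thesis using U le[of \<eta>] by auto
  next
    case below
    \<comment> \<open>If \<open>\<kappa>' \<theta>\<close> stayed at or below \<open>x - d\<close>,
      the tangent at \<open>\<theta>\<close>, evaluated at 0, would give
      \<open>\<theta> * x - \<kappa> \<theta> \<ge> \<theta> * d\<close>. The choice makes
      \<open>\<theta> * d\<close> equal to \<open>\<bar>R\<bar> + 1\<close>, which exceeds the bound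
      \<open>R\<close>. The mirrored case uses the same value with a minus sign.\<close>
    define \<theta> where "\<theta> = (\<bar>R\<bar> + 1) / d"
    have th: "\<theta> > 0" using d by (simp add: \<theta>_def)
    have "x - d < \<kappa>' \<theta>"
    proof (rule ccontr)
      assume "\<not> ?thesis"
      then have "\<theta> * \<kappa>' \<theta> \<le> \<theta> * (x - d)" using th by (intro mult_left_mono) auto
      moreover have "\<kappa> \<theta> \<le> \<theta> * \<kappa>' \<theta>" using subgradient[of \<theta> 0] kappa_0 by simp
      ultimately have "\<theta> * d \<le> R" using R[of \<theta>] by (simp add: algebra_simps)
      then show False using d by (simp add: \<theta>_def)
    qed
    moreover have "\<theta> * \<kappa>' \<theta> \<le> \<theta> * x" using below[of \<theta>] th by simp
    ultimately show ?thesis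
      using below[of \<theta>] d(2)[of "\<kappa>' \<theta>"] le[of \<theta>] by (intro exI[of _ \<theta>]) (auto intro: order_trans[rotated])
  next
    case above
    define \<theta> where "\<theta> = (\<bar>R\<bar> + 1) / d"
    have th: "\<theta> > 0" using d by (simp add: \<theta>_def)
    have "\<kappa>' (-\<theta>) < x + d"
    proof (rule ccontr)
      assume "\<not> ?thesis"
      then have "\<theta> * (x + d) \<le> \<theta> * \<kappa>' (-\<theta>)" using th by (intro mult_left_mono) auto
      moreover have "\<kappa> (-\<theta>) \<le> - \<theta> * \<kappa>' (-\<theta>)" using subgradient[of "-\<theta>" 0] kappa_0 by simp
      ultimately have "\<theta> * d \<le> R" using R[of "-\<theta>"] by (simp add: algebra_simps)
      then show False using d by (simp add: \<theta>_def)
    qed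
    moreover have "\<theta> * x \<le> \<theta> * \<kappa>' (-\<theta>)" using above[of "-\<theta>"] th by simp
    ultimately show ?thesis
      using above[of "-\<theta>"] d(2)[of "\<kappa>' (-\<theta>)"] le[of "-\<theta>"] by (intro exI[of _ "-\<theta>"]) (auto intro: order_trans[rotated])
  qed
qed

lemma lower_bound:
  assumes A: "A \<in> sets borel"
  shows "- (INF x\<in>interior A. rate x) \<le> liminf (\<lambda>n. elog (measure (\<mu> n) A) / ereal (s n))"
proof -
  let ?L = "liminf (\<lambda>n. elog (measure (\<mu> n) A) / ereal (s n))"
  have "- ?L \<le> rate x" if x: "x \<in> interior A" for x
  proof (rule dense_ge)
    fix c' assume c': "rate x < c'"
    then have "rate x \<noteq> \<infinity>" by auto
    then obtain \<eta> where \<eta>: "\<kappa>' \<eta> \<in> interior A" "ereal (\<eta> * \<kappa>' \<eta> - \<kappa> \<eta>) \<le> rate x"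
      using approximate_by_exposed[OF _ open_interior x] by blast
    then have "ereal (\<eta> * \<kappa>' \<eta> - \<kappa> \<eta>) < c'" using c' by (rule_tac le_less_trans)
    then obtain c where c: "\<eta> * \<kappa>' \<eta> - \<kappa> \<eta> < c" "ereal c < c'"
      using ereal_dense2 by (metis ereal_less(2) less_ereal.simps(1))
    obtain r where r: "0 < r" "ball (\<kappa>' \<eta>) r \<subseteq> A"
      using \<eta>(1) by (auto simp: mem_interior)
    \<comment> \<open>The second term keeps \<open>\<bar>\<eta>\<bar> * d\<close> within half of the
      slack between the cost at \<open>\<eta>\<close> and \<open>c\<close>; the summand 1 covers
      \<open>\<eta> = 0\<close>.\<close>
    define d where "d = min r ((c - (\<eta> * \<kappa>' \<eta> - \<kappa> \<eta>)) / 2 / (\<bar>\<eta>\<bar> + 1))"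
    have d: "0 < d" "d \<le> r" using r c by (auto simp: d_def)
    have q: "\<bar>\<eta>\<bar> + 1 \<noteq> 0" by linarith
    have "\<bar>\<eta>\<bar> * d \<le> (\<bar>\<eta>\<bar> + 1) * ((c - (\<eta> * \<kappa>' \<eta> - \<kappa> \<eta>)) / 2 / (\<bar>\<eta>\<bar> + 1))"
      using d by (intro mult_mono) (auto simp: d_def)
    also have "\<dots> = (c - (\<eta> * \<kappa>' \<eta> - \<kappa> \<eta>)) / 2"
      using q nonzero_mult_div_cancel_left by (metis times_divide_eq_right)
    finally have "\<eta> * \<kappa>' \<eta> - \<kappa> \<eta> + \<bar>\<eta>\<bar> * d < c" using c by (simp add: field_simps)
    from ball_lower_bound[OF d(1) this] speed_pos
    have "\<forall>\<^sub>F n in sequentially. ereal (- c) \<le> elog (measure (\<mu> n) A) / ereal (s n)"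
    proof eventually_elim
      case (elim n)
      interpret prob_space "\<mu> n" by (rule prob)
      have "exp (- c * s n) \<le> prob A"
        using elim(1) r d A
        by (elim order_trans) (auto intro!: finite_measure_mono simp: sets_mu ball_def dist_real_def abs_if subset_iff)
      moreover from this have "0 < prob A" using exp_gt_zero less_le_trans by blast
      ultimately have "- c * s n \<le> ln (prob A)" by (simp add: ln_ge_iff)
      then have "- c \<le> ln (prob A) / s n" using elim by (simp add: field_simps)
      then show ?case using \<open>0 < prob A\<close> elim by (simp add: elog_def)
    qed
    then have "ereal (- c) \<le> ?L" by (rule Liminf_bounded)
    then have "- ?L \<le> ereal c" by (simp add: ereal_uminus_le_reorder)
    then show "- ?L \<le> c'" using c by order
  qed
  then have "- ?L \<le> (INF x\<in>interior A. rate x)" by (rule INF_greatest)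
  then show ?thesis by (simp add: ereal_uminus_le_reorder)
qed

text \<open>On one side of the typical value \<open>\<kappa>' 0\<close>, a parameter
  \<open>\<theta>\<close> that earns more than \<open>c\<close> at the nearest point of
  \<open>F\<close> must point away from \<open>\<kappa>' 0\<close>. Then \<open>\<theta> * y\<close>
  is smallest on \<open>F\<close> at that nearest point, and a single Chernoff bound covers the
  whole set. The sign \<open>\<sigma>\<close> serves both half-lines at once, and the strict
  \<open>c' > c\<close> leaves room to add the two bounds.\<close>

lemma half_line_upper_bound:
  assumes F: "closed F" "\<sigma> = 1 \<or> \<sigma> = -1" "\<And>y. y \<in> F \<Longrightarrow> \<sigma> * \<kappa>' 0 \<le> \<sigma> * y"
    and c: "0 \<le> c" "ereal c < (INF x\<in>F. rate x)"
  shows "\<exists>c'>c. \<forall>\<^sub>F n in sequentially. measure (\<mu> n) F \<le> exp (- c' * s n)"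
proof (cases "F = {}")
  case True
  then show ?thesis by (intro exI[of _ "c + 1"]) auto
next
  case False
  have "\<exists>x\<in>F. \<forall>y\<in>F. \<sigma> * x \<le> \<sigma> * y"
  proof (cases "\<sigma> = 1")
    case True
    then have "bdd_below F" using F(3) by (auto intro!: bdd_belowI[of F "\<kappa>' 0"])
    then show ?thesis
      using True F(1) False closed_contains_Inf[of F] cInf_lower[of _ F] by auto
  next
    case False
    then have "bdd_above F" using F(2,3) by (auto intro!: bdd_aboveI[of F "\<kappa>' 0"])
    then show ?thesis
      using False F(1,2) \<open>F \<noteq> {}\<close> closed_contains_Sup[of F] cSup_upper[of _ F] by auto
  qed
  then obtain x where x: "x \<in> F" "\<And>y. y \<in> F \<Longrightarrow> \<sigma> * x \<le> \<sigma> * y" by blast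
  have "ereal c < rate x" using c(2) x(1) by (metis INF_lower less_le_trans)
  then obtain \<theta> where \<theta>: "c < \<theta> * x - \<kappa> \<theta>" unfolding rate_def less_SUP_iff by auto
  then obtain c' where c': "c < c'" "c' < \<theta> * x - \<kappa> \<theta>" using dense by blast
  \<comment> \<open>The tangent at 0 gives
    \<open>\<kappa> \<theta> \<ge> \<theta> * \<kappa>' 0\<close>, so
    \<open>\<theta> * (x - \<kappa>' 0)\<close> exceeds \<open>c\<close>, which is
    nonnegative.\<close>
  have "0 < \<theta> * (x - \<kappa>' 0)"
    using \<theta> c(1) subgradient[of 0 \<theta>] kappa_0 by (simp add: algebra_simps)
  then have "0 < (\<sigma> * \<theta>) * (\<sigma> * (x - \<kappa>' 0))"
    using F(2) by (auto simp: algebra_simps)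
  then have "0 \<le> \<sigma> * \<theta>"
    using F(3)[OF x(1)] mult_nonpos_nonneg[of "\<sigma> * \<theta>" "\<sigma> * (x - \<kappa>' 0)"]
    by (cases "0 \<le> \<sigma> * \<theta>") (simp_all add: right_diff_distrib)
  then have "(\<sigma> * \<theta>) * (\<sigma> * x) \<le> (\<sigma> * \<theta>) * (\<sigma> * y)" if "y \<in> F" for y
    using x(2)[OF that] by (rule mult_left_mono[rotated])
  then have "\<theta> * x \<le> \<theta> * y" if "y \<in> F" for y using F(2) that by auto
  then show ?thesis
    using chernoff[of F "\<theta> * x" \<theta> c'] c' F(1) by auto
qed

text \<open>Cutting the closure at \<open>\<kappa>' 0\<close> leaves two closed sets, each with its
  own half-line bound; adding them costs a factor 2, which the strict gap in the exponents
  absorbs.\<close>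

lemma upper_bound:
  assumes A: "A \<in> sets borel"
  shows "limsup (\<lambda>n. elog (measure (\<mu> n) A) / ereal (s n)) \<le> - (INF x\<in>closure A. rate x)"
proof -
  let ?L = "limsup (\<lambda>n. elog (measure (\<mu> n) A) / ereal (s n))"
  let ?J = "INF x\<in>closure A. rate x"
  have key: "?L \<le> ereal (- c)" if "\<forall>\<^sub>F n in sequentially. measure (\<mu> n) A \<le> exp (- c * s n)" for c
  proof (rule Limsup_bounded)
    show "\<forall>\<^sub>F n in sequentially. elog (measure (\<mu> n) A) / ereal (s n) \<le> ereal (- c)"
      using that speed_pos
    proof eventually_elim
      case (elim n)
      show ?case
      proof (cases "measure (\<mu> n) A = 0")
        case True
        then show ?thesis using elim by (simp add: elog_def)
      next
        case False
        then have "0 < measure (\<mu> n) A" by (simp add: zero_less_measure_iff)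
        then have "ln (measure (\<mu> n) A) \<le> ln (exp (- c * s n))"
          using elim(1) by (subst ln_le_cancel_iff) auto
        then show ?thesis using False elim(2) by (simp add: elog_def field_simps)
      qed
    qed
  qed
  have "?J \<le> - ?L"
  proof (rule dense_le)
    fix c' assume c': "c' < ?J"
    \<comment> \<open>A negative \<open>c'\<close> asks for nothing beyond probabilities being at
      most 1; the half-line bounds need a nonnegative exponent.\<close>
    show "c' \<le> - ?L"
    proof (cases "c' < 0")
      case True
      have "?L \<le> ereal (- 0)"
        by (rule key) (simp add: prob_space.prob_le_1[OF prob])
      then have "?L \<le> 0" by (simp add: zero_ereal_def)
      then have "0 \<le> - ?L" using ereal_minus_le_minus[of 0 ?L] by simp
      then show ?thesis using True by (meson le_less_trans less_imp_le order_trans)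
    next
      case False
      then obtain c where c: "c' = ereal c" "0 \<le> c"
        using c' by (cases c') auto
      let ?F = "closure A \<inter> {\<kappa>' 0..}" and ?G = "closure A \<inter> {..\<kappa>' 0}"
      have "ereal c < (INF x\<in>?F. rate x)" "ereal c < (INF x\<in>?G. rate x)"
        using c c' by (auto intro: less_le_trans[OF _ INF_superset_mono])
      then obtain c1 c2 where c1: "c < c1" "\<forall>\<^sub>F n in sequentially. measure (\<mu> n) ?F \<le> exp (- c1 * s n)"
        and c2: "c < c2" "\<forall>\<^sub>F n in sequentially. measure (\<mu> n) ?G \<le> exp (- c2 * s n)"
        using half_line_upper_bound[of ?F 1 c] half_line_upper_bound[of ?G "-1" c] c
        by auto
      have "\<forall>\<^sub>F n in sequentially. 2 * exp (- c1 * s n) \<le> exp (- c * s n)"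
        "\<forall>\<^sub>F n in sequentially. 2 * exp (- c2 * s n) \<le> exp (- c * s n)"
        using c1 c2 exp_speed_dominates[of "- c1" "- c" 2] exp_speed_dominates[of "- c2" "- c" 2] by simp_all
      with c1(2) c2(2) have "\<forall>\<^sub>F n in sequentially. measure (\<mu> n) A \<le> exp (- c * s n)"
      proof eventually_elim
        case (elim n)
        interpret prob_space "\<mu> n" by (rule prob)
        have "prob A \<le> prob (?F \<union> ?G)"
          using closure_subset by (intro finite_measure_mono) (auto simp: sets_mu)
        also have "\<dots> \<le> prob ?F + prob ?G"
          by (intro measure_Un_le) (auto simp: sets_mu)
        finally show ?case using elim by linarith
      qed
      from key[OF this] have "- ereal (- c) \<le> - ?L" by (simp only: ereal_minus_le_minus)
      then show ?thesis using c by simp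
    qed
  qed
  then have "- (- ?L) \<le> - ?J" by (simp only: ereal_minus_le_minus)
  then show ?thesis by simp
qed

theorem gaertner_ellis: "large_deviation_principle \<mu> s rate"
  unfolding large_deviation_principle_def
  using lower_bound upper_bound by (auto intro: Liminf_le_Limsup)

end

section \<open>Prime powers and Mertens' theorem\<close>

text \<open>The pair \<open>(p, j)\<close> encodes the prime power \<open>replicate_mset j p\<close>.\<close>

definition prime_powers_upto :: "'p set \<Rightarrow> ('p \<Rightarrow> nat) \<Rightarrow> real \<Rightarrow> ('p \<times> nat) set" where
  "prime_powers_upto P N X = {q. fst q \<in> P \<and> 1 \<le> snd q \<and> real (N (fst q)) ^ snd q \<le> X}"

lemma mnorm_plus: "mnorm N (m + n) = mnorm N m * mnorm N n"
  by (simp add: mnorm_def)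

lemma mnorm_replicate: "mnorm N (replicate_mset j p) = N p ^ j"
  by (simp add: mnorm_def)

lemma mnorm_empty [simp]: "mnorm N {#} = 1"
  by (simp add: mnorm_def)

lemma free_monoid_plus_iff: "m + n \<in> free_monoid P \<longleftrightarrow> m \<in> free_monoid P \<and> n \<in> free_monoid P"
  by (auto simp: free_monoid_def)

lemma free_monoid_replicate: "p \<in> P \<Longrightarrow> replicate_mset j p \<in> free_monoid P"
  by (auto simp: free_monoid_def in_replicate_mset)

text \<open>A dyadic decomposition replaces partial summation.\<close>

lemma dyadic_sum_bound:
  fixes w \<nu> :: "'a \<Rightarrow> real"
  assumes fin: "\<And>t. finite {x \<in> U. \<nu> x \<le> t}"
    and w: "\<And>x. x \<in> U \<Longrightarrow> 0 \<le> w x" and \<nu>: "\<And>x. x \<in> U \<Longrightarrow> 1 \<le> \<nu> x"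
    and C: "\<And>t. 1 \<le> t \<Longrightarrow> (\<Sum>x | x \<in> U \<and> \<nu> x \<le> t. w x) \<le> C * t"
    and \<beta>: "0 \<le> \<beta>" "\<beta> < 1"
  obtains C' where "0 \<le> C'" "\<And>X. 1 \<le> X \<Longrightarrow> (\<Sum>x | x \<in> U \<and> \<nu> x \<le> X. w x * (X / \<nu> x) powr \<beta>) \<le> C' * X"
proof
  \<comment> \<open>The level \<open>2 ^ i \<le> X / \<nu> x\<close> has mass at most
    \<open>C * X / 2 ^ i\<close> and weight about \<open>2 powr (\<beta> * i)\<close>, so the levels
    form a geometric series of ratio \<open>q\<close>; it converges because
    \<open>\<beta> < 1\<close>.\<close>
  define q :: real where "q = 2 powr (\<beta> - 1)"
  have q: "0 < q" "q < 1" using \<beta> powr_less_one[of 2 "\<beta> - 1"] by (auto simp: q_def)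
  have C0: "0 \<le> C"
    using order_trans[OF sum_nonneg C[of 1]] w by simp
  define C' where "C' = 2 powr \<beta> * C * (1 / (1 - q))"
  show "0 \<le> C'" using C0 q by (simp add: C'_def)
  fix X :: real assume X: "1 \<le> X"
  let ?S = "\<lambda>t. {x. x \<in> U \<and> \<nu> x \<le> t}"
  define K where "K = nat \<lfloor>log 2 X\<rfloor>"
  have K: "2 ^ i \<le> X \<longleftrightarrow> i \<le> K" for i
  proof -
    have "2 ^ i \<le> X \<longleftrightarrow> 2 powr (real i) \<le> X" by (simp add: powr_realpow)
    also have "\<dots> \<longleftrightarrow> real i \<le> log 2 X" using X by (simp add: le_log_iff)
    also have "\<dots> \<longleftrightarrow> i \<le> K"
      using X by (auto simp: K_def le_nat_iff le_floor_iff)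
    finally show ?thesis .
  qed
  have "(\<Sum>x\<in>?S X. w x * (X / \<nu> x) powr \<beta>)
      \<le> (\<Sum>x\<in>?S X. \<Sum>i | i \<le> K \<and> 2 ^ i \<le> X / \<nu> x. 2 powr \<beta> * (2 powr \<beta>) ^ i * w x)"
  proof (rule sum_mono)
    fix x assume x: "x \<in> ?S X"
    then have n: "1 \<le> \<nu> x" "\<nu> x \<le> X" using \<nu> by auto
    define u where "u = X / \<nu> x"
    have u: "1 \<le> u" "u \<le> X" using n by (auto simp: u_def field_simps)
    define i where "i = nat \<lfloor>log 2 u\<rfloor>"
    have l: "0 \<le> log 2 u" using u by simp
    have "real i \<le> log 2 u" "log 2 u < real i + 1"
      using l by (auto simp: i_def) 
    then have i: "2 ^ i \<le> u" "u < 2 ^ (i + 1)"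
      using u by (auto simp: le_log_iff log_less_iff powr_realpow[symmetric] powr_add)
    have "u powr \<beta> \<le> (2 ^ (i + 1)) powr \<beta>"
      using i u \<beta> by (intro powr_mono2) auto
    also have "\<dots> = 2 powr \<beta> * (2 powr \<beta>) ^ i"
      by (simp add: powr_realpow[symmetric] powr_powr powr_add[symmetric] algebra_simps powr_mult)
    finally have "w x * u powr \<beta> \<le> w x * (2 powr \<beta> * (2 powr \<beta>) ^ i)"
      using w x by (intro mult_left_mono) auto
    also have "\<dots> = (\<Sum>i\<in>{i}. 2 powr \<beta> * (2 powr \<beta>) ^ i * w x)" by simp
    \<comment> \<open>The top level alone already dominates the term of \<open>x\<close>. The lower
      levels are added so that, after the exchange of sums, each level is a full initial segment to
      which the hypothesis applies.\<close>
    also have "\<dots> \<le> (\<Sum>i | i \<le> K \<and> 2 ^ i \<le> u. 2 powr \<beta> * (2 powr \<beta>) ^ i * w x)"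
      using i u K[of i] w x by (intro sum_mono2) auto
    finally show "w x * (X / \<nu> x) powr \<beta> \<le> (\<Sum>i | i \<le> K \<and> 2 ^ i \<le> X / \<nu> x. 2 powr \<beta> * (2 powr \<beta>) ^ i * w x)"
      by (simp add: u_def)
  qed
  also have "\<dots> = (\<Sum>i\<le>K. \<Sum>x | x \<in> ?S X \<and> 2 ^ i \<le> X / \<nu> x. 2 powr \<beta> * (2 powr \<beta>) ^ i * w x)"
    using fin by (subst sum.swap_restrict[symmetric]) (auto simp: atMost_def intro!: sum.cong)
  also have "\<dots> = (\<Sum>i\<le>K. 2 powr \<beta> * (2 powr \<beta>) ^ i * (\<Sum>x\<in>?S (X / 2 ^ i). w x))"
  proof (intro sum.cong refl)
    fix i :: nat
    have "(\<nu> x \<le> X \<and> 2 ^ i \<le> X / \<nu> x) \<longleftrightarrow> \<nu> x \<le> X / 2 ^ i" if "x \<in> U" for x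
    proof -
      have "\<nu> x * 1 \<le> \<nu> x * 2 ^ i" using \<nu>[OF that] by (intro mult_left_mono) auto
      moreover have "2 ^ i \<le> X / \<nu> x \<longleftrightarrow> \<nu> x * 2 ^ i \<le> X" "\<nu> x \<le> X / 2 ^ i \<longleftrightarrow> \<nu> x * 2 ^ i \<le> X"
        using \<nu>[OF that] by (auto simp: field_simps)
      ultimately show ?thesis by linarith
    qed
    then have "{x. x \<in> ?S X \<and> 2 ^ i \<le> X / \<nu> x} = ?S (X / 2 ^ i)" by auto
    then show "(\<Sum>x | x \<in> ?S X \<and> 2 ^ i \<le> X / \<nu> x. 2 powr \<beta> * (2 powr \<beta>) ^ i * w x)
        = 2 powr \<beta> * (2 powr \<beta>) ^ i * (\<Sum>x\<in>?S (X / 2 ^ i). w x)"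
      by (simp add: sum_distrib_left)
  qed
  also have "\<dots> \<le> (\<Sum>i\<le>K. 2 powr \<beta> * (2 powr \<beta>) ^ i * (C * (X / 2 ^ i)))"
    using K by (intro sum_mono mult_left_mono C) (auto simp: field_simps)
  also have "\<dots> = (\<Sum>i\<le>K. q ^ i) * (2 powr \<beta> * C * X)"
    by (simp add: q_def powr_diff power_divide sum_distrib_right sum_distrib_left mult_ac)
  also have "\<dots> \<le> (1 / (1 - q)) * (2 powr \<beta> * C * X)"
  proof (rule mult_right_mono)
    have "(\<Sum>i\<le>K. q ^ i) \<le> (\<Sum>i. q ^ i)"
      using q by (intro sum_le_suminf summable_geometric) auto
    then show "(\<Sum>i\<le>K. q ^ i) \<le> 1 / (1 - q)" using q by (simp add: suminf_geometric)
  qed (use C0 X in auto)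
  finally show "(\<Sum>x\<in>?S X. w x * (X / \<nu> x) powr \<beta>) \<le> C' * X"
    by (simp add: C'_def mult_ac)
qed

section \<open>The monoid, its prime powers and the growth conditions\<close>

locale growth_conditions =
  fixes P :: "'p set" and N :: "'p \<Rightarrow> nat"
  assumes norm_ge_2: "\<And>p. p \<in> P \<Longrightarrow> 2 \<le> N p"
    and G1: "growth_monoid P N"
    and G2: "growth_gens P N"
begin

abbreviation "M \<equiv> monoid_upto P N"
abbreviation "G \<equiv> gens_upto P N"
abbreviation "Q \<equiv> prime_powers_upto P N"
abbreviation "nrm m \<equiv> real (mnorm N m)"
abbreviation "pow q \<equiv> replicate_mset (snd q) (fst q)"
abbreviation "pnorm q \<equiv> real (N (fst q)) ^ snd q"
text \<open>The von Mangoldt function of the prime power \<open>pow q\<close>.\<close>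

abbreviation "\<Lambda> q \<equiv> ln (real (N (fst q)))"

lemma finite_M: "finite (M X)"
  using G1 by (simp add: growth_monoid_def)

lemma finite_G: "finite (G X)"
  using G2 by (simp add: growth_gens_def)

lemma M_mono: "X \<le> Y \<Longrightarrow> M X \<subseteq> M Y"
  by (auto simp: monoid_upto_def)

lemma G_mono: "X \<le> Y \<Longrightarrow> G X \<subseteq> G Y"
  by (auto simp: gens_upto_def)

lemma Q_mono: "X \<le> Y \<Longrightarrow> Q X \<subseteq> Q Y"
  by (auto simp: prime_powers_upto_def)

lemma fst_in_G: "q \<in> Q X \<Longrightarrow> fst q \<in> G X"
proof -
  assume q: "q \<in> Q X"
  then have "real (N (fst q)) ^ 1 \<le> pnorm q"
    using norm_ge_2[of "fst q"] by (intro power_increasing) (auto simp: prime_powers_upto_def)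
  moreover have "pnorm q \<le> X" using q by (simp add: prime_powers_upto_def)
  ultimately have "real (N (fst q)) \<le> X" by (metis order_trans power_one_right)
  then show ?thesis using q by (simp add: prime_powers_upto_def gens_upto_def)
qed

lemma finite_Q: "finite (Q X)"
proof (rule finite_subset)
  show "Q X \<subseteq> G X \<times> {..nat \<lfloor>X\<rfloor>}"
  proof
    fix q assume q: "q \<in> Q X"
    have "real (snd q) \<le> 2 ^ snd q" by (simp add: of_nat_less_two_power less_imp_le)
    also have "\<dots> \<le> pnorm q"
      using q norm_ge_2[of "fst q"] by (intro power_mono) (auto simp: prime_powers_upto_def)
    also have "\<dots> \<le> X" using q by (simp add: prime_powers_upto_def)
    finally show "q \<in> G X \<times> {..nat \<lfloor>X\<rfloor>}"
      using fst_in_G[OF q] by (cases q) (auto simp: le_nat_iff le_floor_iff nat_le_iff)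
  qed
qed (simp add: finite_G)

lemma nrm_ge_1: "m \<in> free_monoid P \<Longrightarrow> 1 \<le> nrm m"
proof -
  assume m: "m \<in> free_monoid P"
  have "0 \<notin># image_mset N m"
    using m norm_ge_2 by (fastforce simp: free_monoid_def)
  then have "mnorm N m \<noteq> 0" by (simp add: mnorm_def prod_mset_zero_iff)
  then show ?thesis by simp
qed

lemma nrm_M: "m \<in> M X \<Longrightarrow> 1 \<le> nrm m \<and> nrm m \<le> X \<and> m \<in> free_monoid P"
  using nrm_ge_1 by (auto simp: monoid_upto_def)

lemma norm_G: "p \<in> G X \<Longrightarrow> 2 \<le> real (N p) \<and> real (N p) \<le> X \<and> p \<in> P"
  using norm_ge_2 by (fastforce simp: gens_upto_def)

lemma norm_Q: "q \<in> Q X \<Longrightarrow> 2 \<le> real (N (fst q)) \<and> 1 \<le> pnorm q \<and> pnorm q \<le> X \<and> fst q \<in> P \<and> 1 \<le> snd q"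
  using norm_G[OF fst_in_G, of q X] one_le_power[of "real (N (fst q))" "snd q"]
  by (simp add: prime_powers_upto_def)

lemma empty_in_M: "1 \<le> X \<Longrightarrow> {#} \<in> M X"
  by (simp add: monoid_upto_def free_monoid_def)

lemma M_eq: "M t = {m. m \<in> free_monoid P \<and> nrm m \<le> t}"
  by (simp add: monoid_upto_def)

lemma Q_eq: "Q t = {q. q \<in> {q. fst q \<in> P \<and> 1 \<le> snd q} \<and> pnorm q \<le> t}"
  by (auto simp: prime_powers_upto_def)

section \<open>The logarithm of the norm as a sum over prime powers\<close>

lemma ln_nrm:
  assumes m: "m \<in> free_monoid P"
  shows "ln (nrm m) = (\<Sum>q | fst q \<in># m \<and> 1 \<le> snd q \<and> snd q \<le> count m (fst q). \<Lambda> q)"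
proof -
  have eq: "{q. fst q \<in># m \<and> 1 \<le> snd q \<and> snd q \<le> count m (fst q)}
      = Sigma (set_mset m) (\<lambda>p. {1..count m p})" by auto
  have "nrm m = (\<Prod>p\<in>set_mset m. real (N p) ^ count m p)"
    by (simp add: mnorm_def image_prod_mset_multiplicity)
  then have "ln (nrm m) = (\<Sum>p\<in>set_mset m. ln (real (N p) ^ count m p))"
    using m norm_ge_2 by (simp, subst ln_prod) (fastforce simp: free_monoid_def)+
  also have "\<dots> = (\<Sum>p\<in>set_mset m. \<Sum>j\<in>{1..count m p}. ln (real (N p)))"
    using m norm_ge_2 by (intro sum.cong refl) (fastforce simp: free_monoid_def ln_realpow)
  also have "\<dots> = (\<Sum>q\<in>Sigma (set_mset m) (\<lambda>p. {1..count m p}). \<Lambda> q)"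
    by (subst sum.Sigma) (auto simp: case_prod_beta)
  finally show ?thesis by (simp only: eq)
qed

lemma sum_times_ln_norm:
  fixes f :: "'p multiset \<Rightarrow> real"
  shows "(\<Sum>m\<in>M X. f m * ln (nrm m)) = (\<Sum>n\<in>M X. \<Sum>q\<in>Q (X / nrm n). \<Lambda> q * f (n + pow q))"
proof -
  let ?D = "\<lambda>m. {q. fst q \<in># m \<and> 1 \<le> snd q \<and> snd q \<le> count m (fst q)}"
  have D: "finite (?D m)" for m :: "'p multiset"
    by (rule finite_subset[of _ "Sigma (set_mset m) (\<lambda>p. {1..count m p})"]) auto
  have "(\<Sum>m\<in>M X. f m * ln (nrm m)) = (\<Sum>m\<in>M X. \<Sum>q\<in>?D m. \<Lambda> q * f m)"
    by (intro sum.cong refl) (auto simp: ln_nrm sum_distrib_left mult_ac dest!: nrm_M)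
  also have "\<dots> = (\<Sum>(m, q)\<in>Sigma (M X) ?D. \<Lambda> q * f m)"
    using finite_M D by (subst sum.Sigma) auto
  also have "\<dots> = (\<Sum>(n, q)\<in>Sigma (M X) (\<lambda>n. Q (X / nrm n)). \<Lambda> q * f (n + pow q))"
  proof (rule sum.reindex_bij_witness[where i = "\<lambda>(n, q). (n + pow q, q)" and j = "\<lambda>(m, q). (m - pow q, q)"])
    fix a assume a: "a \<in> Sigma (M X) ?D"
    then obtain m p j where mq: "a = (m, (p, j))" "m \<in> M X" "p \<in># m" "1 \<le> j" "j \<le> count m p"
      by force
    define n where "n = m - replicate_mset j p"
    \<comment> \<open>Subtraction of multisets is truncated; \<open>j \<le> count m p\<close> makes
      it an exact division.\<close>
    have m: "m = n + replicate_mset j p"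
      using mq by (simp add: n_def count_le_replicate_mset_subset_eq[symmetric])
    have fm: "n + replicate_mset j p \<in> free_monoid P" using mq(2) m by (simp add: monoid_upto_def)
    then have n: "n \<in> free_monoid P" by (simp add: free_monoid_plus_iff)
    have p: "p \<in> P" using mq(2,3) by (auto simp: monoid_upto_def free_monoid_def)
    have le: "nrm n * real (N p) ^ j \<le> X"
      using mq(2) m by (simp add: monoid_upto_def mnorm_plus mnorm_replicate)
    have "1 \<le> real (N p) ^ j" using norm_ge_2[OF p] by (intro one_le_power) simp
    then have "nrm n * 1 \<le> nrm n * real (N p) ^ j" by (intro mult_left_mono) auto
    then have "n \<in> M X" using le n by (simp add: monoid_upto_def)
    moreover have "(p, j) \<in> Q (X / nrm n)"
      using le p mq nrm_ge_1[OF n] by (simp add: prime_powers_upto_def field_simps)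
    ultimately show "(case a of (m, q) \<Rightarrow> (m - pow q, q)) \<in> Sigma (M X) (\<lambda>n. Q (X / nrm n))"
      using mq(1) m by simp
    show "(case (case a of (m, q) \<Rightarrow> (m - pow q, q)) of (n, q) \<Rightarrow> (n + pow q, q)) = a"
      using mq(1) m by simp
    show "(case (case a of (m, q) \<Rightarrow> (m - pow q, q)) of (n, q) \<Rightarrow> \<Lambda> q * f (n + pow q)) = (case a of (m, q) \<Rightarrow> \<Lambda> q * f m)"
      using mq(1) m by simp
  next
    fix a assume a: "a \<in> Sigma (M X) (\<lambda>n. Q (X / nrm n))"
    then obtain n p j where nq: "a = (n, (p, j))" "n \<in> M X" "p \<in> P" "1 \<le> j" "real (N p) ^ j \<le> X / nrm n"
      by (cases a) (force simp: prime_powers_upto_def)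
    show "(case (case a of (n, q) \<Rightarrow> (n + pow q, q)) of (m, q) \<Rightarrow> (m - pow q, q)) = a"
      using nq by simp
    have "nrm (n + replicate_mset j p) \<le> X"
      using nq nrm_M[OF nq(2)] by (simp add: mnorm_plus mnorm_replicate field_simps)
    then have "n + replicate_mset j p \<in> M X"
      using nq(2,3) by (simp add: monoid_upto_def free_monoid_plus_iff free_monoid_replicate)
    then show "(case a of (n, q) \<Rightarrow> (n + pow q, q)) \<in> Sigma (M X) ?D"
      using nq(1,4) by (simp add: in_replicate_mset)
  qed
  also have "\<dots> = (\<Sum>n\<in>M X. \<Sum>q\<in>Q (X / nrm n). \<Lambda> q * f (n + pow q))"
    using finite_M finite_Q by (subst sum.Sigma) auto
  finally show ?thesis .
qed

text \<open>The analogue of Legendre's formula for log n!: each prime power contributes its von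
  Mangoldt weight once for every multiple of it up to \<open>X\<close>.\<close>

lemma sum_ln_norm: "(\<Sum>m\<in>M X. ln (nrm m)) = (\<Sum>q\<in>Q X. \<Lambda> q * card (M (X / pnorm q)))"
proof -
  have "(\<Sum>m\<in>M X. ln (nrm m)) = (\<Sum>n\<in>M X. \<Sum>q\<in>Q (X / nrm n). \<Lambda> q)"
    using sum_times_ln_norm[of "\<lambda>_. 1" X] by simp
  also have "\<dots> = (\<Sum>n\<in>M X. \<Sum>q | q \<in> Q X \<and> nrm n * pnorm q \<le> X. \<Lambda> q)"
  proof (intro sum.cong refl)
    fix n assume n: "n \<in> M X"
    have "nrm n * pnorm q \<le> X \<Longrightarrow> pnorm q \<le> X" for q
      using nrm_M[OF n] mult_right_mono[of 1 "nrm n" "pnorm q"] by simp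
    then show "Q (X / nrm n) = {q. q \<in> Q X \<and> nrm n * pnorm q \<le> X}"
      using nrm_M[OF n] by (auto simp: prime_powers_upto_def field_simps)
  qed
  also have "\<dots> = (\<Sum>q\<in>Q X. \<Sum>n | n \<in> M X \<and> nrm n * pnorm q \<le> X. \<Lambda> q)"
    by (rule sum.swap_restrict) (auto simp: finite_M finite_Q)
  also have "\<dots> = (\<Sum>q\<in>Q X. \<Lambda> q * card (M (X / pnorm q)))"
  proof (intro sum.cong refl)
    fix q assume q: "q \<in> Q X"
    have "nrm n * pnorm q \<le> X \<Longrightarrow> nrm n \<le> X" for n
      using norm_Q[OF q] mult_left_mono[of 1 "pnorm q" "nrm n"] by simp
    then have "{n. n \<in> M X \<and> nrm n * pnorm q \<le> X} = M (X / pnorm q)"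
      using norm_Q[OF q] by (auto simp: monoid_upto_def field_simps)
    then show "(\<Sum>n | n \<in> M X \<and> nrm n * pnorm q \<le> X. \<Lambda> q) = \<Lambda> q * card (M (X / pnorm q))"
      by simp
  qed
  finally show ?thesis .
qed

text \<open>(G1) is needed from 1 on, because the argument will be a quotient
  \<open>X / pnorm q\<close> that comes down to 1. Below the threshold of the asymptotics everything
  is bounded, and the bound is absorbed into \<open>B\<close>.\<close>

lemma count_asymptotics:
  obtains a b B where "0 < a" "0 \<le> b" "b < 1" "0 \<le> B"
    "\<And>t. 1 \<le> t \<Longrightarrow> \<bar>real (card (M t)) - a * t\<bar> \<le> B * t powr b"
proof -
  obtain a b where ab: "a > 0" "0 \<le> b" "b < 1"
    "(\<lambda>X. real (card (M X)) - a * X) \<in> O[at_top](\<lambda>X. X powr b)"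
    using G1 by (auto simp: growth_monoid_def)
  obtain c where c: "c > 0" "\<forall>\<^sub>F X in at_top. \<bar>real (card (M X)) - a * X\<bar> \<le> c * \<bar>X powr b\<bar>"
    using landau_o.bigE[OF ab(4)] by (auto simp del: powr_nonneg_iff)
  then obtain t0 where t0: "\<And>X. t0 \<le> X \<Longrightarrow> \<bar>real (card (M X)) - a * X\<bar> \<le> c * \<bar>X powr b\<bar>"
    by (auto simp: eventually_at_top_linorder)
  define B where "B = c + (real (card (M t0)) + a * \<bar>t0\<bar>)"
  have "\<bar>real (card (M t)) - a * t\<bar> \<le> B * t powr b" if t: "1 \<le> t" for t
  proof (cases "t0 \<le> t")
    case True
    have "c * t powr b \<le> B * t powr b"
      using ab by (intro mult_right_mono) (auto simp: B_def)
    then show ?thesis using t0[OF True] by simp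
  next
    case False
    have "real (card (M t)) \<le> card (M t0)"
      using False by (intro of_nat_mono card_mono finite_M M_mono) auto
    moreover have "a * t \<le> a * \<bar>t0\<bar>" "0 \<le> a * t" using False ab t by (auto intro!: mult_left_mono)
    ultimately have "\<bar>real (card (M t)) - a * t\<bar> \<le> B * 1" using c by (simp add: B_def)
    also have "\<dots> \<le> B * t powr b"
      using c ab t by (intro mult_left_mono) (auto simp: B_def ge_one_powr_ge_zero)
    finally show ?thesis .
  qed
  then show thesis using that[of a b B] ab c by (simp add: B_def)
qed

text \<open>A generator has at most \<open>ln t / ln (N p)\<close> powers up to \<open>t\<close>, so
  its total weight is at most \<open>ln t\<close>, whatever its norm.\<close>

lemma prime_power_sum_le:
  assumes t: "1 \<le> t" and f: "\<And>p. p \<in> P \<Longrightarrow> 0 \<le> f p"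
  shows "(\<Sum>q\<in>Q t. \<Lambda> q * f (fst q)) \<le> ln t * (\<Sum>p\<in>G t. f p)"
proof -
  let ?J = "\<lambda>p. {j. 1 \<le> j \<and> real (N p) ^ j \<le> t}"
  have J: "real (card (?J p)) * ln (real (N p)) \<le> ln t \<and> finite (?J p)" if p: "p \<in> G t" for p
  proof -
    have N: "2 \<le> real (N p)" using norm_G[OF p] by simp
    define k where "k = nat \<lfloor>ln t / ln (real (N p))\<rfloor>"
    have "?J p \<subseteq> {1..k}"
    proof
      fix j assume j: "j \<in> ?J p"
      then have "ln (real (N p) ^ j) \<le> ln t"
        using N t by (subst ln_le_cancel_iff) auto
      then have "real j \<le> ln t / ln (real (N p))" using N by (simp add: ln_realpow field_simps)
      then show "j \<in> {1..k}" using j by (simp add: k_def le_nat_floor)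
    qed
    then have "card (?J p) \<le> k" "finite (?J p)"
      using card_mono[of "{1..k}" "?J p"] finite_subset by auto
    then have "real (card (?J p)) \<le> ln t / ln (real (N p))"
      using N t by (simp add: k_def le_nat_iff le_floor_iff) 
    then show ?thesis using N \<open>finite (?J p)\<close> by (simp add: field_simps)
  qed
  have "Q t = Sigma (G t) ?J"
    using fst_in_G by (auto simp: prime_powers_upto_def gens_upto_def)
  then have "(\<Sum>q\<in>Q t. \<Lambda> q * f (fst q)) = (\<Sum>p\<in>G t. \<Sum>j\<in>?J p. ln (real (N p)) * f p)"
    using finite_G J by (subst sum.Sigma) (auto simp: case_prod_beta)
  also have "\<dots> = (\<Sum>p\<in>G t. (real (card (?J p)) * ln (real (N p))) * f p)"
    by (simp add: mult.assoc)
  also have "\<dots> \<le> (\<Sum>p\<in>G t. ln t * f p)"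
    using J f norm_G by (intro sum_mono mult_right_mono) blast+
  finally show ?thesis by (simp add: sum_distrib_left)
qed

text \<open>\<open>prime_power_sum_le\<close> with constant weight bounds the sum by
  \<open>card (G t) * ln t\<close>, which is O(t) by (G2).\<close>

lemma chebyshev_upper:
  obtains C where "0 < C" "\<And>t. 1 \<le> t \<Longrightarrow> (\<Sum>q\<in>Q t. \<Lambda> q) \<le> C * t"
proof -
  have le: "(\<Sum>q\<in>Q t. \<Lambda> q) \<le> card (G t) * ln t" if t: "1 \<le> t" for t
    using prime_power_sum_le[OF t, of "\<lambda>_. 1"] by (simp add: mult.commute)
  obtain c where c: "c > 0" "\<forall>\<^sub>F X in at_top. \<bar>real (card (G X))\<bar> \<le> c * \<bar>X / ln X\<bar>"
    using landau_o.bigE[OF conjunct2[OF G2[unfolded growth_gens_def]]] by auto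
  then obtain t0 where t0: "\<And>X. t0 \<le> X \<Longrightarrow> \<bar>real (card (G X))\<bar> \<le> c * \<bar>X / ln X\<bar>"
    by (auto simp: eventually_at_top_linorder)
  \<comment> \<open>Starting at 2 keeps \<open>ln\<close> positive, so the factor
    \<open>ln t\<close> cancels.\<close>
  define t1 where "t1 = max 2 t0"
  define C where "C = c + card (G t1) * ln t1"
  have C: "c \<le> C" by (simp add: C_def t1_def)
  have "(\<Sum>q\<in>Q t. \<Lambda> q) \<le> C * t" if t: "1 \<le> t" for t
  proof (cases "t1 \<le> t")
    case True
    then have l: "ln t > 0" by (simp add: t1_def)
    have "card (G t) * ln t \<le> c * (t / ln t) * ln t"
      using t0[of t] True t l by (intro mult_right_mono) (auto simp: t1_def)
    also have "\<dots> = c * t" using l by simp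
    also have "\<dots> \<le> C * t" using C t by simp
    finally show ?thesis using le[OF t] by simp
  next
    case False
    have "(\<Sum>q\<in>Q t. \<Lambda> q) \<le> (\<Sum>q\<in>Q t1. \<Lambda> q)"
      using False by (intro sum_mono2 finite_Q Q_mono) (auto dest: norm_Q)
    also have "\<dots> \<le> C * 1"
    proof -
      have "1 \<le> t1" by (simp add: t1_def)
      then show ?thesis using le[of t1] c by (simp add: C_def)
    qed
    also have "\<dots> \<le> C * t" using C c t by (intro mult_left_mono) auto
    finally show ?thesis .
  qed
  then show thesis using that[of C] C c by simp
qed

end

section \<open>Finite sums behind the Euler products\<close>

lemma geometric_tail_le:
  fixes x :: real assumes "1 < x"
  shows "(\<Sum>k = 1..K. 1 / x ^ k) \<le> 1 / (x - 1)"
proof -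
  have "(\<Sum>k = 1..K. 1 / x ^ k) = (1 - 1 / x ^ K) / (x - 1)"
  proof (induction K)
    case (Suc K)
    have "(1 - 1 / x ^ K) / (x - 1) + 1 / x ^ Suc K = (1 - 1 / x ^ Suc K) / (x - 1)"
      using assms by (simp add: field_simps)
    then show ?case using Suc by simp
  qed simp
  also have "\<dots> \<le> 1 / (x - 1)" using assms by (intro divide_right_mono) auto
  finally show ?thesis .
qed

text \<open>Choose each \<open>p\<close> independently, with weight \<open>w p\<close> against 1.
  The first part is the total weight; the second bounds the mean of \<open>sum l A\<close>, as
  \<open>p\<close> is chosen with probability \<open>w p / (1 + w p) \<le> w p\<close>.\<close>

lemma sum_Pow_prod:
  fixes w l :: "'a \<Rightarrow> real"
  assumes "finite S" "\<And>p. p \<in> S \<Longrightarrow> 0 \<le> w p" "\<And>p. p \<in> S \<Longrightarrow> 0 \<le> l p"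
  shows "(\<Sum>A\<in>Pow S. prod w A) = (\<Prod>p\<in>S. 1 + w p) \<and>
    (\<Sum>A\<in>Pow S. prod w A * sum l A) \<le> (\<Prod>p\<in>S. 1 + w p) * (\<Sum>p\<in>S. w p * l p)"
  using assms
proof (induction S rule: finite_induct)
  case (insert p S)
  let ?Z = "\<Prod>p\<in>S. 1 + w p"
  have split: "(\<Sum>A\<in>Pow (insert p S). f A) = (\<Sum>A\<in>Pow S. f A + f (insert p A))" for f :: "'a set \<Rightarrow> real"
  proof -
    have "inj_on (insert p) (Pow S)" using insert(2) by (auto simp: inj_on_def)
    moreover have "Pow S \<inter> insert p ` Pow S = {}" using insert(2) by auto
    ultimately show ?thesis
      using insert(1) by (simp add: Pow_insert sum.union_disjoint sum.reindex sum.distrib)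
  qed
  have A: "prod w (insert p A) = w p * prod w A" "sum l (insert p A) = l p + sum l A" if "A \<in> Pow S" for A
  proof -
    have "finite A" "p \<notin> A" using that insert(1,2) by (auto intro: finite_subset)
    then show "prod w (insert p A) = w p * prod w A" "sum l (insert p A) = l p + sum l A" by simp_all
  qed
  have Z: "(\<Sum>A\<in>Pow S. prod w A) = ?Z" and
    F: "(\<Sum>A\<in>Pow S. prod w A * sum l A) \<le> ?Z * (\<Sum>p\<in>S. w p * l p)"
    using insert by auto
  have w: "0 \<le> w p" "0 \<le> l p" using insert by auto
  have Z0: "0 \<le> ?Z" using insert by (intro prod_nonneg) (simp add: add_nonneg_nonneg)
  have "(\<Sum>A\<in>Pow (insert p S). prod w A) = (1 + w p) * ?Z"
    unfolding split Z[symmetric] by (simp add: A sum_distrib_left algebra_simps)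
  moreover have "(\<Sum>A\<in>Pow (insert p S). prod w A * sum l A)
      \<le> (1 + w p) * ?Z * (w p * l p + (\<Sum>p\<in>S. w p * l p))"
  proof -
    have "(\<Sum>A\<in>Pow (insert p S). prod w A * sum l A)
       = (\<Sum>A\<in>Pow S. (1 + w p) * (prod w A * sum l A) + w p * l p * prod w A)"
      unfolding split by (intro sum.cong refl) (simp add: A algebra_simps)
    also have "\<dots> = (1 + w p) * (\<Sum>A\<in>Pow S. prod w A * sum l A) + w p * l p * ?Z"
      by (simp add: sum.distrib sum_distrib_left Z[symmetric])
    also have "\<dots> \<le> (1 + w p) * (?Z * (\<Sum>p\<in>S. w p * l p)) + w p * l p * ((1 + w p) * ?Z)"
      using F w Z0 by (intro add_mono mult_left_mono) (auto simp: distrib_right)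
    finally show ?thesis by (simp add: algebra_simps)
  qed
  ultimately show ?case using insert(1,2) by simp
qed simp

section \<open>Mertens' theorem, mean values and Euler products\<close>

context growth_conditions
begin

text \<open>The sum of \<open>ln (nrm m)\<close> is evaluated twice, each time up to O(X). Directly
  it is \<open>card (M X) * ln X\<close> minus the sum of \<open>ln (X / nrm m)\<close>, which is
  O(X) since \<open>ln u \<le> 2 * sqrt u\<close>. By the Legendre formula and (G1) it is
  \<open>a * X\<close> times the sum in question, with an error controlled by the weights
  \<open>(X / pnorm q) powr b\<close>; both dyadic bounds rest on an exponent below 1. Division by
  \<open>a * X\<close> gives the claim.\<close>

lemma mertens:
  obtains C where "0 \<le> C" "\<And>X. 1 \<le> X \<Longrightarrow> \<bar>(\<Sum>q\<in>Q X. \<Lambda> q / pnorm q) - ln X\<bar> \<le> C"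
proof -
  obtain a b B where ab: "0 < a" "0 \<le> b" "b < 1" "0 \<le> B"
    "\<And>t. 1 \<le> t \<Longrightarrow> \<bar>real (card (M t)) - a * t\<bar> \<le> B * t powr b"
    using count_asymptotics by blast
  have pb: "t powr b \<le> t" if "1 \<le> t" for t :: real
    using powr_mono[of b 1 t] that ab by simp
  have card_le: "real (card (M t)) \<le> (a + B) * t" if "1 \<le> t" for t
    using ab(5)[OF that] mult_left_mono[OF pb[OF that] ab(4)] by (simp add: algebra_simps abs_le_iff)
  obtain C1 where C1: "0 \<le> C1" "\<And>X. 1 \<le> X \<Longrightarrow> (\<Sum>m\<in>M X. (X / nrm m) powr (1/2)) \<le> C1 * X"
  proof -
    have "\<And>t. finite {m. m \<in> free_monoid P \<and> nrm m \<le> t}" using finite_M by (simp add: M_eq)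
    moreover have "\<And>t. 1 \<le> t \<Longrightarrow> (\<Sum>m | m \<in> free_monoid P \<and> nrm m \<le> t. 1) \<le> (a + B) * t"
      using card_le by (simp add: M_eq)
    ultimately show thesis
      using dyadic_sum_bound[of "free_monoid P" "\<lambda>m. nrm m" "\<lambda>_. 1" "a + B" "1/2"] nrm_ge_1 that
      unfolding M_eq[symmetric] by auto
  qed
  obtain C0 where C0: "0 < C0" "\<And>t. 1 \<le> t \<Longrightarrow> (\<Sum>q\<in>Q t. \<Lambda> q) \<le> C0 * t"
    using chebyshev_upper by blast
  obtain C2 where C2: "0 \<le> C2" "\<And>X. 1 \<le> X \<Longrightarrow> (\<Sum>q\<in>Q X. \<Lambda> q * (X / pnorm q) powr b) \<le> C2 * X"
  proof -
    let ?U = "{q. fst q \<in> P \<and> 1 \<le> snd q}"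
    have "q \<in> ?U \<Longrightarrow> 0 \<le> \<Lambda> q \<and> 1 \<le> pnorm q" for q
      using norm_Q[of q "pnorm q"] by (auto simp: Q_eq)
    then show thesis
      using dyadic_sum_bound[of ?U "\<lambda>q. pnorm q" "\<lambda>q. \<Lambda> q" C0 b] finite_Q C0 ab that
      unfolding Q_eq[symmetric] by auto
  qed
  define K where "K = (B / (1 - b) + 2 * C1 + B * C2) / a"
  have "\<bar>(\<Sum>q\<in>Q X. \<Lambda> q / pnorm q) - ln X\<bar> \<le> K" if X: "1 \<le> X" for X
  proof -
    let ?S = "\<Sum>m\<in>M X. ln (nrm m)" and ?R = "\<Sum>m\<in>M X. ln (X / nrm m)"
    have S: "?S = card (M X) * ln X - ?R"
    proof -
      have "?R = (\<Sum>m\<in>M X. ln X - ln (nrm m))"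
        using X by (intro sum.cong refl) (auto simp: ln_div dest!: nrm_M)
      then show ?thesis by (simp add: sum_subtractf)
    qed
    have "0 \<le> ?R" by (intro sum_nonneg ln_ge_zero) (auto dest!: nrm_M)
    moreover have "?R \<le> 2 * (C1 * X)"
    proof -
      have "?R \<le> (\<Sum>m\<in>M X. 2 * (X / nrm m) powr (1/2))"
      proof (rule sum_mono)
        fix m assume "m \<in> M X"
        then have "1 \<le> X / nrm m" using nrm_M[of m X] by (simp add: field_simps)
        then show "ln (X / nrm m) \<le> 2 * (X / nrm m) powr (1/2)"
          using ln_powr_bound[of "X / nrm m" "1/2"] by (simp add: mult.commute)
      qed
      also have "\<dots> \<le> 2 * (C1 * X)"
        using C1(2)[OF X] by (simp add: sum_distrib_left[symmetric])
      finally show ?thesis .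
    qed
    moreover have "\<bar>card (M X) * ln X - a * X * ln X\<bar> \<le> B / (1 - b) * X"
    proof -
      have "\<bar>card (M X) * ln X - a * X * ln X\<bar> = \<bar>card (M X) - a * X\<bar> * ln X"
        using X by (simp add: abs_mult left_diff_distrib[symmetric])
      \<comment> \<open>The saving \<open>X powr (1 - b)\<close> in (G1) pays for the
        logarithm.\<close>
      also have "\<dots> \<le> (B * X powr b) * (X powr (1 - b) / (1 - b))"
        using X ab by (intro mult_mono ln_powr_bound) auto
      also have "\<dots> = B / (1 - b) * (X powr b * X powr (1 - b))" by simp
      also have "X powr b * X powr (1 - b) = X" using X by (simp add: powr_add[symmetric])
      finally show ?thesis .
    qed
    moreover have "\<bar>?S - a * X * (\<Sum>q\<in>Q X. \<Lambda> q / pnorm q)\<bar> \<le> B * (C2 * X)"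
    proof -
      have "?S - a * X * (\<Sum>q\<in>Q X. \<Lambda> q / pnorm q) = (\<Sum>q\<in>Q X. \<Lambda> q * (card (M (X / pnorm q)) - a * (X / pnorm q)))"
        by (simp add: sum_ln_norm sum_distrib_left sum_subtractf algebra_simps)
      also have "\<bar>\<dots>\<bar> \<le> (\<Sum>q\<in>Q X. \<bar>\<Lambda> q * (card (M (X / pnorm q)) - a * (X / pnorm q))\<bar>)"
        by (rule sum_abs)
      also have "\<dots> \<le> (\<Sum>q\<in>Q X. B * (\<Lambda> q * (X / pnorm q) powr b))"
      proof (rule sum_mono)
        fix q assume q: "q \<in> Q X"
        have "1 \<le> X / pnorm q" using norm_Q[OF q] by (simp add: field_simps)
        from mult_left_mono[OF ab(5)[OF this], of "\<Lambda> q"]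
        show "\<bar>\<Lambda> q * (card (M (X / pnorm q)) - a * (X / pnorm q))\<bar> \<le> B * (\<Lambda> q * (X / pnorm q) powr b)"
          using norm_Q[OF q] by (simp add: abs_mult mult_ac)
      qed
      also have "\<dots> \<le> B * (C2 * X)"
        unfolding sum_distrib_left[symmetric] using C2(2)[OF X] ab by (intro mult_left_mono) auto
      finally show ?thesis .
    qed
    ultimately have "\<bar>a * X * (\<Sum>q\<in>Q X. \<Lambda> q / pnorm q) - a * X * ln X\<bar> \<le> B / (1 - b) * X + 2 * (C1 * X) + B * (C2 * X)"
      using S by linarith
    also have "\<dots> = X * (a * K)"
    proof -
      have "a * K = B / (1 - b) + 2 * C1 + B * C2" using ab by (simp add: K_def)
      then show ?thesis by (simp only:) (simp add: algebra_simps)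
    qed
    also have "\<dots> = a * X * K" by simp
    finally have "a * X * \<bar>(\<Sum>q\<in>Q X. \<Lambda> q / pnorm q) - ln X\<bar> \<le> a * X * K"
      using ab X by (simp add: right_diff_distrib[symmetric] abs_mult)
    then show ?thesis using ab X by simp
  qed
  then show thesis using that[of K] ab C1 C2 by (simp add: K_def)
qed

text \<open>Two instances of Mertens' theorem, at \<open>y\<close> and \<open>y / D\<close>, differ
  by at least \<open>ln D - 2 * C\<close>, which the choice of \<open>D\<close> makes equal to 1. So
  the prime powers between \<open>y / D\<close> and \<open>y\<close> have reciprocal weight at least
  1, and each reciprocal norm there is at most \<open>D / y\<close>.\<close>

lemma chebyshev_lower:
  obtains c y0 where "0 < c" "1 \<le> y0" "\<And>y. y0 \<le> y \<Longrightarrow> c * y \<le> (\<Sum>q\<in>Q y. \<Lambda> q)"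
proof -
  obtain C where C: "0 \<le> C" "\<And>X. 1 \<le> X \<Longrightarrow> \<bar>(\<Sum>q\<in>Q X. \<Lambda> q / pnorm q) - ln X\<bar> \<le> C"
    using mertens by blast
  define D where "D = exp (2 * C + 1)"
  have D: "1 \<le> D" using C by (simp add: D_def)
  have "1 / D * y \<le> (\<Sum>q\<in>Q y. \<Lambda> q)" if y: "D \<le> y" for y
  proof -
    have y1: "1 \<le> y / D" "1 \<le> y" using y D by (auto simp: field_simps)
    have "ln (y / D) = ln y - (2 * C + 1)" using y1 D by (simp add: ln_div D_def)
    then have "1 \<le> (\<Sum>q\<in>Q y. \<Lambda> q / pnorm q) - (\<Sum>q\<in>Q (y / D). \<Lambda> q / pnorm q)"
      using C(2)[OF y1(1)] C(2)[OF y1(2)] by linarith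
    also have "\<dots> = (\<Sum>q\<in>Q y - Q (y / D). \<Lambda> q / pnorm q)"
      using y1 D by (intro sum_diff[symmetric] finite_Q Q_mono) (auto simp: field_simps)
    also have "\<dots> \<le> (\<Sum>q\<in>Q y - Q (y / D). \<Lambda> q * (D / y))"
    proof (rule sum_mono)
      fix q assume q: "q \<in> Q y - Q (y / D)"
      then have "y / D \<le> pnorm q" by (auto simp: prime_powers_upto_def)
      then have "1 / pnorm q \<le> D / y" using y1 D norm_Q[of q y] q by (simp add: field_simps)
      then have "\<Lambda> q * (1 / pnorm q) \<le> \<Lambda> q * (D / y)"
        using norm_Q[of q y] q by (intro mult_left_mono) auto
      then show "\<Lambda> q / pnorm q \<le> \<Lambda> q * (D / y)" by simp
    qed
    also have "\<dots> \<le> (\<Sum>q\<in>Q y. \<Lambda> q * (D / y))"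
      using y1 D by (intro sum_mono2 finite_Q) (auto dest!: norm_Q)
    also have "\<dots> = (\<Sum>q\<in>Q y. \<Lambda> q) * (D / y)" by (rule sum_distrib_right[symmetric])
    finally show ?thesis using y1 D by (simp add: field_simps)
  qed
  then show thesis using that[of "1 / D" D] D by simp
qed

text \<open>Write \<open>ln X = ln (nrm m) + ln (X / nrm m)\<close>. The first part becomes a
  convolution whose inner sum is bounded by the Chebyshev-type hypothesis at
  \<open>y = X / nrm n\<close>; the second needs only \<open>ln u \<le> u\<close>. Since
  \<open>y\<close> takes many values in [1, X], \<open>K\<close> has to be uniform there.\<close>

lemma mean_value_upper:
  fixes h :: "'p multiset \<Rightarrow> real"
  assumes X: "1 \<le> X"
    and h: "\<And>n. n \<in> free_monoid P \<Longrightarrow> 0 \<le> h n"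
    and u: "\<And>n p j. n \<in> free_monoid P \<Longrightarrow> p \<in> P \<Longrightarrow> h (n + replicate_mset j p) \<le> u p * h n"
    and K: "\<And>y. 1 \<le> y \<Longrightarrow> y \<le> X \<Longrightarrow> (\<Sum>q\<in>Q y. \<Lambda> q * u (fst q)) \<le> K * y"
  shows "(\<Sum>m\<in>M X. h m) * ln X \<le> (K + 1) * X * (\<Sum>n\<in>M X. h n / nrm n)"
proof -
  have "(\<Sum>m\<in>M X. h m) * ln X = (\<Sum>m\<in>M X. h m * ln (nrm m)) + (\<Sum>m\<in>M X. h m * ln (X / nrm m))"
  proof -
    have "ln X = ln (nrm m) + ln (X / nrm m)" if "m \<in> M X" for m
      using nrm_M[OF that] X by (simp add: ln_div)
    then show ?thesis
      by (simp add: sum.distrib[symmetric] sum_distrib_right distrib_left[symmetric] del: sum.distrib cong: sum.cong)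
  qed
  also have "(\<Sum>m\<in>M X. h m * ln (nrm m)) \<le> (\<Sum>n\<in>M X. K * (X * (h n / nrm n)))"
    unfolding sum_times_ln_norm
  proof (rule sum_mono)
    fix n assume n: "n \<in> M X"
    have n': "1 \<le> nrm n" "nrm n \<le> X" "n \<in> free_monoid P" using nrm_M[OF n] by auto
    have "(\<Sum>q\<in>Q (X / nrm n). \<Lambda> q * h (n + pow q)) \<le> (\<Sum>q\<in>Q (X / nrm n). \<Lambda> q * (u (fst q) * h n))"
    proof (intro sum_mono mult_left_mono)
      fix q assume "q \<in> Q (X / nrm n)"
      from norm_Q[OF this] show "h (n + pow q) \<le> u (fst q) * h n" "0 \<le> \<Lambda> q"
        using u n' by auto
    qed
    also have "\<dots> = (\<Sum>q\<in>Q (X / nrm n). \<Lambda> q * u (fst q)) * h n"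
      by (simp add: sum_distrib_right mult.assoc)
    also have "\<dots> \<le> K * (X / nrm n) * h n"
    proof (intro mult_right_mono K)
      show "1 \<le> X / nrm n" using n' by (simp add: field_simps)
      have "X * 1 \<le> X * nrm n" using n' X by (intro mult_left_mono) auto
      then show "X / nrm n \<le> X" using n' by (simp add: divide_le_eq)
    qed (use h n' in auto)
    finally show "(\<Sum>q\<in>Q (X / nrm n). \<Lambda> q * h (n + pow q)) \<le> K * (X * (h n / nrm n))"
      by (simp add: mult_ac)
  qed
  also have "(\<Sum>m\<in>M X. h m * ln (X / nrm m)) \<le> (\<Sum>m\<in>M X. X * (h m / nrm m))"
  proof (rule sum_mono)
    fix m assume "m \<in> M X"
    note m = nrm_M[OF this]
    have "ln (X / nrm m) \<le> X / nrm m" using m X by (intro less_imp_le ln_less_self) auto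
    from mult_left_mono[OF this, of "h m"] show "h m * ln (X / nrm m) \<le> X * (h m / nrm m)"
      using h m by (simp add: mult_ac)
  qed
  finally have "(\<Sum>m\<in>M X. h m) * ln X
      \<le> K * (X * (\<Sum>n\<in>M X. h n / nrm n)) + X * (\<Sum>n\<in>M X. h n / nrm n)"
    by (simp only: sum_distrib_left[symmetric])
  then show ?thesis by (simp add: algebra_simps)
qed

text \<open>Only the \<open>n\<close> of norm at most \<open>sqrt X\<close> are kept, by
  nonnegativity: for these \<open>X / nrm n\<close> lies between \<open>sqrt X\<close> and
  \<open>X\<close>, the range in which a lower Chebyshev bound is available.\<close>

lemma mean_value_lower:
  fixes h :: "'p multiset \<Rightarrow> real"
  assumes X: "1 \<le> X"
    and h: "\<And>n. n \<in> free_monoid P \<Longrightarrow> 0 \<le> h n"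
    and u: "\<And>n p j. n \<in> free_monoid P \<Longrightarrow> p \<in> P \<Longrightarrow> u p * h n \<le> h (n + replicate_mset j p)"
    and k: "\<And>y. sqrt X \<le> y \<Longrightarrow> y \<le> X \<Longrightarrow> k * y \<le> (\<Sum>q\<in>Q y. \<Lambda> q * u (fst q))"
  shows "k * X * (\<Sum>n\<in>M (sqrt X). h n / nrm n) \<le> (\<Sum>m\<in>M X. h m) * ln X"
proof -
  have sq: "sqrt X \<le> X" "1 \<le> sqrt X" using X by (auto intro: real_le_lsqrt simp: power2_eq_square)
  have "k * X * (\<Sum>n\<in>M (sqrt X). h n / nrm n) \<le> (\<Sum>n\<in>M (sqrt X). \<Sum>q\<in>Q (X / nrm n). \<Lambda> q * h (n + pow q))"
    unfolding sum_distrib_left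
  proof (rule sum_mono)
    fix n assume n: "n \<in> M (sqrt X)"
    have n': "1 \<le> nrm n" "nrm n \<le> sqrt X" "n \<in> free_monoid P" using nrm_M[OF n] by auto
    have "k * (X / nrm n) * h n \<le> (\<Sum>q\<in>Q (X / nrm n). \<Lambda> q * u (fst q)) * h n"
    proof (intro mult_right_mono k)
      have "sqrt X * nrm n \<le> sqrt X * sqrt X" using n' sq by (intro mult_left_mono) auto
      then show "sqrt X \<le> X / nrm n" using n' X by (simp add: field_simps)
      have "X * 1 \<le> X * nrm n" using n' X by (intro mult_left_mono) auto
      then show "X / nrm n \<le> X" using n' by (simp add: divide_le_eq)
    qed (use h n' in auto)
    also have "\<dots> = (\<Sum>q\<in>Q (X / nrm n). \<Lambda> q * (u (fst q) * h n))"
      by (simp add: sum_distrib_right mult.assoc)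
    also have "\<dots> \<le> (\<Sum>q\<in>Q (X / nrm n). \<Lambda> q * h (n + pow q))"
    proof (intro sum_mono mult_left_mono)
      fix q assume "q \<in> Q (X / nrm n)"
      from norm_Q[OF this] show "u (fst q) * h n \<le> h (n + pow q)" "0 \<le> \<Lambda> q"
        using u n' by auto
    qed
    finally show "k * X * (h n / nrm n) \<le> (\<Sum>q\<in>Q (X / nrm n). \<Lambda> q * h (n + pow q))"
      by (simp add: mult_ac)
  qed
  also have "\<dots> \<le> (\<Sum>n\<in>M X. \<Sum>q\<in>Q (X / nrm n). \<Lambda> q * h (n + pow q))"
  proof (rule sum_mono2)
    show "M (sqrt X) \<subseteq> M X" using sq by (intro M_mono)
    fix n assume n: "n \<in> M X - M (sqrt X)"
    show "0 \<le> (\<Sum>q\<in>Q (X / nrm n). \<Lambda> q * h (n + pow q))"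
    proof (intro sum_nonneg mult_nonneg_nonneg h)
      fix q assume q: "q \<in> Q (X / nrm n)"
      show "0 \<le> \<Lambda> q" using norm_Q[OF q] by simp
      show "n + pow q \<in> free_monoid P"
        using norm_Q[OF q] n nrm_M[of n X] by (simp add: free_monoid_plus_iff free_monoid_replicate)
    qed
  qed (rule finite_M)
  also have "\<dots> = (\<Sum>m\<in>M X. h m * ln (nrm m))" by (rule sum_times_ln_norm[symmetric])
  also have "\<dots> \<le> (\<Sum>m\<in>M X. h m * ln X)"
    using X h by (intro sum_mono mult_left_mono) (auto dest!: nrm_M)
  finally show ?thesis by (simp add: sum_distrib_right)
qed

text \<open>The summand depends on exponents only through the norm, so the local factor at
  \<open>p\<close> is 1 plus \<open>h p\<close> times the geometric series of
  \<open>1 / N p\<close>. Generators dividing an element of \<open>M X\<close> lie in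
  \<open>G X\<close>, which makes the product finite.\<close>

lemma euler_product_upper:
  fixes h :: "'p \<Rightarrow> real"
  assumes h: "\<And>p. p \<in> P \<Longrightarrow> 0 \<le> h p"
  shows "(\<Sum>n\<in>M X. (\<Prod>p\<in>set_mset n. h p) / nrm n) \<le> (\<Prod>p\<in>G X. 1 + h p / (real (N p) - 1))"
proof -
  let ?t = "\<lambda>n. (\<Prod>p\<in>set_mset n. h p) / nrm n"
  \<comment> \<open>An arbitrary finite \<open>F\<close> supported in \<open>S\<close> makes the
    induction possible: deleting the generator \<open>p\<close> from all elements of
    \<open>F\<close> leaves a set of the same kind over a smaller support.\<close>
  have main: "(\<Sum>n\<in>F. ?t n) \<le> (\<Prod>p\<in>S. 1 + h p / (real (N p) - 1))"
    if "finite S" "S \<subseteq> P" "finite F" "\<And>m. m \<in> F \<Longrightarrow> set_mset m \<subseteq> S" for S F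
    using that
  proof (induction S arbitrary: F rule: finite_induct)
    case empty
    then have "F \<subseteq> {{#}}" by auto
    then have "F = {} \<or> F = {{#}}" by blast
    then show ?case by auto
  next
    case (insert p S)
    define u where "u k = (if k = 0 then 1 else h p / real (N p) ^ k)" for k :: nat
    define \<phi> where "\<phi> = filter_mset (\<lambda>x. x \<noteq> p)"
    have hp: "0 \<le> h p" "1 < real (N p)" using insert h norm_ge_2[of p] by auto
    have u0: "0 \<le> u k" for k using hp by (simp add: u_def)
    have t: "?t m = u (count m p) * ?t (\<phi> m)" for m
    proof -
      have m: "m = replicate_mset (count m p) p + \<phi> m"
        by (rule multiset_eqI) (simp add: \<phi>_def)
      have "nrm m = real (N p) ^ count m p * nrm (\<phi> m)"
        by (subst m) (simp add: mnorm_plus mnorm_replicate)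
      moreover have "(\<Prod>q\<in>set_mset m. h q) = (if count m p = 0 then 1 else h p) * (\<Prod>q\<in>set_mset (\<phi> m). h q)"
      proof (cases "p \<in># m")
        case True
        then have "set_mset m = insert p (set_mset (\<phi> m))" by (auto simp: \<phi>_def)
        moreover have "p \<notin># \<phi> m" by (simp add: \<phi>_def)
        ultimately show ?thesis using True by (simp add: count_eq_zero_iff)
      next
        case False
        then have "\<phi> m = m" unfolding \<phi>_def by (intro filter_mset_True filter_mset_eq_conv[THEN iffD2]) auto
        then show ?thesis using False by (simp add: not_in_iff)
      qed
      ultimately show ?thesis
        unfolding u_def by (cases "count m p = 0") (simp_all only: if_True if_False simp_thms div_by_1 power_0 mult_1 times_divide_times_eq)
    qed
    \<comment> \<open>The inserted 0 gives \<open>Max\<close> a meaning when \<open>F\<close> is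
      empty.\<close>
    define K where "K = Max (insert 0 ((\<lambda>m. count m p) ` F))"
    have K: "count m p \<le> K" if "m \<in> F" for m
      using that insert(5) by (simp add: K_def)
    have inj: "inj_on (\<lambda>m. (count m p, \<phi> m)) F"
    proof (rule inj_onI)
      fix m m' assume eq: "(count m p, \<phi> m) = (count m' p, \<phi> m')"
      show "m = m'"
      proof (rule multiset_eqI)
        fix x show "count m x = count m' x"
          using eq by (cases "x = p") (auto simp: \<phi>_def multiset_eq_iff count_filter_mset split: if_splits dest: spec[of _ x])
      qed
    qed
    have t0: "0 \<le> ?t m" if "m \<in> \<phi> ` F" for m
    proof -
      obtain x where x: "x \<in> F" "m = \<phi> x" using \<open>m \<in> \<phi> ` F\<close> by blast
      then have "set_mset m \<subseteq> set_mset x" by (auto simp: \<phi>_def)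
      then have "set_mset m \<subseteq> P" using insert.prems(1) insert.prems(3)[OF x(1)] by blast
      then show ?thesis using h by (intro divide_nonneg_nonneg prod_nonneg) auto
    qed
    \<comment> \<open>An element is determined by its exponent at \<open>p\<close> and the remaining
      part, so \<open>F\<close> embeds into a rectangle over which the sum factorizes.\<close>
    have "(\<Sum>m\<in>F. ?t m) = (\<Sum>(k, n)\<in>(\<lambda>m. (count m p, \<phi> m)) ` F. u k * ?t n)"
      unfolding sum.reindex[OF inj] comp_def prod.case by (intro sum.cong refl t)
    also have "\<dots> \<le> (\<Sum>(k, n)\<in>{..K} \<times> \<phi> ` F. u k * ?t n)"
    proof (rule sum_mono2)
      show "0 \<le> (case b of (k, n) \<Rightarrow> u k * ?t n)"
        if "b \<in> {..K} \<times> \<phi> ` F - (\<lambda>m. (count m p, \<phi> m)) ` F" for b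
        using that u0[of "fst b"] t0[of "snd b"] unfolding case_prod_beta by (intro mult_nonneg_nonneg) auto
    qed (use K insert(5) in auto)
    also have "\<dots> = (\<Sum>k\<le>K. u k) * (\<Sum>n\<in>\<phi> ` F. ?t n)"
      by (simp add: sum_product sum.cartesian_product)
    also have "\<dots> \<le> (1 + h p / (real (N p) - 1)) * (\<Prod>p\<in>S. 1 + h p / (real (N p) - 1))"
    proof (intro mult_mono insert.IH)
      have "(\<Sum>k\<le>K. u k) = 1 + h p * (\<Sum>k = 1..K. 1 / real (N p) ^ k)"
      proof -
        have "{..K} = insert 0 {1..K}" by auto
        moreover have "(\<Sum>k = 1..K. u k) = (\<Sum>k = 1..K. h p * (1 / real (N p) ^ k))"
          by (intro sum.cong) (auto simp: u_def)
        ultimately show ?thesis by (simp add: sum_distrib_left u_def)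
      qed
      then show "(\<Sum>k\<le>K. u k) \<le> 1 + h p / (real (N p) - 1)"
        using mult_left_mono[OF geometric_tail_le[OF hp(2), of K] hp(1)] by simp
      show "0 \<le> (\<Sum>n\<in>\<phi> ` F. ?t n)" using t0 by (rule sum_nonneg)
      show "set_mset m \<subseteq> S" if m: "m \<in> \<phi> ` F" for m
      proof -
        obtain x where "x \<in> F" "m = \<phi> x" using m by blast
        then show ?thesis using insert.prems(3)[of x] by (auto simp: \<phi>_def)
      qed
    qed (use insert hp in auto)
    finally show ?case using insert(1,2) by simp
  qed
  have "set_mset m \<subseteq> G X" if m: "m \<in> M X" for m
  proof
    fix p assume p: "p \<in># m"
    have "m \<noteq> {#}" using p by auto
    obtain n where n: "m = add_mset p n" using p by (meson mset_add)
    have f: "n \<in> free_monoid P" "p \<in> P" using m n by (auto simp: monoid_upto_def free_monoid_def)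
    have "real (N p) * 1 \<le> real (N p) * nrm n" using nrm_ge_1[OF f(1)] by (intro mult_left_mono) auto
    also have "\<dots> = nrm m" by (simp add: n mnorm_def)
    finally show "p \<in> G X" using m f by (simp add: monoid_upto_def gens_upto_def)
  qed
  moreover have "G X \<subseteq> P" by (auto simp: gens_upto_def)
  ultimately show ?thesis by (intro main finite_G finite_M)
qed

text \<open>
  Squarefree elements suffice here. Under the weights \<open>h\<close> the mean of the logarithm of
  the norm is at most half of \<open>ln Y\<close>, so the elements beyond \<open>Y\<close> carry at most half of the mass.
\<close>

lemma euler_product_lower:
  fixes h :: "'p \<Rightarrow> real"
  assumes h: "\<And>p. p \<in> P \<Longrightarrow> 0 \<le> h p" and Y: "1 < Y"
    and le: "2 * (\<Sum>p\<in>G z. h p / real (N p) * ln (real (N p))) \<le> ln Y"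
  shows "(\<Prod>p\<in>G z. 1 + h p / real (N p)) \<le> 2 * (\<Sum>n\<in>M Y. (\<Prod>p\<in>set_mset n. h p) / nrm n)"
proof -
  let ?w = "\<lambda>p. h p / real (N p)" and ?l = "\<lambda>p. ln (real (N p))"
  let ?Z = "\<Prod>p\<in>G z. 1 + ?w p"
  let ?S = "{A. A \<subseteq> G z \<and> (\<Prod>p\<in>A. real (N p)) \<le> Y}"
  have w: "0 \<le> ?w p" "0 \<le> ?l p" if "p \<in> G z" for p using norm_G[OF that] h by auto
  have pow: "(\<Sum>A\<in>Pow (G z). prod ?w A) = ?Z"
    "(\<Sum>A\<in>Pow (G z). prod ?w A * sum ?l A) \<le> ?Z * (\<Sum>p\<in>G z. ?w p * ?l p)"
    using sum_Pow_prod[of "G z" ?w ?l] finite_G w by auto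
  have Z: "0 \<le> ?Z" using w by (intro prod_nonneg) (simp add: add_nonneg_nonneg)
  have A: "finite A" "(\<Prod>p\<in>A. real (N p)) > 0" "sum ?l A = ln (\<Prod>p\<in>A. real (N p))" "0 \<le> prod ?w A" "A \<subseteq> P"
    if A: "A \<subseteq> G z" for A
  proof -
    have p: "p \<in> A \<Longrightarrow> 2 \<le> real (N p)" for p using A norm_G by blast
    show "finite A" using A finite_G finite_subset by blast
    show "(\<Prod>p\<in>A. real (N p)) > 0" using p by (intro prod_pos) fastforce
    show "sum ?l A = ln (\<Prod>p\<in>A. real (N p))"
      using p by (intro ln_prod[symmetric] \<open>finite A\<close>) fastforce
    show "0 \<le> prod ?w A" using A w by (intro prod_nonneg) blast
    show "A \<subseteq> P" using A by (auto simp: gens_upto_def)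
  qed
  \<comment> \<open>Markov's inequality in pointwise form: \<open>1 - sum ?l A / ln Y\<close> is at
    most 1 always, and at most 0 when the norm exceeds \<open>Y\<close>.\<close>
  have "(\<Sum>A\<in>Pow (G z). prod ?w A * (1 - sum ?l A / ln Y)) \<le> (\<Sum>A\<in>Pow (G z). if A \<in> ?S then prod ?w A else 0)"
  proof (rule sum_mono)
    fix A assume "A \<in> Pow (G z)"
    then have AG: "A \<subseteq> G z" by simp
    show "prod ?w A * (1 - sum ?l A / ln Y) \<le> (if A \<in> ?S then prod ?w A else 0)"
    proof (cases "A \<in> ?S")
      case True
      have "0 \<le> sum ?l A" using w AG by (intro sum_nonneg) blast
      then have "prod ?w A * (1 - sum ?l A / ln Y) \<le> prod ?w A * 1"
        using Y A(4)[OF AG] by (intro mult_left_mono) auto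
      then show ?thesis using True by simp
    next
      case False
      then have "ln Y \<le> sum ?l A"
        using AG Y A[OF AG] by simp
      then have "prod ?w A * (1 - sum ?l A / ln Y) \<le> 0"
        using A(4)[OF AG] Y by (simp add: mult_le_0_iff)
      then show ?thesis by (simp only: False if_False)
    qed
  qed
  also have "\<dots> = (\<Sum>A\<in>?S. prod ?w A)"
  proof -
    have "{A \<in> Pow (G z). A \<in> ?S} = ?S" by auto
    then show ?thesis using finite_G by (simp only: sum.inter_filter[symmetric] finite_Pow_iff)
  qed
  also have "\<dots> = (\<Sum>n\<in>mset_set ` ?S. (\<Prod>p\<in>set_mset n. h p) / nrm n)"
  proof (subst sum.reindex)
    show "inj_on mset_set ?S"
      using A(1) by (auto simp: inj_on_def)
    show "(\<Sum>A\<in>?S. prod ?w A) = sum ((\<lambda>n. (\<Prod>p\<in>set_mset n. h p) / nrm n) \<circ> mset_set) ?S"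
      using A(1) by (intro sum.cong refl) (simp add: mnorm_def prod_dividef prod_unfold_prod_mset[symmetric])
  qed
  also have "\<dots> \<le> (\<Sum>n\<in>M Y. (\<Prod>p\<in>set_mset n. h p) / nrm n)"
  proof (rule sum_mono2[OF finite_M])
    show "mset_set ` ?S \<subseteq> M Y"
    proof (intro subsetI, elim imageE)
      fix n B assume "n = mset_set B" "B \<in> ?S"
      then show "n \<in> M Y"
        using A(1,5)[of B] by (simp add: monoid_upto_def free_monoid_def mnorm_def prod_unfold_prod_mset[symmetric])
    qed
    fix n assume "n \<in> M Y - mset_set ` ?S"
    then have "set_mset n \<subseteq> P" by (simp add: monoid_upto_def free_monoid_def)
    then show "0 \<le> (\<Prod>p\<in>set_mset n. h p) / nrm n"
      using h by (intro divide_nonneg_nonneg prod_nonneg) auto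
  qed
  finally have "?Z - (\<Sum>A\<in>Pow (G z). prod ?w A * sum ?l A) / ln Y \<le> (\<Sum>n\<in>M Y. (\<Prod>p\<in>set_mset n. h p) / nrm n)"
    by (simp add: right_diff_distrib sum_subtractf pow(1)) (simp add: sum_divide_distrib)
  moreover have "(\<Sum>A\<in>Pow (G z). prod ?w A * sum ?l A) / ln Y \<le> ?Z / 2"
  proof -
    have "2 * (\<Sum>A\<in>Pow (G z). prod ?w A * sum ?l A) \<le> ?Z * (2 * (\<Sum>p\<in>G z. ?w p * ?l p))"
      using pow(2) by simp
    also have "\<dots> \<le> ?Z * ln Y" using le Z by (rule mult_left_mono)
    finally show ?thesis using Y by (simp add: field_simps)
  qed
  ultimately show ?thesis by simp
qed

end

section \<open>Exponential moments of a strongly additive function\<close>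

text \<open>Additive constants disappear against \<open>L\<close>, even if they depend on
  \<open>e\<close>. This is the form in which all losses of a small power of the logarithm are
  finally discarded.\<close>

lemma tendsto_ratio:
  fixes f L :: "'a \<Rightarrow> real"
  assumes L: "filterlim L at_top F"
    and up: "\<And>e. 0 < e \<Longrightarrow> \<exists>C. \<forall>\<^sub>F x in F. f x \<le> (l + e) * L x + C"
    and lo: "\<And>e. 0 < e \<Longrightarrow> \<exists>C. \<forall>\<^sub>F x in F. (l - e) * L x - C \<le> f x"
  shows "((\<lambda>x. f x / L x) \<longlongrightarrow> l) F"
proof (rule tendstoI)
  fix e :: real assume e: "0 < e"
  obtain C1 where C1: "\<forall>\<^sub>F x in F. f x \<le> (l + e / 2) * L x + C1" using up[of "e / 2"] e by auto
  obtain C2 where C2: "\<forall>\<^sub>F x in F. (l - e / 2) * L x - C2 \<le> f x" using lo[of "e / 2"] e by auto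
  have "\<forall>\<^sub>F x in F. max 0 (max (2 * C1 / e) (2 * C2 / e)) < L x"
    using L unfolding filterlim_at_top_dense by blast
  with C1 C2 show "\<forall>\<^sub>F x in F. dist (f x / L x) l < e"
  proof eventually_elim
    case (elim x)
    then have x: "0 < L x" "2 * C1 < e * L x" "2 * C2 < e * L x"
      using e by (auto simp: field_simps)
    then have "f x < (l + e) * L x" "(l - e) * L x < f x"
      using elim by (auto simp: algebra_simps)
    then have "f x / L x < l + e" "l - e < f x / L x"
      using x by (auto simp: field_simps)
    then show ?case by (simp add: dist_real_def abs_less_iff)
  qed
qed

lemma ln_le_of_le_exp: "0 < x \<Longrightarrow> x \<le> exp y \<Longrightarrow> ln x \<le> y" for x y :: real
  using ln_le_cancel_iff[of x "exp y"] by simp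

lemma ln_one_plus_ge:
  fixes x :: real assumes "0 \<le> x" shows "x - x\<^sup>2 \<le> ln (1 + x)"
proof (cases "x \<le> 1")
  case False
  then have "x * 1 \<le> x * x" by (intro mult_left_mono) auto
  moreover have "0 \<le> ln (1 + x)" using assms by simp
  ultimately show ?thesis by (simp add: power2_eq_square)
qed (use ln_one_plus_pos_lower_bound assms in auto)

lemma lnln_at_top: "filterlim (\<lambda>x::real. ln (ln x)) at_top at_top"
  by real_asymp

section \<open>Euler products in exponential form\<close>

context growth_conditions
begin

text \<open>With \<open>h = 1\<close> this is the denominator in (A2); with \<open>h\<close> the
  exponential of a multiple of \<open>g\<close> it is the numerator of an exponential
  moment.\<close>

definition psum :: "('p \<Rightarrow> real) \<Rightarrow> real \<Rightarrow> real" where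
  "psum h X = (\<Sum>p\<in>G X. h p / real (N p))"

lemma psum_nonneg: "(\<And>p. p \<in> P \<Longrightarrow> 0 \<le> h p) \<Longrightarrow> 0 \<le> psum h X"
  unfolding psum_def by (intro sum_nonneg divide_nonneg_nonneg) (auto dest: norm_G)

text \<open>For unbounded \<open>h\<close> this series may diverge, so it is bounded relative to
  \<open>psum\<close>: generators of norm above \<open>1 / e\<close> gain a factor \<open>e\<close>,
  and the others form a fixed finite sum.\<close>

lemma sum_inverse_square_le:
  assumes h: "\<And>p. p \<in> P \<Longrightarrow> 0 \<le> h p" and e: "0 < e"
  obtains C where "\<And>X. (\<Sum>p\<in>G X. h p / (real (N p))\<^sup>2) \<le> e * psum h X + C"
proof
  fix X
  let ?t = "\<lambda>p. h p / (real (N p))\<^sup>2"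
  have nn: "0 \<le> ?t p" if "p \<in> G Y" for p Y using norm_G[OF that] h by auto
  have "(\<Sum>p\<in>G X. ?t p) \<le> (\<Sum>p\<in>G X. e * (h p / real (N p)) + (if p \<in> G (1 / e) then ?t p else 0))"
  proof (rule sum_mono)
    fix p assume p: "p \<in> G X"
    note N = norm_G[OF p]
    show "?t p \<le> e * (h p / real (N p)) + (if p \<in> G (1 / e) then ?t p else 0)"
    proof (cases "p \<in> G (1 / e)")
      case True
      then show ?thesis using N h[of p] e by simp
    next
      case False
      then have "1 / e < real (N p)" using N by (simp add: gens_upto_def)
      then have "1 / real (N p) \<le> e" using e N by (simp add: field_simps)
      then have "1 / real (N p) * (h p / real (N p)) \<le> e * (h p / real (N p))"
        using N h[of p] by (intro mult_right_mono) auto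
      then show ?thesis using False by (simp add: power2_eq_square)
    qed
  qed
  also have "\<dots> = e * psum h X + (\<Sum>p\<in>G X \<inter> G (1 / e). ?t p)"
    using finite_G by (simp add: sum.distrib sum_distrib_left psum_def sum.inter_restrict)
  also have "(\<Sum>p\<in>G X \<inter> G (1 / e). ?t p) \<le> (\<Sum>p\<in>G (1 / e). ?t p)"
    using nn by (intro sum_mono2 finite_G) auto
  finally show "(\<Sum>p\<in>G X. ?t p) \<le> e * psum h X + (\<Sum>p\<in>G (1 / e). ?t p)" by simp
qed

lemma euler_product_exp_upper:
  assumes h: "\<And>p. p \<in> P \<Longrightarrow> 0 \<le> h p" and e: "0 < e"
  obtains C where "\<And>X. (\<Sum>n\<in>M X. (\<Prod>p\<in>set_mset n. h p) / nrm n) \<le> exp ((1 + e) * psum h X + C)"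
proof -
  obtain C where C: "\<And>X. (\<Sum>p\<in>G X. h p / (real (N p))\<^sup>2) \<le> e / 2 * psum h X + C"
    using sum_inverse_square_le[of h "e / 2"] h e by auto
  have "(\<Sum>n\<in>M X. (\<Prod>p\<in>set_mset n. h p) / nrm n) \<le> exp ((1 + e) * psum h X + 2 * C)" for X
  proof -
    have "(\<Sum>n\<in>M X. (\<Prod>p\<in>set_mset n. h p) / nrm n) \<le> (\<Prod>p\<in>G X. 1 + h p / (real (N p) - 1))"
      using h by (rule euler_product_upper)
    also have "\<dots> \<le> (\<Prod>p\<in>G X. exp (h p / real (N p) + 2 * (h p / (real (N p))\<^sup>2)))"
    proof (intro prod_mono conjI)
      fix p assume p: "p \<in> G X"
      note N = norm_G[OF p]
      have hp: "0 \<le> h p" using h N by simp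
      then show "0 \<le> 1 + h p / (real (N p) - 1)" using N by simp
      \<comment> \<open>The difference of the two reciprocals is 1 / (N(p) (N(p) - 1)), and N(p) >=
        2.\<close>
      have "1 / (real (N p) - 1) \<le> 1 / real (N p) + 2 / (real (N p))\<^sup>2"
        using N by (simp add: field_simps power2_eq_square)
      from mult_left_mono[OF this hp]
      have "h p / (real (N p) - 1) \<le> h p / real (N p) + 2 * (h p / (real (N p))\<^sup>2)"
        by (simp add: algebra_simps)
      then show "1 + h p / (real (N p) - 1) \<le> exp (h p / real (N p) + 2 * (h p / (real (N p))\<^sup>2))"
        using exp_ge_add_one_self order_trans by (meson add_left_mono)
    qed
    also have "\<dots> = exp (psum h X + 2 * (\<Sum>p\<in>G X. h p / (real (N p))\<^sup>2))"
      using finite_G by (simp add: exp_sum[symmetric] sum.distrib sum_distrib_left psum_def)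
    also have "\<dots> \<le> exp ((1 + e) * psum h X + 2 * C)"
      using C[of X] by (simp add: algebra_simps)
    finally show ?thesis .
  qed
  then show thesis by (rule that)
qed

text \<open>Taking the logarithm of the product loses the squares of \<open>h p / N p\<close>. The
  resulting sum with \<open>(h p)\<^sup>2\<close> is harmless because the square of an exponential
  of \<open>g\<close> is again one, so (A2) controls it too.\<close>

lemma euler_product_exp_lower:
  assumes h: "\<And>p. p \<in> P \<Longrightarrow> 0 \<le> h p" and e: "0 < e"
  obtains C where "\<And>z Y. 1 < Y \<Longrightarrow> 2 * (\<Sum>p\<in>G z. h p / real (N p) * ln (real (N p))) \<le> ln Y \<Longrightarrow>
      exp (psum h z - e * psum (\<lambda>p. (h p)\<^sup>2) z - C) \<le> 2 * (\<Sum>n\<in>M Y. (\<Prod>p\<in>set_mset n. h p) / nrm n)"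
proof -
  obtain C where C: "\<And>X. (\<Sum>p\<in>G X. (h p)\<^sup>2 / (real (N p))\<^sup>2) \<le> e * psum (\<lambda>p. (h p)\<^sup>2) X + C"
    using sum_inverse_square_le[of "\<lambda>p. (h p)\<^sup>2" e] e by auto
  have "exp (psum h z - e * psum (\<lambda>p. (h p)\<^sup>2) z - C) \<le> 2 * (\<Sum>n\<in>M Y. (\<Prod>p\<in>set_mset n. h p) / nrm n)"
    if "1 < Y" "2 * (\<Sum>p\<in>G z. h p / real (N p) * ln (real (N p))) \<le> ln Y" for z Y
  proof -
    have "exp (psum h z - e * psum (\<lambda>p. (h p)\<^sup>2) z - C) \<le> exp (psum h z - (\<Sum>p\<in>G z. (h p)\<^sup>2 / (real (N p))\<^sup>2))"
      using C[of z] by simp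
    also have "\<dots> = (\<Prod>p\<in>G z. exp (h p / real (N p) - (h p / real (N p))\<^sup>2))"
      using finite_G by (simp add: exp_sum[symmetric] sum_subtractf psum_def power_divide)
    also have "\<dots> \<le> (\<Prod>p\<in>G z. 1 + h p / real (N p))"
    proof (intro prod_mono conjI)
      fix p assume p: "p \<in> G z"
      have hp: "0 \<le> h p / real (N p)" using norm_G[OF p] h by simp
      then have "exp (h p / real (N p) - (h p / real (N p))\<^sup>2) \<le> exp (ln (1 + h p / real (N p)))"
        unfolding exp_le_cancel_iff by (rule ln_one_plus_ge)
      also have "\<dots> = 1 + h p / real (N p)" using hp by (intro exp_ln) simp
      finally show "exp (h p / real (N p) - (h p / real (N p))\<^sup>2) \<le> 1 + h p / real (N p)" .
    qed simp
    also have "\<dots> \<le> 2 * (\<Sum>n\<in>M Y. (\<Prod>p\<in>set_mset n. h p) / nrm n)"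
      using h that by (rule euler_product_lower)
    finally show ?thesis .
  qed
  then show thesis by (rule that)
qed

section \<open>The sum of 1 / N(p)\<close>

lemma card_M_bounds:
  obtains c C where "0 < c" "0 < C" "\<forall>\<^sub>F X in at_top. c * X \<le> real (card (M X)) \<and> real (card (M X)) \<le> C * X"
proof -
  obtain a b B where ab: "0 < a" "0 \<le> b" "b < 1" "0 \<le> B"
    "\<And>t. 1 \<le> t \<Longrightarrow> \<bar>real (card (M t)) - a * t\<bar> \<le> B * t powr b"
    using count_asymptotics by blast
  have "((\<lambda>t. t powr (b - 1)) \<longlongrightarrow> 0) at_top"
    using ab by (intro tendsto_neg_powr filterlim_ident) auto
  then have "((\<lambda>t. B * t powr (b - 1)) \<longlongrightarrow> B * 0) at_top" by (intro tendsto_intros)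
  then have "\<forall>\<^sub>F t in at_top. B * t powr (b - 1) < a / 2"
    using ab by (intro order_tendstoD) auto
  then have "\<forall>\<^sub>F X in at_top. a / 2 * X \<le> real (card (M X)) \<and> real (card (M X)) \<le> 2 * a * X"
    using eventually_ge_at_top[of 1]
  proof eventually_elim
    case (elim X)
    have "B * X powr b = B * X powr (b - 1) * X" using elim by (simp add: powr_diff)
    also have "\<dots> \<le> a / 2 * X" using elim by (intro mult_right_mono) auto
    finally show ?case using ab(5)[of X] elim ab(1) by (simp add: abs_le_iff)
  qed
  then show thesis using that[of "a / 2" "2 * a"] ab by simp
qed

text \<open>For h = 1 the mean is known and the Euler product is not, so the mean value estimates
  are read backwards: the upper one bounds the sum of 1 / N(p) from below, the lower one bounds it
  from above.\<close>

lemma psum_one_asymptotics: "((\<lambda>X. psum (\<lambda>_. 1) X / ln (ln X)) \<longlongrightarrow> 1) at_top"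
proof (rule tendsto_ratio[OF lnln_at_top])
  obtain ca Ca where ca: "0 < ca" "0 < Ca" "\<forall>\<^sub>F X in at_top. ca * X \<le> real (card (M X)) \<and> real (card (M X)) \<le> Ca * X"
    using card_M_bounds by blast
  have lnpos: "\<forall>\<^sub>F X::real in at_top. 0 < ln X" by real_asymp
  fix e :: real assume e: "0 < e"
  show "\<exists>C. \<forall>\<^sub>F X in at_top. (1 - e) * ln (ln X) - C \<le> psum (\<lambda>_. 1) X"
  proof -
    obtain C0 where C0: "0 < C0" "\<And>t. 1 \<le> t \<Longrightarrow> (\<Sum>q\<in>Q t. \<Lambda> q) \<le> C0 * t"
      using chebyshev_upper by blast
    obtain C where C: "\<And>X. (\<Sum>n\<in>M X. 1 / nrm n) \<le> exp ((1 + e) * psum (\<lambda>_. 1) X + C)"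
      using euler_product_exp_upper[of "\<lambda>_. 1" e] e by auto
    have "\<forall>\<^sub>F X in at_top. 0 < ln (ln (X::real))" by real_asymp
    with ca(3) eventually_ge_at_top[of 1] lnpos
    have "\<forall>\<^sub>F X in at_top. (1 - e) * ln (ln X) - (\<bar>ln (ca / (C0 + 1))\<bar> + \<bar>C\<bar>) \<le> psum (\<lambda>_. 1) X"
    proof eventually_elim
      case (elim X)
      have "(\<Sum>m\<in>M X. 1) * ln X \<le> (C0 + 1) * X * (\<Sum>n\<in>M X. 1 / nrm n)"
        by (rule mean_value_upper[where u = "\<lambda>_. 1"]) (use elim C0 in auto)
      then have "card (M X) * ln X \<le> (C0 + 1) * X * (\<Sum>n\<in>M X. 1 / nrm n)" by simp
      moreover have "ca * X * ln X \<le> card (M X) * ln X" using elim by (intro mult_right_mono) auto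
      ultimately have "ca * X * ln X \<le> (C0 + 1) * X * (\<Sum>n\<in>M X. 1 / nrm n)" by linarith
      then have "ca / (C0 + 1) * ln X \<le> (\<Sum>n\<in>M X. 1 / nrm n)"
      proof -
        assume "ca * X * ln X \<le> (C0 + 1) * X * (\<Sum>n\<in>M X. 1 / nrm n)"
        then have "X * (ca * ln X) \<le> X * ((C0 + 1) * (\<Sum>n\<in>M X. 1 / nrm n))" by (simp only: mult_ac)
        then have "ca * ln X \<le> (C0 + 1) * (\<Sum>n\<in>M X. 1 / nrm n)" using elim by simp
        then show ?thesis using C0 by (simp add: divide_le_eq mult.commute)
      qed
      also have "\<dots> \<le> exp ((1 + e) * psum (\<lambda>_. 1) X + C)" by (rule C)
      finally have "ln (ca / (C0 + 1) * ln X) \<le> (1 + e) * psum (\<lambda>_. 1) X + C"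
        using ca C0 elim by (intro ln_le_of_le_exp) auto
      then have "ln (ca / (C0 + 1)) + ln (ln X) \<le> (1 + e) * psum (\<lambda>_. 1) X + C"
        using ca C0 elim by (subst (asm) ln_mult) auto
      then have "ln (ln X) - (\<bar>ln (ca / (C0 + 1))\<bar> + \<bar>C\<bar>) \<le> (1 + e) * psum (\<lambda>_. 1) X" by linarith
      \<comment> \<open>Division by \<open>1 + e\<close> is replaced by multiplication with
        \<open>1 - e\<close>, as \<open>(1 + e) * (1 - e) \<le> 1\<close>.\<close>
      moreover have "(1 + e) * ((1 - e) * ln (ln X) - (\<bar>ln (ca / (C0 + 1))\<bar> + \<bar>C\<bar>)) \<le> ln (ln X) - (\<bar>ln (ca / (C0 + 1))\<bar> + \<bar>C\<bar>)"
      proof -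
        have "(1 + e) * ((1 - e) * x - y) = x - y - (e * e * x + e * y)" for x y :: real
          by (simp add: algebra_simps)
        moreover have "0 \<le> e * e * ln (ln X) + e * (\<bar>ln (ca / (C0 + 1))\<bar> + \<bar>C\<bar>)"
          using e elim by (intro add_nonneg_nonneg mult_nonneg_nonneg) auto
        ultimately show ?thesis by simp
      qed
      ultimately have "(1 + e) * ((1 - e) * ln (ln X) - (\<bar>ln (ca / (C0 + 1))\<bar> + \<bar>C\<bar>)) \<le> (1 + e) * psum (\<lambda>_. 1) X"
        by linarith
      then show ?case using e by simp
    qed
    then show ?thesis by blast
  qed
  show "\<exists>C. \<forall>\<^sub>F X in at_top. psum (\<lambda>_. 1) X \<le> (1 + e) * ln (ln X) + C"
  proof -
    obtain c y0 where c: "0 < c" "1 \<le> y0" "\<And>y. y0 \<le> y \<Longrightarrow> c * y \<le> (\<Sum>q\<in>Q y. \<Lambda> q)"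
      using chebyshev_lower by blast
    obtain C0 where C0: "0 \<le> C0" "\<And>X. 1 \<le> X \<Longrightarrow> \<bar>(\<Sum>q\<in>Q X. \<Lambda> q / pnorm q) - ln X\<bar> \<le> C0"
      using mertens by blast
    define d where "d = e / (1 + e)"
    have d: "0 < d" "(1 + e) * (1 - d) = 1" using e by (auto simp: d_def field_simps)
    obtain C where C: "\<And>z Y. 1 < Y \<Longrightarrow> 2 * (\<Sum>p\<in>G z. 1 / real (N p) * ln (real (N p))) \<le> ln Y \<Longrightarrow>
      exp (psum (\<lambda>_. 1) z - d * psum (\<lambda>_. 1) z - C) \<le> 2 * (\<Sum>n\<in>M Y. 1 / nrm n)"
      using euler_product_exp_lower[of "\<lambda>_. 1" d] d by auto
    \<comment> \<open>By Mertens' theorem \<open>ln z + C0\<close> bounds the mean of the logarithm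
      of the norm, and \<open>ln (Y z)\<close> is twice that, as \<open>euler_product_lower\<close>
      requires. The mean value estimate is then applied at \<open>(Y z)\<^sup>2\<close>, whose
      square root is \<open>Y z\<close>.\<close>
    define Y where "Y z = exp (2 * (ln z + C0))" for z :: real
    have YX: "filterlim (\<lambda>z. (Y z)\<^sup>2) at_top at_top"
      unfolding Y_def by real_asymp
    have "\<forall>\<^sub>F z in at_top. y0 \<le> Y z" unfolding Y_def by real_asymp
    moreover have "\<forall>\<^sub>F z in at_top. C0 \<le> ln (z::real)" by real_asymp
    moreover note eventually_compose_filterlim[OF ca(3) YX] eventually_gt_at_top[of 1] lnpos
    ultimately have "\<forall>\<^sub>F z in at_top. psum (\<lambda>_. 1) z \<le> (1 + e) * ln (ln z) + (1 + e) * (ln (16 * Ca / c) + C)"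
    proof eventually_elim
      case (elim z)
      have "0 < ln z" using elim by simp
      then have Y1: "1 < Y z" using C0 by (simp add: Y_def add_pos_nonneg)
      have "(\<Sum>p\<in>G z. 1 / real (N p) * ln (real (N p))) \<le> (\<Sum>q\<in>Q z. \<Lambda> q / pnorm q)"
      proof -
        have "(\<Sum>p\<in>G z. 1 / real (N p) * ln (real (N p))) = (\<Sum>q\<in>(\<lambda>p. (p, 1)) ` G z. \<Lambda> q / pnorm q)"
          by (subst sum.reindex) (auto simp: inj_on_def)
        also have "\<dots> \<le> (\<Sum>q\<in>Q z. \<Lambda> q / pnorm q)"
          by (intro sum_mono2 finite_Q) (auto simp: gens_upto_def prime_powers_upto_def dest: norm_ge_2)
        finally show ?thesis .
      qed
      also have "\<dots> \<le> ln z + C0" using C0(2)[of z] elim by linarith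
      finally have "2 * (\<Sum>p\<in>G z. 1 / real (N p) * ln (real (N p))) \<le> ln (Y z)" by (simp add: Y_def)
      from C[OF Y1 this]
      have "exp (psum (\<lambda>_. 1) z - d * psum (\<lambda>_. 1) z - C) \<le> 2 * (\<Sum>n\<in>M (Y z). 1 / nrm n)" .
      also have "\<dots> \<le> 2 * (Ca / c * ln ((Y z)\<^sup>2))"
      proof -
        have X: "sqrt ((Y z)\<^sup>2) = Y z" "1 \<le> (Y z)\<^sup>2" using Y1 by auto
        have "c * (Y z)\<^sup>2 * (\<Sum>n\<in>M (sqrt ((Y z)\<^sup>2)). 1 / nrm n) \<le> (\<Sum>m\<in>M ((Y z)\<^sup>2). 1) * ln ((Y z)\<^sup>2)"
          by (rule mean_value_lower[where u = "\<lambda>_. 1"]) (use X elim c in auto)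
        also have "\<dots> \<le> Ca * (Y z)\<^sup>2 * ln ((Y z)\<^sup>2)"
          using elim X by (simp del: ln_powr add: mult_right_mono)
        finally show ?thesis using X c Y1 by (simp add: field_simps)
      qed
      \<comment> \<open>The logarithm of \<open>(Y z)\<^sup>2\<close> is
        \<open>4 * (ln z + C0)\<close>, and \<open>C0 \<le> ln z\<close> here. Being proportional to
        \<open>ln z\<close>, it leaves only a constant after taking logarithms once more.\<close>
      also have "2 * (Ca / c * ln ((Y z)\<^sup>2)) \<le> 2 * (Ca / c * (8 * ln z))"
        using elim ca(2) c(1) by (intro mult_left_mono) (auto simp: Y_def ln_realpow)
      also have "2 * (Ca / c * (8 * ln z)) = 16 * Ca / c * ln z" by simp
      finally have "psum (\<lambda>_. 1) z - d * psum (\<lambda>_. 1) z - C \<le> ln (16 * Ca / c * ln z)"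
        using ca c elim by (subst ln_ge_iff) auto
      also have "\<dots> = ln (16 * Ca / c) + ln (ln z)" using ca c elim by (subst ln_mult) auto
      finally have "(1 - d) * psum (\<lambda>_. 1) z \<le> ln (ln z) + (ln (16 * Ca / c) + C)" by (simp add: algebra_simps)
      then have "(1 + e) * ((1 - d) * psum (\<lambda>_. 1) z) \<le> (1 + e) * (ln (ln z) + (ln (16 * Ca / c) + C))"
        using e by (intro mult_left_mono) auto
      then show ?case using d(2) by (simp add: mult.assoc[symmetric] distrib_left)
    qed
    then show ?thesis by blast
  qed
qed

end

section \<open>Strong additivity and the limits in (A2)\<close>

locale strongly_additive_function = growth_conditions P N
  for P :: "'p set" and N :: "'p \<Rightarrow> nat" +
  fixes g :: "'p multiset \<Rightarrow> nat" and L :: "real \<Rightarrow> real"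
  assumes additive: "strongly_additive P g"
    and rho_mgf: "\<And>\<theta>. ((\<lambda>X. \<integral>y. exp (\<theta> * y) \<partial>rho_upto P N g X) \<longlongrightarrow> L \<theta>) at_top"
begin

abbreviation "\<gamma> p \<equiv> real (g {#p#})"

lemma g_plus: "m \<in> free_monoid P \<Longrightarrow> n \<in> free_monoid P \<Longrightarrow> coprime_on P m n \<Longrightarrow> g (m + n) = g m + g n"
  using additive by (simp add: strongly_additive_def)

lemma g_power: "p \<in> P \<Longrightarrow> 1 \<le> k \<Longrightarrow> g (replicate_mset k p) = g {#p#}"
  using additive by (simp add: strongly_additive_def)

lemma g_eq_sum: "n \<in> free_monoid P \<Longrightarrow> g n = (\<Sum>p\<in>set_mset n. g {#p#})"
proof (induction "card (set_mset n)" arbitrary: n)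
  case 0
  then have n: "n = {#}" by simp
  \<comment> \<open>The unit is coprime to itself, so its value is twice itself and
    vanishes.\<close>
  have "coprime_on P {#} {#}" by (simp add: coprime_on_def)
  then have "g ({#} + {#}) = g {#} + g {#}"
    using 0 n by (intro g_plus) simp_all
  then show ?case using n by simp
next
  case (Suc k)
  then obtain p where p: "p \<in># n" by (cases "n = {#}") auto
  define m where "m = filter_mset (\<lambda>x. x \<noteq> p) n"
  have n: "n = replicate_mset (count n p) p + m"
    by (rule multiset_eqI) (simp add: m_def)
  have set: "set_mset n = insert p (set_mset m)" "p \<notin># m" using p by (auto simp: m_def)
  have free: "p \<in> P" "m \<in> free_monoid P" using Suc.prems p by (auto simp: free_monoid_def m_def)
  have "card (set_mset m) = k" using Suc.hyps(2) set by simp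
  then have IH: "g m = (\<Sum>p\<in>set_mset m. g {#p#})" using Suc.hyps(1) free by blast
  have "coprime_on P (replicate_mset (count n p) p) m"
    using set(2) by (auto simp: coprime_on_def in_replicate_mset)
  then have "g (replicate_mset (count n p) p + m) = g (replicate_mset (count n p) p) + g m"
    using free by (intro g_plus free_monoid_replicate)
  then have "g n = g (replicate_mset (count n p) p) + g m" using n by simp
  also have "g (replicate_mset (count n p) p) = g {#p#}"
    using free p by (intro g_power) (simp_all add: Suc_le_eq)
  finally show ?case using IH set by simp
qed

lemma exp_g_eq_prod: "n \<in> free_monoid P \<Longrightarrow> exp (\<theta> * real (g n)) = (\<Prod>p\<in>set_mset n. exp (\<theta> * \<gamma> p))"
  by (simp add: g_eq_sum sum_distrib_left exp_sum)

text \<open>A power of \<open>p\<close> adds nothing to \<open>g\<close> if it is trivial or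
  \<open>p\<close> already divides \<open>n\<close>, and adds \<open>g {#p#}\<close> otherwise;
  \<open>\<bar>\<theta>\<bar>\<close> covers both cases and both signs. The bound is independent of
  the exponent \<open>j\<close>.\<close>

lemma exp_g_plus_replicate:
  assumes "n \<in> free_monoid P" "p \<in> P"
  shows "exp (\<theta> * real (g (n + replicate_mset j p))) \<le> exp (\<bar>\<theta>\<bar> * \<gamma> p) * exp (\<theta> * real (g n))" (is ?up)
    and "exp (- \<bar>\<theta>\<bar> * \<gamma> p) * exp (\<theta> * real (g n)) \<le> exp (\<theta> * real (g (n + replicate_mset j p)))" (is ?lo)
proof -
  have free: "n + replicate_mset j p \<in> free_monoid P"
    using assms by (simp add: free_monoid_plus_iff free_monoid_replicate)
  have "g (n + replicate_mset j p) = g n \<or> g (n + replicate_mset j p) = g {#p#} + g n"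
  proof (cases "j = 0 \<or> p \<in># n")
    case True
    then have "set_mset (n + replicate_mset j p) = set_mset n" by auto
    then show ?thesis using g_eq_sum[OF free] g_eq_sum[OF assms(1)] by simp
  next
    case False
    then have "set_mset (n + replicate_mset j p) = insert p (set_mset n)" by auto
    then show ?thesis using g_eq_sum[OF free] g_eq_sum[OF assms(1)] False by simp
  qed
  moreover have "\<bar>\<theta> * \<gamma> p\<bar> = \<bar>\<theta>\<bar> * \<gamma> p" by (simp add: abs_mult)
  then have "\<theta> * \<gamma> p \<le> \<bar>\<theta>\<bar> * \<gamma> p" "- (\<bar>\<theta>\<bar> * \<gamma> p) \<le> \<theta> * \<gamma> p" "0 \<le> \<bar>\<theta>\<bar> * \<gamma> p" by linarith+
  ultimately have "\<theta> * real (g (n + replicate_mset j p)) \<le> \<bar>\<theta>\<bar> * \<gamma> p + \<theta> * real (g n)"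
    "- \<bar>\<theta>\<bar> * \<gamma> p + \<theta> * real (g n) \<le> \<theta> * real (g (n + replicate_mset j p))"
    by (auto simp: distrib_left)
  then show ?up ?lo by (simp_all only: exp_add[symmetric] exp_le_cancel_iff)
qed

text \<open>The measure is the image of a weighted point measure on the finite set
  \<open>G X\<close>. If the denominator vanishes, both sides are 0, since division by 0 yields
  0.\<close>

lemma integral_rho_upto:
  "(\<integral>y. exp (\<theta> * y) \<partial>rho_upto P N g X) = psum (\<lambda>p. exp (\<theta> * \<gamma> p)) X / psum (\<lambda>_. 1) X"
proof -
  let ?w = "\<lambda>p. 1 / real (N p) / psum (\<lambda>_. 1) X"
  let ?D = "distr (point_measure (G X) (\<lambda>p. ennreal (?w p))) borel \<gamma>"
  have w: "0 \<le> ?w p" for p by (simp add: psum_nonneg)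
  have rho: "rho_upto P N g X = ?D"
  proof (rule measure_eqI)
    fix B assume "B \<in> sets (rho_upto P N g X)"
    then have B: "B \<in> sets borel" by (simp add: sets_rho_upto)
    let ?S = "{p. p \<in> G X \<and> \<gamma> p \<in> B}"
    have "emeasure ?D B = (\<Sum>p\<in>?S. ennreal (?w p))"
      using B finite_G
      by (subst emeasure_distr)
         (auto simp: space_point_measure emeasure_point_measure_finite2 vimage_def Int_def conj_commute
               measurable_def sets_point_measure)
    also have "\<dots> = ennreal (\<Sum>p\<in>?S. ?w p)"
      using w by (intro sum_ennreal)
    also have "\<dots> = emeasure (rho_upto P N g X) B"
      using emeasure_rho_upto[OF finite_G B] by (simp add: psum_def sum_divide_distrib)
    finally show "emeasure (rho_upto P N g X) B = emeasure ?D B" by simp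
  qed (simp add: sets_rho_upto)
  have "(\<integral>y. exp (\<theta> * y) \<partial>rho_upto P N g X)
      = (\<integral>p. exp (\<theta> * \<gamma> p) \<partial>point_measure (G X) (\<lambda>p. ennreal (?w p)))"
  proof -
    have "\<gamma> \<in> measurable (point_measure (G X) (\<lambda>p. ennreal (?w p))) borel"
      by (auto simp: measurable_def space_point_measure sets_point_measure)
    then show ?thesis unfolding rho by (intro integral_distr) auto
  qed
  also have "\<dots> = (\<Sum>p\<in>G X. ?w p * exp (\<theta> * \<gamma> p))"
    using finite_G w by (subst lebesgue_integral_point_measure_finite) auto
  also have "\<dots> = psum (\<lambda>p. exp (\<theta> * \<gamma> p)) X / psum (\<lambda>_. 1) X"
    by (simp add: psum_def sum_divide_distrib)
  finally show ?thesis .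
qed

lemma psum_exp_asymptotics:
  "((\<lambda>X. psum (\<lambda>p. exp (\<theta> * \<gamma> p)) X / ln (ln X)) \<longlongrightarrow> L \<theta>) at_top"
proof -
  have "((\<lambda>X. (\<integral>y. exp (\<theta> * y) \<partial>rho_upto P N g X) * (psum (\<lambda>_. 1) X / ln (ln X))) \<longlongrightarrow> L \<theta> * 1) at_top"
    by (intro tendsto_mult rho_mgf psum_one_asymptotics)
  \<comment> \<open>Eventually the denominator is nonzero and cancels.\<close>
  moreover have "\<forall>\<^sub>F X in at_top. psum (\<lambda>_. 1) X / ln (ln X) > 0"
    using psum_one_asymptotics by (rule order_tendstoD) simp
  then have "\<forall>\<^sub>F X in at_top. (\<integral>y. exp (\<theta> * y) \<partial>rho_upto P N g X) * (psum (\<lambda>_. 1) X / ln (ln X))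
      = psum (\<lambda>p. exp (\<theta> * \<gamma> p)) X / ln (ln X)"
    by eventually_elim (auto simp: integral_rho_upto)
  ultimately show ?thesis by (simp add: Lim_transform_eventually)
qed

lemma psum_exp_bounds:
  assumes e: "0 < e"
  shows "\<forall>\<^sub>F X in at_top. (L \<theta> - e) * ln (ln X) \<le> psum (\<lambda>p. exp (\<theta> * \<gamma> p)) X \<and>
    psum (\<lambda>p. exp (\<theta> * \<gamma> p)) X \<le> (L \<theta> + e) * ln (ln X)"
proof -
  have "\<forall>\<^sub>F X in at_top. 0 < ln (ln (X :: real))" by real_asymp
  with order_tendstoD[OF psum_exp_asymptotics[of \<theta>], of "L \<theta> - e"]
    order_tendstoD[OF psum_exp_asymptotics[of \<theta>], of "L \<theta> + e"] e
  have "\<forall>\<^sub>F X in at_top. L \<theta> - e < psum (\<lambda>p. exp (\<theta> * \<gamma> p)) X / ln (ln X)"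
    "\<forall>\<^sub>F X in at_top. psum (\<lambda>p. exp (\<theta> * \<gamma> p)) X / ln (ln X) < L \<theta> + e"
    "\<forall>\<^sub>F X in at_top. 0 < ln (ln (X :: real))" by auto
  then show ?thesis by eventually_elim (auto simp: field_simps)
qed

lemma L_nonneg: "0 \<le> L \<theta>"
  using rho_mgf by (rule tendsto_lowerbound) auto

text \<open>
  Generators with \<open>exp (\<bar>\<theta>\<bar> * \<gamma> p) > (ln X) powr e\<close> are negligible by
  Markov's inequality for a high power, since condition (A2) controls every exponential moment.
  Therefore \<open>exp (\<theta> * \<gamma> p)\<close> may be treated as being of size \<open>(ln X) powr o(1)\<close>.
\<close>

lemma large_values_negligible:
  assumes e: "0 < e" and d: "0 < d"
  shows "\<forall>\<^sub>F X in at_top. ln X * psum (\<lambda>p. if exp (e * ln (ln X)) < exp (\<bar>\<theta>\<bar> * \<gamma> p)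
    then exp (\<bar>\<theta>\<bar> * \<gamma> p) else 0) X \<le> d"
proof -
  \<comment> \<open>Above the threshold, exp(a) is at most exp((k + 1) a) times (log X)^(-k e),
    where a = |theta| g(p). With k e >= 2 one factor log X cancels the one in the claim, and the
    other beats the log log X coming from (A2) at \<open>\<theta>'\<close>.\<close>
  define k where "k = nat \<lceil>2 / e\<rceil>"
  have k: "2 \<le> real k * e" using e unfolding k_def by (simp add: pos_divide_le_eq[symmetric])
  define \<theta>' where "\<theta>' = (real k + 1) * \<bar>\<theta>\<bar>"
  have "\<forall>\<^sub>F X in at_top. (L \<theta>' + 1) * ln (ln X) / ln X \<le> (d::real)"
  proof -
    have "((\<lambda>X::real. (L \<theta>' + 1) * (ln (ln X) / ln X)) \<longlongrightarrow> (L \<theta>' + 1) * 0) at_top"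
      by (intro tendsto_mult tendsto_const) real_asymp
    then have "\<forall>\<^sub>F X in at_top. (L \<theta>' + 1) * (ln (ln X) / ln X) < d"
      using d by (intro order_tendstoD) auto
    then show ?thesis by eventually_elim simp
  qed
  moreover have "\<forall>\<^sub>F X in at_top. 1 < ln (X :: real)" by real_asymp
  moreover note psum_exp_bounds[OF zero_less_one, of \<theta>']
  ultimately show ?thesis
  proof eventually_elim
    case (elim X)
    let ?l = "ln (ln X)"
    have l: "0 < ?l" using elim by simp
    have "psum (\<lambda>p. if exp (e * ?l) < exp (\<bar>\<theta>\<bar> * \<gamma> p) then exp (\<bar>\<theta>\<bar> * \<gamma> p) else 0) X
        \<le> (\<Sum>p\<in>G X. exp (- 2 * ?l) * (exp (\<theta>' * \<gamma> p) / real (N p)))"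
      unfolding psum_def
    proof (rule sum_mono)
      fix p assume p: "p \<in> G X"
      let ?a = "\<bar>\<theta>\<bar> * \<gamma> p"
      have "(if exp (e * ?l) < exp ?a then exp ?a else 0) \<le> exp (- 2 * ?l) * exp (\<theta>' * \<gamma> p)"
      proof (cases "e * ?l < ?a")
        case True
        have "2 * ?l \<le> (real k * e) * ?l" using k l by (intro mult_right_mono) auto
        also have "\<dots> = real k * (e * ?l)" by simp
        also have "\<dots> \<le> real k * ?a" using True by (intro mult_left_mono) auto
        finally have "?a \<le> - 2 * ?l + \<theta>' * \<gamma> p" by (simp add: \<theta>'_def algebra_simps)
        then show ?thesis using True by (simp add: exp_add[symmetric])
      qed simp
      from divide_right_mono[OF this, of "real (N p)"]
      show "(if exp (e * ?l) < exp ?a then exp ?a else 0) / real (N p)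
          \<le> exp (- 2 * ?l) * (exp (\<theta>' * \<gamma> p) / real (N p))" by simp
    qed
    also have "\<dots> = exp (- 2 * ?l) * psum (\<lambda>p. exp (\<theta>' * \<gamma> p)) X"
      by (simp add: psum_def sum_distrib_left)
    also have "\<dots> \<le> exp (- 2 * ?l) * ((L \<theta>' + 1) * ?l)"
      using elim by (intro mult_left_mono) auto
    also have "exp (- 2 * ?l) = 1 / (ln X * ln X)"
    proof -
      have "exp (- 2 * ?l) = exp (- ?l) * exp (- ?l)" unfolding exp_add[symmetric] by simp
      moreover have "exp (- ?l) = 1 / ln X" using elim by (simp add: exp_minus inverse_eq_divide)
      ultimately show ?thesis by simp
    qed
    finally have "ln X * psum (\<lambda>p. if exp (e * ?l) < exp (\<bar>\<theta>\<bar> * \<gamma> p) then exp (\<bar>\<theta>\<bar> * \<gamma> p) else 0) X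
        \<le> ln X * (1 / (ln X * ln X) * ((L \<theta>' + 1) * ?l))"
      using elim by (intro mult_left_mono) auto
    also have "\<dots> = (L \<theta>' + 1) * ?l / ln X" using elim by simp
    finally show ?case using elim by linarith
  qed
qed

text \<open>The bound \<open>1 \<le> y / N p\<close> turns an unweighted sum over generators into
  one weighted by reciprocal norms. This wastes a factor \<open>ln X\<close>, which the
  negligibility of large values can afford, and it holds for all \<open>y\<close> up to
  \<open>X\<close> at once.\<close>

lemma large_prime_powers_le:
  assumes y: "1 \<le> y" "y \<le> X"
  shows "(\<Sum>q\<in>Q y. \<Lambda> q * (if T < exp (\<bar>\<theta>\<bar> * \<gamma> (fst q)) then exp (\<bar>\<theta>\<bar> * \<gamma> (fst q)) else 0))
    \<le> y * (ln X * psum (\<lambda>p. if T < exp (\<bar>\<theta>\<bar> * \<gamma> p) then exp (\<bar>\<theta>\<bar> * \<gamma> p) else 0) X)"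
proof -
  let ?f = "\<lambda>p. if T < exp (\<bar>\<theta>\<bar> * \<gamma> p) then exp (\<bar>\<theta>\<bar> * \<gamma> p) else 0"
  have "(\<Sum>q\<in>Q y. \<Lambda> q * ?f (fst q)) \<le> ln y * (\<Sum>p\<in>G y. ?f p)"
    using y by (intro prime_power_sum_le) auto
  also have "\<dots> \<le> ln X * (\<Sum>p\<in>G X. y * (?f p / real (N p)))"
  proof (intro mult_mono)
    have "(\<Sum>p\<in>G y. ?f p) \<le> (\<Sum>p\<in>G y. y * (?f p / real (N p)))"
    proof (rule sum_mono)
      fix p assume p: "p \<in> G y"
      have "1 \<le> y / real (N p)" using norm_G[OF p] by (simp add: field_simps)
      from mult_right_mono[OF this, of "?f p"] show "?f p \<le> y * (?f p / real (N p))" by simp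
    qed
    also have "\<dots> \<le> (\<Sum>p\<in>G X. y * (?f p / real (N p)))"
      using y by (intro sum_mono2 finite_G G_mono) auto
    finally show "(\<Sum>p\<in>G y. ?f p) \<le> (\<Sum>p\<in>G X. y * (?f p / real (N p)))" .
  qed (use y in \<open>auto intro!: sum_nonneg\<close>)
  also have "\<dots> = y * (ln X * psum ?f X)" by (simp add: psum_def sum_distrib_left mult_ac)
  finally show ?thesis .
qed

text \<open>Generators whose weight is at most (log X)^e fall under Chebyshev's bound times that
  factor; the others contribute at most \<open>y\<close>. The threshold depends on \<open>X\<close>
  and not on \<open>y\<close>, since the mean value estimate uses all \<open>y\<close> at
  once.\<close>

lemma weighted_chebyshev_upper:
  assumes e: "0 < e"
  obtains C where "0 < C" "\<forall>\<^sub>F X in at_top. \<forall>y. 1 \<le> y \<longrightarrow> y \<le> X \<longrightarrow>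
    (\<Sum>q\<in>Q y. \<Lambda> q * exp (\<bar>\<theta>\<bar> * \<gamma> (fst q))) \<le> C * exp (e * ln (ln X)) * y"
proof -
  obtain C0 where C0: "0 < C0" "\<And>t. 1 \<le> t \<Longrightarrow> (\<Sum>q\<in>Q t. \<Lambda> q) \<le> C0 * t"
    using chebyshev_upper by blast
  have "\<forall>\<^sub>F X in at_top. 0 < ln (ln (X :: real))" by real_asymp
  with large_values_negligible[OF e zero_less_one, of \<theta>]
  have "\<forall>\<^sub>F X in at_top. \<forall>y. 1 \<le> y \<longrightarrow> y \<le> X \<longrightarrow>
    (\<Sum>q\<in>Q y. \<Lambda> q * exp (\<bar>\<theta>\<bar> * \<gamma> (fst q))) \<le> (C0 + 1) * exp (e * ln (ln X)) * y"
  proof eventually_elim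
    case (elim X)
    let ?T = "exp (e * ln (ln X))"
    let ?f = "\<lambda>p. if ?T < exp (\<bar>\<theta>\<bar> * \<gamma> p) then exp (\<bar>\<theta>\<bar> * \<gamma> p) else 0"
    show ?case
    proof (intro allI impI)
      fix y assume y: "1 \<le> y" "y \<le> X"
      have "(\<Sum>q\<in>Q y. \<Lambda> q * exp (\<bar>\<theta>\<bar> * \<gamma> (fst q))) \<le> (\<Sum>q\<in>Q y. \<Lambda> q * ?T + \<Lambda> q * ?f (fst q))"
        unfolding distrib_left[symmetric] by (intro sum_mono mult_left_mono) (auto dest!: norm_Q)
      also have "\<dots> \<le> C0 * y * ?T + y * (ln X * psum ?f X)"
        unfolding sum.distrib sum_distrib_right[symmetric]
        using y C0 by (intro add_mono large_prime_powers_le mult_right_mono) auto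
      also have "\<dots> \<le> C0 * y * ?T + y * ?T"
      proof (intro add_left_mono mult_left_mono)
        have "1 \<le> ?T" using elim e by simp
        then show "ln X * psum ?f X \<le> ?T" using elim by linarith
      qed (use y in auto)
      finally show "(\<Sum>q\<in>Q y. \<Lambda> q * exp (\<bar>\<theta>\<bar> * \<gamma> (fst q))) \<le> (C0 + 1) * ?T * y"
        by (simp add: algebra_simps)
    qed
  qed
  then show thesis using that[of "C0 + 1"] C0 by simp
qed

text \<open>Generators below the threshold (log X)^e keep a weight of at least (log X)^(-e). Those
  above it account for at most half of the Chebyshev lower bound, which explains
  \<open>c / 2\<close>.\<close>

lemma weighted_chebyshev_lower:
  assumes e: "0 < e"
  obtains c where "0 < c" "\<forall>\<^sub>F X in at_top. \<forall>y. sqrt X \<le> y \<longrightarrow> y \<le> X \<longrightarrow>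
    c * exp (- e * ln (ln X)) * y \<le> (\<Sum>q\<in>Q y. \<Lambda> q * exp (- \<bar>\<theta>\<bar> * \<gamma> (fst q)))"
proof -
  obtain c y0 where c: "0 < c" "1 \<le> y0" "\<And>y. y0 \<le> y \<Longrightarrow> c * y \<le> (\<Sum>q\<in>Q y. \<Lambda> q)"
    using chebyshev_lower by blast
  have "\<forall>\<^sub>F X in at_top. max 1 y0 \<le> sqrt X"
    by (rule filterlim_at_top[THEN iffD1, rule_format, OF sqrt_at_top])
  moreover have "0 < c / 2" using c by simp
  note large_values_negligible[OF e this, of \<theta>]
  ultimately have "\<forall>\<^sub>F X in at_top. \<forall>y. sqrt X \<le> y \<longrightarrow> y \<le> X \<longrightarrow>
    c / 2 * exp (- e * ln (ln X)) * y \<le> (\<Sum>q\<in>Q y. \<Lambda> q * exp (- \<bar>\<theta>\<bar> * \<gamma> (fst q)))"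
  proof eventually_elim
    case (elim X)
    let ?T = "exp (e * ln (ln X))" and ?T' = "exp (- e * ln (ln X))"
    let ?f = "\<lambda>p. if ?T < exp (\<bar>\<theta>\<bar> * \<gamma> p) then exp (\<bar>\<theta>\<bar> * \<gamma> p) else 0"
    show ?case
    proof (intro allI impI)
      fix y assume y: "sqrt X \<le> y" "y \<le> X"
      have "max 1 y0 \<le> y" using elim y by linarith
      then have y1: "1 \<le> y" "y0 \<le> y" by simp_all
      \<comment> \<open>\<open>1 - ?f\<close> stands in for the indicator of the small values: it is
        1 there, and at most 0 on the large ones because \<open>?f\<close> is at least 1.\<close>
      have "(\<Sum>q\<in>Q y. \<Lambda> q * (1 - ?f (fst q))) * ?T' \<le> (\<Sum>q\<in>Q y. \<Lambda> q * exp (- \<bar>\<theta>\<bar> * \<gamma> (fst q)))"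
        unfolding sum_distrib_right mult.assoc
      proof (intro sum_mono mult_left_mono)
        fix q assume "q \<in> Q y"
        show "(1 - ?f (fst q)) * ?T' \<le> exp (- \<bar>\<theta>\<bar> * \<gamma> (fst q))"
        proof (cases "?T < exp (\<bar>\<theta>\<bar> * \<gamma> (fst q))")
          case True
          have "1 \<le> exp (\<bar>\<theta>\<bar> * \<gamma> (fst q))" by simp
          then have "(1 - ?f (fst q)) * ?T' \<le> 0" using True by (intro mult_nonpos_nonneg) auto
          then show ?thesis using exp_ge_zero order_trans by blast
        next
          case False
          then show ?thesis by simp
        qed
        show "0 \<le> \<Lambda> q" using norm_Q[OF \<open>q \<in> Q y\<close>] by simp
      qed
      moreover have "c / 2 * y * ?T' \<le> (\<Sum>q\<in>Q y. \<Lambda> q * (1 - ?f (fst q))) * ?T'"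
      proof (rule mult_right_mono)
        have "(\<Sum>q\<in>Q y. \<Lambda> q * ?f (fst q)) \<le> y * (ln X * psum ?f X)"
          using y1 y by (intro large_prime_powers_le)
        also have "\<dots> \<le> y * (c / 2)" using elim y1 by (intro mult_left_mono) auto
        finally have f: "(\<Sum>q\<in>Q y. \<Lambda> q * ?f (fst q)) \<le> y * (c / 2)" .
        have "(\<Sum>q\<in>Q y. \<Lambda> q * (1 - ?f (fst q))) = (\<Sum>q\<in>Q y. \<Lambda> q) - (\<Sum>q\<in>Q y. \<Lambda> q * ?f (fst q))"
          by (simp only: right_diff_distrib sum_subtractf mult_1_right)
        with f c(3)[OF y1(2)] show "c / 2 * y \<le> (\<Sum>q\<in>Q y. \<Lambda> q * (1 - ?f (fst q)))"
          by (simp only:) (simp add: algebra_simps)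
      qed simp
      moreover have "c / 2 * ?T' * y = c / 2 * y * ?T'" by (simp only: mult_ac)
      ultimately show "c / 2 * ?T' * y \<le> (\<Sum>q\<in>Q y. \<Lambda> q * exp (- \<bar>\<theta>\<bar> * \<gamma> (fst q)))"
        by linarith
    qed
  qed
  then show thesis using that[of "c / 2"] c by simp
qed

section \<open>The moment generating function of W(X)\<close>

definition mean_exp :: "real \<Rightarrow> real \<Rightarrow> real" where
  "mean_exp \<theta> X = (\<Sum>m\<in>M X. exp (\<theta> * real (g m))) / real (card (M X))"

text \<open>Bookkeeping of powers of log X: d from the weighted Chebyshev bound, (1 + d) (L + d)
  from the Euler product and (A2), and -1 from the factor \<open>ln X\<close> on the left of the
  mean value estimate.\<close>

lemma mean_exp_upper:
  assumes e: "0 < e"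
  shows "\<exists>C. \<forall>\<^sub>F X in at_top. ln (mean_exp \<theta> X) \<le> (L \<theta> - 1 + e) * ln (ln X) + C"
proof -
  \<comment> \<open>With d <= 1 the total excess over \<open>L \<theta>\<close> is d (2 + L + d), at
    most d (4 + 2 L).\<close>
  define d where "d = min 1 (e / (4 + 2 * L \<theta>))"
  have L0: "0 \<le> L \<theta>" by (rule L_nonneg)
  have "d \<le> e / (4 + 2 * L \<theta>)" "0 < 4 + 2 * L \<theta>" using L0 by (auto simp: d_def)
  then have d: "d * (4 + 2 * L \<theta>) \<le> e" "0 < d" "d \<le> 1"
    using e by (simp_all add: pos_le_divide_eq) (simp_all add: d_def)
  have "d + (1 + d) * (L \<theta> + d) = L \<theta> + d * (2 + L \<theta> + d)" by (simp add: algebra_simps)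
  also have "d * (2 + L \<theta> + d) \<le> d * (4 + 2 * L \<theta>)" using d L0 by (intro mult_left_mono) auto
  finally have de: "d + (1 + d) * (L \<theta> + d) \<le> L \<theta> + e" using d by linarith
  obtain C1 where C1: "0 < C1" "\<forall>\<^sub>F X in at_top. \<forall>y. 1 \<le> y \<longrightarrow> y \<le> X \<longrightarrow>
    (\<Sum>q\<in>Q y. \<Lambda> q * exp (\<bar>\<theta>\<bar> * \<gamma> (fst q))) \<le> C1 * exp (d * ln (ln X)) * y"
    using weighted_chebyshev_upper[OF d(2)] by blast
  obtain C2 where C2: "\<And>X. (\<Sum>n\<in>M X. (\<Prod>p\<in>set_mset n. exp (\<theta> * \<gamma> p)) / nrm n)
      \<le> exp ((1 + d) * psum (\<lambda>p. exp (\<theta> * \<gamma> p)) X + C2)"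
    using euler_product_exp_upper[of "\<lambda>p. exp (\<theta> * \<gamma> p)" d] d by auto
  obtain c C where c: "0 < c" "0 < C" "\<forall>\<^sub>F X in at_top. c * X \<le> real (card (M X)) \<and> real (card (M X)) \<le> C * X"
    using card_M_bounds by blast
  have "\<forall>\<^sub>F X in at_top. 1 < ln (X :: real)" by real_asymp
  with C1(2) c(3) psum_exp_bounds[OF d(2), of \<theta>] eventually_gt_at_top[of 1]
  have "\<forall>\<^sub>F X in at_top. ln (mean_exp \<theta> X) \<le> (L \<theta> - 1 + e) * ln (ln X) + (ln ((C1 + 1) / c) + C2)"
  proof eventually_elim
    case (elim X)
    let ?l = "ln (ln X)" and ?S = "\<Sum>m\<in>M X. exp (\<theta> * real (g m))"
    have l: "0 < ?l" using elim by simp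
    have S: "0 < ?S" using elim empty_in_M[of X] by (intro sum_pos finite_M) auto
    have card: "0 < card (M X)" using elim empty_in_M[of X] finite_M by (auto simp: card_gt_0_iff)
    have "?S * ln X \<le> (C1 * exp (d * ?l) + 1) * X * (\<Sum>n\<in>M X. exp (\<theta> * real (g n)) / nrm n)"
      using elim exp_g_plus_replicate(1) by (intro mean_value_upper[where u = "\<lambda>p. exp (\<bar>\<theta>\<bar> * \<gamma> p)"]) auto
    also have "(\<Sum>n\<in>M X. exp (\<theta> * real (g n)) / nrm n) = (\<Sum>n\<in>M X. (\<Prod>p\<in>set_mset n. exp (\<theta> * \<gamma> p)) / nrm n)"
      by (intro sum.cong refl) (auto simp: exp_g_eq_prod dest!: nrm_M)
    also have "(C1 * exp (d * ?l) + 1) * X * \<dots> \<le> ((C1 + 1) * exp (d * ?l)) * X * exp ((1 + d) * ((L \<theta> + d) * ?l) + C2)"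
    proof (intro mult_mono)
      have "1 \<le> exp (d * ?l)" using l d by simp
      then show "C1 * exp (d * ?l) + 1 \<le> (C1 + 1) * exp (d * ?l)" by (simp add: distrib_right)
      have "(1 + d) * psum (\<lambda>p. exp (\<theta> * \<gamma> p)) X \<le> (1 + d) * ((L \<theta> + d) * ?l)"
        using elim d by (intro mult_left_mono) auto
      then show "(\<Sum>n\<in>M X. (\<Prod>p\<in>set_mset n. exp (\<theta> * \<gamma> p)) / nrm n) \<le> exp ((1 + d) * ((L \<theta> + d) * ?l) + C2)"
        using C2[of X] by (elim order_trans) simp
    qed (use elim C1 in \<open>auto intro!: sum_nonneg divide_nonneg_nonneg prod_nonneg\<close>)
    also have "\<dots> = (C1 + 1) * X * exp (d * ?l + ((1 + d) * ((L \<theta> + d) * ?l) + C2))"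
      by (simp add: exp_add mult_ac)
    also have "d * ?l + ((1 + d) * ((L \<theta> + d) * ?l) + C2) = (d + (1 + d) * (L \<theta> + d)) * ?l + C2"
      by (simp add: algebra_simps)
    also have "(C1 + 1) * X * exp \<dots> \<le> (C1 + 1) * X * exp ((L \<theta> + e) * ?l + C2)"
      using de l C1 elim by (intro mult_left_mono) (auto intro!: mult_right_mono)
    finally have upper: "?S * ln X \<le> (C1 + 1) * X * exp ((L \<theta> + e) * ?l + C2)" .
    have "mean_exp \<theta> X \<le> ?S / (c * X)"
      unfolding mean_exp_def using elim c S card by (intro divide_left_mono) (auto intro!: mult_pos_pos)
    then have "mean_exp \<theta> X * ln X \<le> ?S / (c * X) * ln X"
      using elim by (intro mult_right_mono) auto
    also have "\<dots> = ?S * ln X / (c * X)" by simp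
    also have "\<dots> \<le> (C1 + 1) * X * exp ((L \<theta> + e) * ?l + C2) / (c * X)"
      using upper elim c by (intro divide_right_mono) auto
    also have "\<dots> = exp (ln ((C1 + 1) / c) + ((L \<theta> + e) * ?l + C2))"
      using elim c C1 by (simp add: exp_add)
    finally have "mean_exp \<theta> X \<le> exp (ln ((C1 + 1) / c) + ((L \<theta> + e) * ?l + C2)) / ln X"
      using elim by (simp add: pos_le_divide_eq)
    also have "\<dots> = exp (ln ((C1 + 1) / c) + ((L \<theta> + e) * ?l + C2) - ?l)"
      using elim by (simp add: exp_diff)
    also have "ln ((C1 + 1) / c) + ((L \<theta> + e) * ?l + C2) - ?l = (L \<theta> - 1 + e) * ?l + (ln ((C1 + 1) / c) + C2)"
      by (simp add: algebra_simps)
    finally show ?case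
      using S card by (intro ln_le_of_le_exp) (auto simp: mean_exp_def intro!: divide_pos_pos)
  qed
  then show ?thesis by blast
qed

lemma mean_exp_lower:
  assumes e: "0 < e"
  shows "\<exists>C. \<forall>\<^sub>F X in at_top. (L \<theta> - 1 - e) * ln (ln X) - C \<le> ln (mean_exp \<theta> X)"
proof -
  let ?h = "\<lambda>p. exp (\<theta> * \<gamma> p)"
  have L0: "0 \<le> L \<theta>" "0 \<le> L (2 * \<theta>)" by (rule L_nonneg)+
  \<comment> \<open>Here the losses are \<open>d\<close> in the limit at \<open>\<theta>\<close>,
    \<open>d * (L (2 * \<theta>) + 1)\<close> from the squares, a factor \<open>1 - d\<close> from
    the cut at \<open>Z\<close>, and \<open>d\<close> from the Chebyshev bound; to first order they
    add up to d (3 + L(theta) + L(2 theta)).\<close>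
  define d where "d = min (1 / 2) (e / (3 + L \<theta> + L (2 * \<theta>)))"
  have "d \<le> e / (3 + L \<theta> + L (2 * \<theta>))" "0 < 3 + L \<theta> + L (2 * \<theta>)" using L0 by (auto simp: d_def)
  then have d: "d * (3 + L \<theta> + L (2 * \<theta>)) \<le> e" "0 < d"
    using e by (simp_all add: pos_le_divide_eq) (simp add: d_def)
  have "d \<le> 1 / 2" unfolding d_def by (rule min.cobounded1)
  note d = d this
  have "0 \<le> d * d" "0 \<le> d * d * L (2 * \<theta>)" using L0 by auto
  moreover have "((L \<theta> - d) - d * (L (2 * \<theta>) + 1)) * (1 - d) - d
      = L \<theta> - d * (3 + L \<theta> + L (2 * \<theta>)) + (2 * (d * d) + d * d * L (2 * \<theta>))"
    by (simp add: algebra_simps)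
  ultimately have de: "L \<theta> - e \<le> ((L \<theta> - d) - d * (L (2 * \<theta>) + 1)) * (1 - d) - d"
    using d(1) by linarith
  obtain k where k: "0 < k" "\<forall>\<^sub>F X in at_top. \<forall>y. sqrt X \<le> y \<longrightarrow> y \<le> X \<longrightarrow>
    k * exp (- d * ln (ln X)) * y \<le> (\<Sum>q\<in>Q y. \<Lambda> q * exp (- \<bar>\<theta>\<bar> * \<gamma> (fst q)))"
    using weighted_chebyshev_lower[OF d(2)] by blast
  obtain C2 where C2: "\<And>z Y. 1 < Y \<Longrightarrow> 2 * (\<Sum>p\<in>G z. ?h p / real (N p) * ln (real (N p))) \<le> ln Y \<Longrightarrow>
      exp (psum ?h z - d * psum (\<lambda>p. (?h p)\<^sup>2) z - C2) \<le> 2 * (\<Sum>n\<in>M Y. (\<Prod>p\<in>set_mset n. ?h p) / nrm n)"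
    using euler_product_exp_lower[of ?h d] d by auto
  have sq: "(\<lambda>p. (?h p)\<^sup>2) = (\<lambda>p. exp (2 * \<theta> * \<gamma> p))"
    by (simp add: power2_eq_square exp_add[symmetric] algebra_simps)
  obtain c C where c: "0 < c" "0 < C" "\<forall>\<^sub>F X in at_top. c * X \<le> real (card (M X)) \<and> real (card (M X)) \<le> C * X"
    using card_M_bounds by blast
  define Z where "Z X = exp ((ln X) powr (1 - d))" for X :: real
  have Z: "filterlim Z at_top at_top" unfolding Z_def using d by real_asymp
  \<comment> \<open>A quarter of \<open>ln X\<close> is the right target:
    \<open>euler_product_lower\<close> doubles it, and \<open>ln (sqrt X)\<close> is half of
    \<open>ln X\<close>.\<close>
  have small: "\<forall>\<^sub>F X in at_top. (ln X) powr (1 - d) * ((L \<theta> + d) * ((1 - d) * ln (ln X))) \<le> ln (X::real) / 4"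
  proof -
    have "((\<lambda>X::real. (L \<theta> + d) * (1 - d) * ((ln X) powr (1 - d) * ln (ln X) / ln X)) \<longlongrightarrow> (L \<theta> + d) * (1 - d) * 0) at_top"
      using d by (intro tendsto_mult tendsto_const) real_asymp
    then have "\<forall>\<^sub>F X::real in at_top. (L \<theta> + d) * (1 - d) * ((ln X) powr (1 - d) * ln (ln X) / ln X) < 1 / 4"
      by (intro order_tendstoD) auto
    moreover have "\<forall>\<^sub>F X in at_top. 0 < ln (X :: real)" by real_asymp
    ultimately show ?thesis by eventually_elim (simp add: field_simps)
  qed
  have "\<forall>\<^sub>F X in at_top. 1 < ln (X :: real)" by real_asymp
  moreover note small k(2) c(3) eventually_gt_at_top[of 1]
    eventually_compose_filterlim[OF psum_exp_bounds[OF d(2), of \<theta>] Z]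
    eventually_compose_filterlim[OF psum_exp_bounds[OF zero_less_one, of "2 * \<theta>"] Z]
  ultimately have "\<forall>\<^sub>F X in at_top. (L \<theta> - 1 - e) * ln (ln X) - (C2 - ln (k / (2 * C))) \<le> ln (mean_exp \<theta> X)"
  proof eventually_elim
    case (elim X)
    let ?l = "ln (ln X)" and ?S = "\<Sum>m\<in>M X. exp (\<theta> * real (g m))"
    have lX: "0 < ln X" and X: "1 < X" and l: "0 < ?l" using elim by auto
    have lZ: "ln (ln (Z X)) = (1 - d) * ?l" "ln (Z X) = ln X powr (1 - d)"
      using lX by (simp_all add: Z_def ln_powr)
    have "(\<Sum>p\<in>G (Z X). ?h p / real (N p) * ln (real (N p))) \<le> ln (Z X) * psum ?h (Z X)"
      \<comment> \<open>Replacing each \<open>ln (N p)\<close> by \<open>ln (Z X)\<close> is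
        affordable, as \<open>ln (Z X)\<close> is already a smaller power of
        \<open>ln X\<close>.\<close>
      unfolding psum_def sum_distrib_left
    proof (rule sum_mono)
      fix p assume "p \<in> G (Z X)"
      note p = norm_G[OF this]
      have "ln (real (N p)) \<le> ln (Z X)" using p by (subst ln_le_cancel_iff) (auto simp: Z_def)
      from mult_left_mono[OF this, of "?h p / real (N p)"]
      show "?h p / real (N p) * ln (real (N p)) \<le> ln (Z X) * (?h p / real (N p))"
        by (simp add: mult.commute)
    qed
    also have "\<dots> \<le> ln (Z X) * ((L \<theta> + d) * ((1 - d) * ?l))"
      using elim lZ by (intro mult_left_mono) auto
    also have "\<dots> \<le> ln X / 4" using elim lZ by simp
    finally have "2 * (\<Sum>p\<in>G (Z X). ?h p / real (N p) * ln (real (N p))) \<le> ln (sqrt X)"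
      using X by (simp add: ln_sqrt)
    with X have E1: "exp (psum ?h (Z X) - d * psum (\<lambda>p. (?h p)\<^sup>2) (Z X) - C2)
        \<le> 2 * (\<Sum>n\<in>M (sqrt X). (\<Prod>p\<in>set_mset n. ?h p) / nrm n)"
      by (intro C2) auto
    have E2: "(L \<theta> - e + d) * ?l - C2 \<le> psum ?h (Z X) - d * psum (\<lambda>p. (?h p)\<^sup>2) (Z X) - C2"
    proof -
      have 1: "(L \<theta> - d) * ((1 - d) * ?l) \<le> psum ?h (Z X)" using elim lZ by simp
      have 2: "d * psum (\<lambda>p. (?h p)\<^sup>2) (Z X) \<le> d * ((L (2 * \<theta>) + 1) * ((1 - d) * ?l))"
        using elim lZ d unfolding sq by (intro mult_left_mono) auto
      have "(L \<theta> - e + d) * ?l \<le> (((L \<theta> - d) - d * (L (2 * \<theta>) + 1)) * (1 - d)) * ?l"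
        using de l by (intro mult_right_mono) auto
      also have "\<dots> = (L \<theta> - d) * ((1 - d) * ?l) - d * ((L (2 * \<theta>) + 1) * ((1 - d) * ?l))"
        by (simp add: algebra_simps)
      finally show ?thesis using 1 2 by linarith
    qed
    have "exp ((L \<theta> - e + d) * ?l - C2) \<le> exp (psum ?h (Z X) - d * psum (\<lambda>p. (?h p)\<^sup>2) (Z X) - C2)"
      using E2 by (simp only: exp_le_cancel_iff)
    also note E1
    also have "(\<Sum>n\<in>M (sqrt X). (\<Prod>p\<in>set_mset n. ?h p) / nrm n) = (\<Sum>n\<in>M (sqrt X). exp (\<theta> * real (g n)) / nrm n)"
      by (intro sum.cong refl) (auto simp: exp_g_eq_prod dest!: nrm_M)
    finally have E: "exp ((L \<theta> - e + d) * ?l - C2) \<le> 2 * (\<Sum>n\<in>M (sqrt X). exp (\<theta> * real (g n)) / nrm n)" .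
    let ?k = "k * exp (- d * ?l)"
    have "?k * X * (\<Sum>n\<in>M (sqrt X). exp (\<theta> * real (g n)) / nrm n) \<le> ?S * ln X"
      using elim exp_g_plus_replicate(2)
      by (intro mean_value_lower[where u = "\<lambda>p. exp (- \<bar>\<theta>\<bar> * \<gamma> p)"]) auto
    moreover have "?k * X * exp ((L \<theta> - e + d) * ?l - C2)
        \<le> ?k * X * (2 * (\<Sum>n\<in>M (sqrt X). exp (\<theta> * real (g n)) / nrm n))"
      using E k X by (intro mult_left_mono) auto
    ultimately have S: "?k * X * exp ((L \<theta> - e + d) * ?l - C2) \<le> 2 * (?S * ln X)" by linarith
    have card: "0 < real (card (M X))" using X empty_in_M[of X] finite_M by (auto simp: card_gt_0_iff)
    have S0: "0 \<le> ?S" by (intro sum_nonneg) simp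
    have "exp (ln (k / (2 * C)) + ((L \<theta> - 1 - e) * ?l - C2))
        = k / (2 * C) * (exp (- d * ?l) * exp ((L \<theta> - e + d) * ?l - C2) * exp (- ?l))"
    proof -
      have "k / (2 * C) = exp (ln (k / (2 * C)))" using k c by simp
      moreover have "ln (k / (2 * C)) + ((L \<theta> - 1 - e) * ?l - C2)
          = ln (k / (2 * C)) + (- d * ?l + ((L \<theta> - e + d) * ?l - C2) + - ?l)"
        by (simp add: algebra_simps)
      ultimately show ?thesis by (simp only: exp_add)
    qed
    also have "exp (- ?l) = 1 / ln X" using lX by (simp add: exp_minus inverse_eq_divide)
    also have "k / (2 * C) * (exp (- d * ?l) * exp ((L \<theta> - e + d) * ?l - C2) * (1 / ln X))
        = (?k * X * exp ((L \<theta> - e + d) * ?l - C2)) / (2 * C * X * ln X)"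
      using X by simp
    also have "\<dots> \<le> 2 * (?S * ln X) / (2 * C * X * ln X)"
      using S c X lX by (intro divide_right_mono) auto
    also have "\<dots> = ?S / (C * X)" using lX by simp
    also have "\<dots> \<le> mean_exp \<theta> X"
      unfolding mean_exp_def using elim card S0 c X by (intro divide_left_mono) auto
    finally have le: "exp (ln (k / (2 * C)) + ((L \<theta> - 1 - e) * ?l - C2)) \<le> mean_exp \<theta> X" .
    then have "0 < mean_exp \<theta> X" using exp_gt_zero less_le_trans by blast
    with le have "ln (k / (2 * C)) + ((L \<theta> - 1 - e) * ?l - C2) \<le> ln (mean_exp \<theta> X)"
      by (simp add: ln_ge_iff)
    then show ?case by simp
  qed
  then show ?thesis by blast
qed

lemma ln_mean_exp_asymptotics:
  "((\<lambda>X. ln (mean_exp \<theta> X) / ln (ln X)) \<longlongrightarrow> L \<theta> - 1) at_top"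
  using mean_exp_upper mean_exp_lower by (intro tendsto_ratio[OF lnln_at_top])

end

section \<open>The large deviation principle\<close>

lemma abs_exp_minus_one_le: "\<bar>exp u - 1\<bar> \<le> \<bar>u\<bar> * exp \<bar>u\<bar>" for u :: real
proof (cases "0 \<le> u")
  case True
  have "exp u * (1 - u) \<le> exp u * exp (- u)"
    using exp_ge_add_one_self[of "- u"] by (intro mult_left_mono) auto
  also have "\<dots> = 1" by (simp add: exp_minus)
  finally show ?thesis using True by (simp add: algebra_simps)
next
  case False
  have "\<bar>exp u - 1\<bar> = 1 - exp u" using False by simp
  also have "\<dots> \<le> \<bar>u\<bar> * 1" using exp_ge_add_one_self[of u] False by linarith
  also have "\<dots> \<le> \<bar>u\<bar> * exp \<bar>u\<bar>" by (intro mult_left_mono) auto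
  finally show ?thesis .
qed

lemma exp_abs_le: "exp (a * \<bar>y\<bar>) \<le> exp (a * y) + exp (- a * y)" for a y :: real
  by (cases "0 \<le> y") auto

context
  fixes \<rho> :: "real measure"
  assumes borel: "sets \<rho> = sets borel"
    and mgf: "\<And>\<theta>::real. integrable \<rho> (\<lambda>y. exp (\<theta> * y))"
begin

lemma measurable_rho: "f \<in> borel_measurable borel \<Longrightarrow> f \<in> borel_measurable \<rho>"
  using borel by (simp cong: measurable_cong_sets)

text \<open>The factor \<open>y\<close> is at most \<open>exp y + exp (- y)\<close> in absolute
  value, hence is paid for by moving the parameter by 1 in both directions.\<close>

lemma integrable_times_exp: "integrable \<rho> (\<lambda>y. y * exp (\<theta> * y))"
proof (rule Bochner_Integration.integrable_bound)
  show "integrable \<rho> (\<lambda>y. exp ((\<theta> + 1) * y) + exp ((\<theta> - 1) * y))"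
    by (intro Bochner_Integration.integrable_add mgf)
  have "norm (y * exp (\<theta> * y)) \<le> norm (exp ((\<theta> + 1) * y) + exp ((\<theta> - 1) * y))" for y
  proof -
    have "\<bar>y\<bar> \<le> exp (1 * \<bar>y\<bar>)" using exp_ge_add_one_self[of "\<bar>y\<bar>"] unfolding mult_1 by linarith
    also have "\<dots> \<le> exp (1 * y) + exp (- 1 * y)" by (rule exp_abs_le)
    finally have "\<bar>y\<bar> * exp (\<theta> * y) \<le> (exp (1 * y) + exp (- 1 * y)) * exp (\<theta> * y)"
      by (intro mult_right_mono) auto
    also have "\<dots> = exp ((\<theta> + 1) * y) + exp ((\<theta> - 1) * y)"
      by (simp add: distrib_right exp_add[symmetric]) (simp add: algebra_simps)
    finally show ?thesis by (simp add: abs_mult)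
  qed
  then show "AE y in \<rho>. norm (y * exp (\<theta> * y)) \<le> norm (exp ((\<theta> + 1) * y) + exp ((\<theta> - 1) * y))" by simp
qed (intro measurable_rho, measurable)

text \<open>The inequality 1 + u <= exp u at \<open>u = (\<theta> - \<eta>) * y\<close>, multiplied
  by \<open>exp (\<eta> * y)\<close> and integrated. The slope found is the derivative of the moment
  generating function at \<open>\<eta>\<close>.\<close>

lemma mgf_subgradient:
  "(\<integral>y. exp (\<eta> * y) \<partial>\<rho>) + (\<theta> - \<eta>) * (\<integral>y. y * exp (\<eta> * y) \<partial>\<rho>) \<le> (\<integral>y. exp (\<theta> * y) \<partial>\<rho>)"
proof -
  have "(\<integral>y. exp (\<eta> * y) \<partial>\<rho>) + (\<theta> - \<eta>) * (\<integral>y. y * exp (\<eta> * y) \<partial>\<rho>)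
      = (\<integral>y. exp (\<eta> * y) + (\<theta> - \<eta>) * (y * exp (\<eta> * y)) \<partial>\<rho>)"
    using mgf integrable_times_exp by simp
  also have "\<dots> \<le> (\<integral>y. exp (\<theta> * y) \<partial>\<rho>)"
  proof (rule integral_mono)
    fix y
    have "exp (\<eta> * y) * (1 + (\<theta> - \<eta>) * y) \<le> exp (\<eta> * y) * exp ((\<theta> - \<eta>) * y)"
      by (intro mult_left_mono exp_ge_add_one_self) simp
    also have "\<dots> = exp (\<theta> * y)" unfolding exp_add[symmetric] by (simp add: algebra_simps)
    finally show "exp (\<eta> * y) + (\<theta> - \<eta>) * (y * exp (\<eta> * y)) \<le> exp (\<theta> * y)"
      by (simp add: algebra_simps)
  qed (use mgf integrable_times_exp in auto)
  finally show ?thesis .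
qed

text \<open>For increments \<open>\<bar>t\<bar> \<le> 1\<close> the integrand changes by at most
  \<open>\<bar>t\<bar>\<close> times an integrable function, so the derivative is Lipschitz at
  \<open>\<theta>\<close>. One \<open>exp \<bar>y\<bar>\<close> bounds the exponential increment and
  another bounds \<open>y\<^sup>2\<close>, hence the parameters \<open>\<theta> + 2\<close> and
  \<open>\<theta> - 2\<close>.\<close>

lemma continuous_on_derivative_mgf: "continuous_on UNIV (\<lambda>\<theta>. \<integral>y. y * exp (\<theta> * y) \<partial>\<rho>)"
proof (intro continuous_at_imp_continuous_on ballI)
  fix \<theta> :: real
  let ?f = "\<lambda>\<theta>. \<integral>y. y * exp (\<theta> * y) \<partial>\<rho>"
  let ?B = "\<lambda>y. 2 * (exp ((\<theta> + 2) * y) + exp ((\<theta> - 2) * y))"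
  have B: "integrable \<rho> ?B" using mgf by auto
  have "norm (?f (\<theta> + t) - ?f \<theta>) \<le> \<bar>t\<bar> * (\<integral>y. ?B y \<partial>\<rho>)" if t: "\<bar>t\<bar> \<le> 1" for t
  proof -
    have "?f (\<theta> + t) - ?f \<theta> = (\<integral>y. y * exp ((\<theta> + t) * y) - y * exp (\<theta> * y) \<partial>\<rho>)"
      using integrable_times_exp by simp
    also have "norm \<dots> \<le> (\<integral>y. norm (y * exp ((\<theta> + t) * y) - y * exp (\<theta> * y)) \<partial>\<rho>)"
      by (rule integral_norm_bound)
    also have "\<dots> \<le> (\<integral>y. \<bar>t\<bar> * ?B y \<partial>\<rho>)"
    proof (rule integral_mono)
      fix y
      have "\<bar>exp (t * y) - 1\<bar> \<le> \<bar>t * y\<bar> * exp \<bar>t * y\<bar>" by (rule abs_exp_minus_one_le)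
      also have "\<dots> \<le> \<bar>t * y\<bar> * exp \<bar>y\<bar>"
        using t mult_right_mono[of "\<bar>t\<bar>" 1 "\<bar>y\<bar>"] by (intro mult_left_mono) (auto simp: abs_mult)
      finally have 1: "\<bar>exp (t * y) - 1\<bar> \<le> \<bar>t\<bar> * \<bar>y\<bar> * exp \<bar>y\<bar>" by (simp add: abs_mult)
      have 2: "\<bar>y\<bar> * \<bar>y\<bar> \<le> 2 * exp \<bar>y\<bar>"
        using exp_lower_Taylor_quadratic[of "\<bar>y\<bar>"] by (simp add: power2_eq_square)
      have "y * exp ((\<theta> + t) * y) - y * exp (\<theta> * y) = exp (\<theta> * y) * y * (exp (t * y) - 1)"
        by (simp add: distrib_right exp_add algebra_simps)
      then have "norm (y * exp ((\<theta> + t) * y) - y * exp (\<theta> * y)) = exp (\<theta> * y) * \<bar>y\<bar> * \<bar>exp (t * y) - 1\<bar>"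
        by (simp add: abs_mult)
      also have "\<dots> \<le> exp (\<theta> * y) * \<bar>y\<bar> * (\<bar>t\<bar> * \<bar>y\<bar> * exp \<bar>y\<bar>)"
        using 1 by (intro mult_left_mono) auto
      also have "\<dots> = exp (\<theta> * y) * \<bar>t\<bar> * exp \<bar>y\<bar> * (\<bar>y\<bar> * \<bar>y\<bar>)" by (simp add: mult_ac)
      also have "\<dots> \<le> exp (\<theta> * y) * \<bar>t\<bar> * exp \<bar>y\<bar> * (2 * exp \<bar>y\<bar>)"
        using 2 by (intro mult_left_mono) auto
      also have "\<dots> = 2 * \<bar>t\<bar> * (exp (\<theta> * y) * exp (2 * \<bar>y\<bar>))"
      proof -
        have "exp (2 * \<bar>y\<bar>) = exp \<bar>y\<bar> * exp \<bar>y\<bar>" unfolding exp_add[symmetric] by simp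
        then show ?thesis by (simp only: mult_ac)
      qed
      also have "\<dots> \<le> 2 * \<bar>t\<bar> * (exp (\<theta> * y) * (exp (2 * y) + exp (- 2 * y)))"
        by (intro mult_left_mono exp_abs_le) auto
      also have "exp (\<theta> * y) * (exp (2 * y) + exp (- 2 * y)) = exp ((\<theta> + 2) * y) + exp ((\<theta> - 2) * y)"
        unfolding distrib_left exp_add[symmetric] by (simp add: algebra_simps)
      also have "2 * \<bar>t\<bar> * (exp ((\<theta> + 2) * y) + exp ((\<theta> - 2) * y)) = \<bar>t\<bar> * ?B y" by simp
      finally show "norm (y * exp ((\<theta> + t) * y) - y * exp (\<theta> * y)) \<le> \<bar>t\<bar> * ?B y" .
    qed (use B integrable_times_exp in auto)
    also have "\<dots> = \<bar>t\<bar> * (\<integral>y. ?B y \<partial>\<rho>)" by (rule integral_mult_right_zero)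
    finally show ?thesis .
  qed
  then have "\<forall>\<^sub>F t in at 0. norm (?f (\<theta> + t) - ?f \<theta>) \<le> \<bar>t\<bar> * (\<integral>y. ?B y \<partial>\<rho>)"
    unfolding eventually_at by (intro exI[of _ 1]) auto
  moreover have "((\<lambda>t. \<bar>t\<bar> * (\<integral>y. ?B y \<partial>\<rho>)) \<longlongrightarrow> 0) (at 0)"
    by (auto intro!: tendsto_eq_intros)
  ultimately have "((\<lambda>t. ?f (\<theta> + t) - ?f \<theta>) \<longlongrightarrow> 0) (at 0)"
    by (rule Lim_null_comparison)
  then show "isCont ?f \<theta>" by (simp add: isCont_iff LIM_zero_iff)
qed

end

theorem theorem1p5:
  fixes P :: "'p set" and N :: "'p \<Rightarrow> nat" and g :: "'p multiset \<Rightarrow> nat"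
    and \<rho> :: "real measure"
  assumes norm_ge_2: "\<And>p. p \<in> P \<Longrightarrow> N p \<ge> 2"
    and G1: "growth_monoid P N"
    and G2: "growth_gens P N"
    and g: "strongly_additive P g"
    and rho_prob: "prob_space \<rho>" and rho_borel: "sets \<rho> = sets borel"
    and A1: "\<And>\<theta>::real. integrable \<rho> (\<lambda>y. exp (\<theta> * y))"
    and A2: "\<And>\<theta>::real. ((\<lambda>X::real. \<integral>y. exp (\<theta> * y) \<partial>rho_upto P N g X)
                \<longlongrightarrow> (\<integral>y. exp (\<theta> * y) \<partial>\<rho>)) at_top"
  shows "large_deviation_principle
           (\<lambda>X. distr (W_pmf P N g X) borel (\<lambda>w. real w / ln (ln (real X))))
           (\<lambda>X. ln (ln (real X)))
           (rate_function \<rho>)"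
proof -
  define L where "L \<theta> = (\<integral>y. exp (\<theta> * y) \<partial>\<rho>)" for \<theta>
  interpret strongly_additive_function P N g L
    by unfold_locales (use assms in \<open>auto simp: L_def\<close>)
  let ?\<mu> = "\<lambda>n. distr (W_pmf P N g n) borel (\<lambda>w. real w / ln (ln (real n)))"
  let ?s = "\<lambda>n. ln (ln (real n))"
  have speed: "filterlim ?s at_top sequentially" by real_asymp
  then have s_pos: "\<forall>\<^sub>F n in sequentially. 0 < ?s n"
    unfolding filterlim_at_top_dense by blast
  \<comment> \<open>The scaling of W and of the parameter cancel as soon as the speed is nonzero.
    For small \<open>n\<close> it is zero or negative, so this is an eventual statement.\<close>
  have mgf_eq: "integrable (?\<mu> n) (\<lambda>y. exp (\<theta> * ?s n * y)) \<and>
      (\<integral>y. exp (\<theta> * ?s n * y) \<partial>?\<mu> n) = mean_exp \<theta> (real n)" if n: "0 < ?s n" "1 \<le> n" for n \<theta>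
  proof -
    have M: "M (real n) \<noteq> {}" "finite (M (real n))" using empty_in_M[of "real n"] n finite_M by auto
    have eq: "exp (\<theta> * ?s n * (real w / ?s n)) = exp (\<theta> * real w)" for w using n by simp
    have "integrable (W_pmf P N g n) (\<lambda>w. exp (\<theta> * real w))"
      using M by (intro integrable_measure_pmf_finite) (simp add: W_pmf_def V_pmf_def)
    then have "integrable (?\<mu> n) (\<lambda>y. exp (\<theta> * ?s n * y))" (is ?int)
      by (subst integrable_distr_eq) (auto simp only: eq intro!: borel_measurable_exp, measurable)
    have "(\<integral>y. exp (\<theta> * ?s n * y) \<partial>?\<mu> n) = (\<integral>w. exp (\<theta> * real w) \<partial>W_pmf P N g n)"
      by (subst integral_distr) (simp_all only: eq, simp_all)
    also have "\<dots> = mean_exp \<theta> (real n)"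
      using M by (simp add: W_pmf_def V_pmf_def integral_pmf_of_set mean_exp_def)
    finally show ?thesis using \<open>?int\<close> by simp
  qed
  have "((\<lambda>n. ln (mean_exp \<theta> (real n)) / ?s n) \<longlongrightarrow> L \<theta> - 1) sequentially" for \<theta>
    using ln_mean_exp_asymptotics filterlim_real_sequentially by (rule filterlim_compose)
  then have lim: "(\<lambda>n. ln (\<integral>y. exp (\<theta> * ?s n * y) \<partial>?\<mu> n) / ?s n) \<longlonglongrightarrow> L \<theta> - 1" for \<theta>
    by (rule Lim_transform_eventually)
      (use s_pos eventually_ge_at_top[of 1] in eventually_elim, simp add: mgf_eq)
  \<comment> \<open>The constant 1 subtracted from \<open>L\<close> is the power of log X by which
    the mean of exp(theta g) falls short of its Euler product.\<close>
  interpret scaled_mgf_limit ?\<mu> ?s "\<lambda>\<theta>. L \<theta> - 1" "\<lambda>\<theta>. \<integral>y. y * exp (\<theta> * y) \<partial>\<rho>"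
  proof (rule scaled_mgf_limit.intro)
    show "prob_space (?\<mu> n)" for n by (intro prob_space.prob_space_distr prob_space_measure_pmf) simp
    show "\<forall>\<^sub>F n in sequentially. integrable (?\<mu> n) (\<lambda>y. exp (\<theta> * ?s n * y))" for \<theta>
      using s_pos eventually_ge_at_top[of 1] by eventually_elim (simp add: mgf_eq)
    show "L \<eta> - 1 + (\<theta> - \<eta>) * (\<integral>y. y * exp (\<eta> * y) \<partial>\<rho>) \<le> L \<theta> - 1" for \<eta> \<theta>
      using mgf_subgradient[OF rho_borel A1, of \<eta> \<theta>] by (simp add: L_def)
    show "continuous_on UNIV (\<lambda>\<theta>. \<integral>y. y * exp (\<theta> * y) \<partial>\<rho>)"
      using rho_borel A1 by (rule continuous_on_derivative_mgf)
  qed (use speed lim in auto)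
  \<comment> \<open>The total mass 1 of \<open>\<rho>\<close> turns the same constant into the
    compensator of the compound Poisson exponent in the rate function.\<close>
  have "(\<integral>y. exp (\<theta> * y) - 1 \<partial>\<rho>) = L \<theta> - 1" for \<theta>
  proof -
    interpret prob_space \<rho> by (rule rho_prob)
    show ?thesis using A1[of \<theta>] by (simp add: L_def prob_space)
  qed
  then have "rate = rate_function \<rho>"
    by (simp add: fun_eq_iff rate_def rate_function_def)
  then show ?thesis using gaertner_ellis by simp
qed

end
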